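(* Let $R$ be a commutative ring and let $H$ be a Hopf algebra over $R$ which is flat as an $R$-module. Consider the Galois connection given by $\psi:\mathrm{Sub}_{gen}(H)\to\mathrm{Quot}_{gen}(H)$, $\psi(K)=H/K^+H$, and $\phi:\mathrm{Quot}_{gen}(H)\to\mathrm{Sub}_{gen}(H)$, $\phi(Q)=H^{co\,Q}$. Then: (i) $Q\in\mathrm{Quot}_{gen}(H)$ is a closed element of this Galois connection if and only if $H/H^{co\,Q}$ is a $Q$-Galois extension; (ii) $K\in\mathrm{Sub}_{gen}(H)$ is a closed element of this Galois connection if and only if $H\to H^K=H/K^+H$ is a $K$-Galois coextension, i.e. the map $$K\otimes H\to H\,\square_{H/K^+H}H,\qquad k\otimes h\mapsto kh_{(1)}\otimes h_{(2)}$$ is an isomorphism.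
   Context: Unadorned $\otimes$ is over $R$. $\mathrm{Sub}_{gen}(H)$ is the poset (under inclusion) of left coideal subalgebras of $H$, i.e. unital subalgebras $K$ with $\Delta(K)\subseteq H\otimes K$; $K^+=K\cap\ker\epsilon$. $\mathrm{Quot}_{gen}(H)$ is the set of quotients $H/I$ by right ideal coideals $I$ (a coideal is a submodule such that $H/I$ is a coalgebra and $H\to H/I$ a coalgebra map), ordered by $H/I\succcurlyeq H/J\Leftrightarrow I\subseteq J$. For $Q$ in it with projection $\pi:H\to Q$, $H^{co\,Q}=\{h\in H:h_{(1)}\otimes\pi(h_{(2)})=h\otimes\pi(1)\}$. $\phi,\psi$ are order-reversing with $K\subseteq\phi\psi(K)$ and $Q\preccurlyeq\psi\phi(Q)$; $K$ is closed if $\phi\psi(K)=K$ and $Q$ is closed if $\psi\phi(Q)=Q$. $H/H^{co\,Q}$ is $Q$-Galois if $\mathrm{can}_Q:H\otimes_{H^{co\,Q}}H\to H\otimes Q$, $h\otimes h'\mapsto hh'_{(1)}\otimes\pi(h'_{(2)})$, is bijective. For a quotient coalgebra $\pi:H\to D$, $H\,\square_DH$ is the equaliser of the two maps $H\otimes H\rightrightarrows H\otimes D\otimes H$, $h\otimes h'\mapsto h_{(1)}\otimes\pi(h_{(2)})\otimes h'$ and $h\otimes h'\mapsto h\otimes\pi(h'_{(1)})\otimes h'_{(2)}$. *)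

theory Defs
  imports "HOL-Algebra.Module" "HOL-Algebra.Subrings" "HOL-Algebra.Galois_Connection"
begin

section \<open>Modules over a commutative ring\<close>

definition linear_map ::
  "('r, 'a) ring_scheme \<Rightarrow> ('r, 'm, 'b) module_scheme \<Rightarrow> ('r, 'n, 'c) module_scheme \<Rightarrow> ('m \<Rightarrow> 'n) set"
  where "linear_map R M N =
    {f \<in> carrier M \<rightarrow> carrier N.
      (\<forall>x\<in>carrier M. \<forall>y\<in>carrier M. f (x \<oplus>\<^bsub>M\<^esub> y) = f x \<oplus>\<^bsub>N\<^esub> f y) \<and>
      (\<forall>a\<in>carrier R. \<forall>x\<in>carrier M. f (a \<odot>\<^bsub>M\<^esub> x) = a \<odot>\<^bsub>N\<^esub> f x)}"

definition linear_iso ::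
  "('r, 'a) ring_scheme \<Rightarrow> ('r, 'm, 'b) module_scheme \<Rightarrow> ('r, 'n, 'c) module_scheme \<Rightarrow> ('m \<Rightarrow> 'n) set"
  where "linear_iso R M N = {f \<in> linear_map R M N. bij_betw f (carrier M) (carrier N)}"

definition regular_module :: "('r, 'a) ring_scheme \<Rightarrow> ('r, 'r) module"
  where "regular_module R =
    \<lparr>carrier = carrier R, monoid.mult = monoid.mult R, monoid.one = monoid.one R, ring.zero = ring.zero R, ring.add = ring.add R, module.smult = monoid.mult R\<rparr>"

definition module_span ::
  "('r, 'a) ring_scheme \<Rightarrow> ('r, 'm, 'b) module_scheme \<Rightarrow> 'm set \<Rightarrow> 'm set"
  where "module_span R M X = \<Inter>{N. submodule N R M \<and> X \<subseteq> N}"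

text \<open>
  Module records extend ring records; the fields for a multiplication that a bare module does not
  have are left undefined. The zero element of the quotient by \<open>N\<close> is the set \<open>N\<close> itself.
\<close>

definition quot_module :: "('r, 'm, 'b) module_scheme \<Rightarrow> 'm set \<Rightarrow> ('r, 'm set) module"
  where "quot_module M N =
    \<lparr>carrier = a_rcosets\<^bsub>M\<^esub> N, monoid.mult = undefined, monoid.one = undefined,
     ring.zero = N, ring.add = (\<lambda>C D. C <+>\<^bsub>M\<^esub> D), module.smult = (\<lambda>a C. \<Union>x\<in>C. N +>\<^bsub>M\<^esub> (a \<odot>\<^bsub>M\<^esub> x))\<rparr>"

definition quot_proj :: "('r, 'm, 'b) module_scheme \<Rightarrow> ('r, 'm set) module \<Rightarrow> 'm \<Rightarrow> 'm set"
  where "quot_proj M Q x = \<zero>\<^bsub>Q\<^esub> +>\<^bsub>M\<^esub> x"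

text \<open>The map that a map constant on cosets induces on the quotient.\<close>

definition quot_lift :: "('m \<Rightarrow> 'n) \<Rightarrow> 'm set \<Rightarrow> 'n"
  where "quot_lift f C = the_elem (f ` C)"


section \<open>Tensor products\<close>

definition free_module :: "('r, 'a) ring_scheme \<Rightarrow> 'x set \<Rightarrow> ('r, 'x \<Rightarrow> 'r) module"
  where "free_module R X =
    \<lparr>carrier = {t. range t \<subseteq> carrier R \<and> finite {x. t x \<noteq> \<zero>\<^bsub>R\<^esub>} \<and> {x. t x \<noteq> \<zero>\<^bsub>R\<^esub>} \<subseteq> X},
     monoid.mult = undefined, monoid.one = undefined,
     ring.zero = (\<lambda>_. \<zero>\<^bsub>R\<^esub>), ring.add = (\<lambda>s t x. s x \<oplus>\<^bsub>R\<^esub> t x), module.smult = (\<lambda>a t x. a \<otimes>\<^bsub>R\<^esub> t x)\<rparr>"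

definition free_basis :: "('r, 'a) ring_scheme \<Rightarrow> 'x \<Rightarrow> 'x \<Rightarrow> 'r"
  where "free_basis R x = (\<lambda>y. if y = x then \<one>\<^bsub>R\<^esub> else \<zero>\<^bsub>R\<^esub>)"

definition tensor_rels ::
  "('r, 'a) ring_scheme \<Rightarrow> ('r, 'm, 'b) module_scheme \<Rightarrow> ('r, 'n, 'c) module_scheme \<Rightarrow> ('m \<times> 'n \<Rightarrow> 'r) set"
  where "tensor_rels R M N =
    (let F = free_module R (carrier M \<times> carrier N); e = (\<lambda>m n. free_basis R (m, n)) in
      {e (m \<oplus>\<^bsub>M\<^esub> m') n \<ominus>\<^bsub>F\<^esub> (e m n \<oplus>\<^bsub>F\<^esub> e m' n) | m m' n.
         m \<in> carrier M \<and> m' \<in> carrier M \<and> n \<in> carrier N}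
      \<union> {e m (n \<oplus>\<^bsub>N\<^esub> n') \<ominus>\<^bsub>F\<^esub> (e m n \<oplus>\<^bsub>F\<^esub> e m n') | m n n'.
         m \<in> carrier M \<and> n \<in> carrier N \<and> n' \<in> carrier N}
      \<union> {e (a \<odot>\<^bsub>M\<^esub> m) n \<ominus>\<^bsub>F\<^esub> a \<odot>\<^bsub>F\<^esub> e m n | a m n.
         a \<in> carrier R \<and> m \<in> carrier M \<and> n \<in> carrier N}
      \<union> {e m (a \<odot>\<^bsub>N\<^esub> n) \<ominus>\<^bsub>F\<^esub> a \<odot>\<^bsub>F\<^esub> e m n | a m n.
         a \<in> carrier R \<and> m \<in> carrier M \<and> n \<in> carrier N})"

definition tensor_kernel ::
  "('r, 'a) ring_scheme \<Rightarrow> ('r, 'm, 'b) module_scheme \<Rightarrow> ('r, 'n, 'c) module_scheme \<Rightarrow> ('m \<times> 'n \<Rightarrow> 'r) set"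
  where "tensor_kernel R M N =
    module_span R (free_module R (carrier M \<times> carrier N)) (tensor_rels R M N)"

definition tensor ::
  "('r, 'a) ring_scheme \<Rightarrow> ('r, 'm, 'b) module_scheme \<Rightarrow> ('r, 'n, 'c) module_scheme
    \<Rightarrow> ('r, ('m \<times> 'n \<Rightarrow> 'r) set) module"
  where "tensor R M N =
    quot_module (free_module R (carrier M \<times> carrier N)) (tensor_kernel R M N)"

definition pure_tensor ::
  "('r, 'a) ring_scheme \<Rightarrow> ('r, 'm, 'b) module_scheme \<Rightarrow> ('r, 'n, 'c) module_scheme
    \<Rightarrow> 'm \<Rightarrow> 'n \<Rightarrow> ('m \<times> 'n \<Rightarrow> 'r) set"
  where "pure_tensor R M N m n =
    tensor_kernel R M N +>\<^bsub>free_module R (carrier M \<times> carrier N)\<^esub> free_basis R (m, n)"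

text \<open>
  For a bilinear \<open>\<beta>\<close>, \<open>tensor_lift R M N P \<beta>\<close> is the linear map \<open>M \<otimes> N \<rightarrow> P\<close> sending the pure
  tensor of \<open>m\<close> and \<open>n\<close> to \<open>\<beta> m n\<close>. It is used below only for bilinear \<open>\<beta>\<close>, so that in particular
  \<open>tensor_lift R H H P (\<lambda>x y. \<beta> x y) (\<Delta> h)\<close> is \<open>\<beta> h\<^sub>(\<^sub>1\<^sub>) h\<^sub>(\<^sub>2\<^sub>)\<close> in Sweedler notation.
\<close>

definition tensor_lift ::
  "('r, 'a) ring_scheme \<Rightarrow> ('r, 'm, 'b) module_scheme \<Rightarrow> ('r, 'n, 'c) module_scheme
    \<Rightarrow> ('r, 'p, 'd) module_scheme \<Rightarrow> ('m \<Rightarrow> 'n \<Rightarrow> 'p) \<Rightarrow> ('m \<times> 'n \<Rightarrow> 'r) set \<Rightarrow> 'p"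
  where "tensor_lift R M N P \<beta> =
    quot_lift (\<lambda>t. \<Oplus>\<^bsub>P\<^esub>p\<in>{p. t p \<noteq> \<zero>\<^bsub>R\<^esub>}. t p \<odot>\<^bsub>P\<^esub> \<beta> (fst p) (snd p))"

definition tensor_map ::
  "('r, 'a) ring_scheme \<Rightarrow> ('r, 'm, 'b) module_scheme \<Rightarrow> ('r, 'n, 'c) module_scheme
    \<Rightarrow> ('r, 'm2, 'd) module_scheme \<Rightarrow> ('r, 'n2, 'e) module_scheme
    \<Rightarrow> ('m \<Rightarrow> 'm2) \<Rightarrow> ('n \<Rightarrow> 'n2) \<Rightarrow> ('m \<times> 'n \<Rightarrow> 'r) set \<Rightarrow> ('m2 \<times> 'n2 \<Rightarrow> 'r) set"
  where "tensor_map R M N M' N' f g =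
    tensor_lift R M N (tensor R M' N') (\<lambda>m n. pure_tensor R M' N' (f m) (g n))"

text \<open>The associativity isomorphism \<open>M \<otimes> (N \<otimes> P) \<rightarrow> (M \<otimes> N) \<otimes> P\<close>.\<close>

definition tensor_assoc ::
  "('r, 'a) ring_scheme \<Rightarrow> ('r, 'm, 'b) module_scheme \<Rightarrow> ('r, 'n, 'c) module_scheme
    \<Rightarrow> ('r, 'p, 'd) module_scheme \<Rightarrow> ('m \<times> ('n \<times> 'p \<Rightarrow> 'r) set \<Rightarrow> 'r) set
    \<Rightarrow> (('m \<times> 'n \<Rightarrow> 'r) set \<times> 'p \<Rightarrow> 'r) set"
  where "tensor_assoc R M N P =
    tensor_lift R M (tensor R N P) (tensor R (tensor R M N) P)
      (\<lambda>m. tensor_map R N P (tensor R M N) P (pure_tensor R M N m) id)"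

text \<open>
  \<open>M\<close> is flat if \<open>M \<otimes> -\<close> preserves injectivity of linear maps \<open>N' \<rightarrow> N\<close>. A formula cannot quantify
  over all types, so the modules \<open>N'\<close> and \<open>N\<close> are those with elements in the type \<open>'x\<close>. If \<open>'r\<close>
  embeds into \<open>'x\<close>, these include, up to isomorphism, all inclusions of ideals \<open>J \<subseteq> R\<close>, for which
  preservation of injectivity already implies flatness; the notion then does not depend on \<open>'x\<close>.
\<close>

definition flat_module ::
  "'x itself \<Rightarrow> ('r, 'a) ring_scheme \<Rightarrow> ('r, 'm, 'b) module_scheme \<Rightarrow> bool"
  where "flat_module _ R M \<longleftrightarrow>
    (\<forall>(N' :: ('r, 'x) module) (N :: ('r, 'x) module) f.
      module R N' \<and> module R N \<and> f \<in> linear_map R N' N \<and> inj_on f (carrier N') \<longrightarrow>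
      inj_on (tensor_map R M N' M N id f) (carrier (tensor R M N')))"


section \<open>Hopf algebras\<close>

locale unital_algebra = module + ring M +
  assumes smult_mult_left:
      "\<lbrakk>a \<in> carrier R; x \<in> carrier M; y \<in> carrier M\<rbrakk> \<Longrightarrow>
        (a \<odot>\<^bsub>M\<^esub> x) \<otimes>\<^bsub>M\<^esub> y = a \<odot>\<^bsub>M\<^esub> (x \<otimes>\<^bsub>M\<^esub> y)"
    and smult_mult_right:
      "\<lbrakk>a \<in> carrier R; x \<in> carrier M; y \<in> carrier M\<rbrakk> \<Longrightarrow>
        x \<otimes>\<^bsub>M\<^esub> (a \<odot>\<^bsub>M\<^esub> y) = a \<odot>\<^bsub>M\<^esub> (x \<otimes>\<^bsub>M\<^esub> y)"

locale coalgebra = module R C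
  for R :: "('r, 'a) ring_scheme" (structure) and C :: "('r, 'c, 'b) module_scheme" (structure) +
  fixes \<Delta> :: "'c \<Rightarrow> ('c \<times> 'c \<Rightarrow> 'r) set" and \<epsilon> :: "'c \<Rightarrow> 'r"
  assumes comult_linear: "\<Delta> \<in> linear_map R C (tensor R C C)"
    and counit_linear: "\<epsilon> \<in> linear_map R C (regular_module R)"
    and coassoc: "c \<in> carrier C \<Longrightarrow>
      tensor_map R C C (tensor R C C) C \<Delta> id (\<Delta> c) =
      tensor_assoc R C C C (tensor_map R C C C (tensor R C C) id \<Delta> (\<Delta> c))"
    and counit_left: "c \<in> carrier C \<Longrightarrow> tensor_lift R C C C (\<lambda>x y. \<epsilon> x \<odot>\<^bsub>C\<^esub> y) (\<Delta> c) = c"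
    and counit_right: "c \<in> carrier C \<Longrightarrow> tensor_lift R C C C (\<lambda>x y. \<epsilon> y \<odot>\<^bsub>C\<^esub> x) (\<Delta> c) = c"

definition coalgebra_hom ::
  "('r, 'a) ring_scheme \<Rightarrow> ('r, 'c, 'b) module_scheme \<Rightarrow> ('c \<Rightarrow> ('c \<times> 'c \<Rightarrow> 'r) set) \<Rightarrow> ('c \<Rightarrow> 'r)
    \<Rightarrow> ('r, 'd, 'e) module_scheme \<Rightarrow> ('d \<Rightarrow> ('d \<times> 'd \<Rightarrow> 'r) set) \<Rightarrow> ('d \<Rightarrow> 'r) \<Rightarrow> ('c \<Rightarrow> 'd) set"
  where "coalgebra_hom R C \<Delta> \<epsilon> D \<Delta>' \<epsilon>' =
    {f \<in> linear_map R C D. \<forall>c\<in>carrier C. \<Delta>' (f c) = tensor_map R C C D D f f (\<Delta> c) \<and> \<epsilon>' (f c) = \<epsilon> c}"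

text \<open>The multiplication of \<open>A \<otimes> A\<close>, \<open>(a \<otimes> b)(c \<otimes> d) = ac \<otimes> bd\<close>.\<close>

definition tensor_mult ::
  "('r, 'a) ring_scheme \<Rightarrow> ('r, 'h, 'b) module_scheme
    \<Rightarrow> ('h \<times> 'h \<Rightarrow> 'r) set \<Rightarrow> ('h \<times> 'h \<Rightarrow> 'r) set \<Rightarrow> ('h \<times> 'h \<Rightarrow> 'r) set"
  where "tensor_mult R A s t =
    tensor_lift R A A (tensor R A A)
      (\<lambda>a b. tensor_map R A A A A (\<lambda>c. a \<otimes>\<^bsub>A\<^esub> c) (\<lambda>d. b \<otimes>\<^bsub>A\<^esub> d) t) s"

locale bialgebra = unital_algebra R H + coalgebra R H \<Delta> \<epsilon>
  for R :: "('r, 'a) ring_scheme" (structure) and H :: "('r, 'h, 'b) module_scheme" (structure)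
    and \<Delta> and \<epsilon> +
  assumes comult_mult: "\<lbrakk>x \<in> carrier H; y \<in> carrier H\<rbrakk> \<Longrightarrow>
      \<Delta> (x \<otimes>\<^bsub>H\<^esub> y) = tensor_mult R H (\<Delta> x) (\<Delta> y)"
    and comult_one: "\<Delta> \<one>\<^bsub>H\<^esub> = pure_tensor R H H \<one>\<^bsub>H\<^esub> \<one>\<^bsub>H\<^esub>"
    and counit_ring_hom: "\<epsilon> \<in> ring_hom H R"

locale hopf_algebra = bialgebra R H \<Delta> \<epsilon>
  for R :: "('r, 'a) ring_scheme" (structure) and H :: "('r, 'h, 'b) module_scheme" (structure)
    and \<Delta> and \<epsilon> +
  fixes S :: "'h \<Rightarrow> 'h"
  assumes antipode_linear: "S \<in> linear_map R H H"
    and antipode_left: "h \<in> carrier H \<Longrightarrow>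
      tensor_lift R H H H (\<lambda>x y. S x \<otimes>\<^bsub>H\<^esub> y) (\<Delta> h) = \<epsilon> h \<odot>\<^bsub>H\<^esub> \<one>\<^bsub>H\<^esub>"
    and antipode_right: "h \<in> carrier H \<Longrightarrow>
      tensor_lift R H H H (\<lambda>x y. x \<otimes>\<^bsub>H\<^esub> S y) (\<Delta> h) = \<epsilon> h \<odot>\<^bsub>H\<^esub> \<one>\<^bsub>H\<^esub>"


section \<open>Left coideal subalgebras and quotients by right ideal coideals\<close>

text \<open>\<open>H \<otimes> K\<close> is regarded inside \<open>H \<otimes> H\<close> as the image of the map induced by the inclusion.\<close>

definition sub_gen ::
  "('r, 'a) ring_scheme \<Rightarrow> ('r, 'h, 'b) module_scheme \<Rightarrow> ('h \<Rightarrow> ('h \<times> 'h \<Rightarrow> 'r) set) \<Rightarrow> 'h set set"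
  where "sub_gen R H \<Delta> =
    {K. subring K H \<and> submodule K R H \<and>
      \<Delta> ` K \<subseteq> tensor_map R H (H\<lparr>carrier := K\<rparr>) H H id id ` carrier (tensor R H (H\<lparr>carrier := K\<rparr>))}"

definition right_ideal :: "'h set \<Rightarrow> ('h, 'b) ring_scheme \<Rightarrow> bool"
  where "right_ideal I H \<longleftrightarrow>
    additive_subgroup I H \<and> (\<forall>x\<in>I. \<forall>h\<in>carrier H. x \<otimes>\<^bsub>H\<^esub> h \<in> I)"

definition coideal ::
  "'h set \<Rightarrow> ('r, 'a) ring_scheme \<Rightarrow> ('r, 'h, 'b) module_scheme
    \<Rightarrow> ('h \<Rightarrow> ('h \<times> 'h \<Rightarrow> 'r) set) \<Rightarrow> ('h \<Rightarrow> 'r) \<Rightarrow> bool"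
  where "coideal I R H \<Delta> \<epsilon> \<longleftrightarrow>
    submodule I R H \<and>
    (\<exists>\<Delta>' \<epsilon>'. coalgebra R (quot_module H I) \<Delta>' \<epsilon>' \<and>
      quot_proj H (quot_module H I) \<in> coalgebra_hom R H \<Delta> \<epsilon> (quot_module H I) \<Delta>' \<epsilon>')"

definition quot_gen ::
  "('r, 'a) ring_scheme \<Rightarrow> ('r, 'h, 'b) module_scheme \<Rightarrow> ('h \<Rightarrow> ('h \<times> 'h \<Rightarrow> 'r) set) \<Rightarrow> ('h \<Rightarrow> 'r)
    \<Rightarrow> ('r, 'h set) module set"
  where "quot_gen R H \<Delta> \<epsilon> = quot_module H ` {I. right_ideal I H \<and> coideal I R H \<Delta> \<epsilon>}"

text \<open>\<open>H/K\<^sup>+H\<close>; as \<open>K\<^sup>+\<close> is an \<open>R\<close>-submodule, the span below is just the set of sums of products.\<close>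

definition quot_of_sub ::
  "('r, 'a) ring_scheme \<Rightarrow> ('r, 'h, 'b) module_scheme \<Rightarrow> ('h \<Rightarrow> 'r) \<Rightarrow> 'h set \<Rightarrow> ('r, 'h set) module"
  where "quot_of_sub R H \<epsilon> K =
    quot_module H (module_span R H
      {k \<otimes>\<^bsub>H\<^esub> h | k h. k \<in> K \<inter> {x \<in> carrier H. \<epsilon> x = \<zero>\<^bsub>R\<^esub>} \<and> h \<in> carrier H})"

definition coinvariants ::
  "('r, 'a) ring_scheme \<Rightarrow> ('r, 'h, 'b) module_scheme \<Rightarrow> ('h \<Rightarrow> ('h \<times> 'h \<Rightarrow> 'r) set)
    \<Rightarrow> ('r, 'h set) module \<Rightarrow> 'h set"
  where "coinvariants R H \<Delta> Q =
    {h \<in> carrier H. tensor_map R H H H Q id (quot_proj H Q) (\<Delta> h) =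
      pure_tensor R H Q h (quot_proj H Q \<one>\<^bsub>H\<^esub>)}"

text \<open>
  The library's Galois connections are monotone, so the second order is the reverse of the order
  on quotients, in which \<open>H/I\<close> is above \<open>H/J\<close> if \<open>I \<subseteq> J\<close>. The lower adjoint is
  \<open>\<psi> K = H/K\<^sup>+H\<close>, the upper adjoint is \<open>\<phi> Q = H\<^sup>c\<^sup>o \<^sup>Q\<close>.
\<close>

definition hopf_galcon ::
  "('r, 'a) ring_scheme \<Rightarrow> ('r, 'h, 'b) module_scheme \<Rightarrow> ('h \<Rightarrow> ('h \<times> 'h \<Rightarrow> 'r) set) \<Rightarrow> ('h \<Rightarrow> 'r)
    \<Rightarrow> ('h set, ('r, 'h set) module) galois"
  where "hopf_galcon R H \<Delta> \<epsilon> =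
    \<lparr>orderA = \<lparr>carrier = sub_gen R H \<Delta>, eq = (=), le = (\<subseteq>)\<rparr>,
     orderB = \<lparr>carrier = quot_gen R H \<Delta> \<epsilon>, eq = (=), le = (\<lambda>Q Q'. \<zero>\<^bsub>Q\<^esub> \<subseteq> \<zero>\<^bsub>Q'\<^esub>)\<rparr>,
     lower = quot_of_sub R H \<epsilon>,
     upper = coinvariants R H \<Delta>\<rparr>"

definition closed_in_A :: "('a, 'b, 'c, 'd) galcon \<Rightarrow> 'a \<Rightarrow> bool"
  where "closed_in_A G x \<longleftrightarrow> x \<in> carrier (orderA G) \<and> upper G (lower G x) = x"

definition closed_in_B :: "('a, 'b, 'c, 'd) galcon \<Rightarrow> 'b \<Rightarrow> bool"
  where "closed_in_B G y \<longleftrightarrow> y \<in> carrier (orderB G) \<and> lower G (upper G y) = y"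


section \<open>Galois extensions and coextensions\<close>

text \<open>
  \<open>H \<otimes>\<^sub>B H\<close> for a subalgebra \<open>B\<close> of \<open>H\<close>, obtained from \<open>H \<otimes> H\<close> by imposing the balancing relations;
  its elements are cosets in \<open>H \<otimes> H\<close>.
\<close>

definition balanced_tensor ::
  "('r, 'a) ring_scheme \<Rightarrow> ('r, 'h, 'b) module_scheme \<Rightarrow> 'h set
    \<Rightarrow> ('r, ('h \<times> 'h \<Rightarrow> 'r) set set) module"
  where "balanced_tensor R H B =
    quot_module (tensor R H H) (module_span R (tensor R H H)
      {pure_tensor R H H (h \<otimes>\<^bsub>H\<^esub> b) h' \<ominus>\<^bsub>tensor R H H\<^esub> pure_tensor R H H h (b \<otimes>\<^bsub>H\<^esub> h') | h b h'.
        h \<in> carrier H \<and> b \<in> B \<and> h' \<in> carrier H})"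

text \<open>\<open>can\<^sub>Q : H \<otimes>\<^sub>B H \<rightarrow> H \<otimes> Q\<close>, \<open>h \<otimes> h' \<mapsto> hh'\<^sub>(\<^sub>1\<^sub>) \<otimes> \<pi>(h'\<^sub>(\<^sub>2\<^sub>))\<close>.\<close>

definition can_map ::
  "('r, 'a) ring_scheme \<Rightarrow> ('r, 'h, 'b) module_scheme \<Rightarrow> ('h \<Rightarrow> ('h \<times> 'h \<Rightarrow> 'r) set)
    \<Rightarrow> ('r, 'h set) module \<Rightarrow> ('h \<times> 'h \<Rightarrow> 'r) set set \<Rightarrow> ('h \<times> 'h set \<Rightarrow> 'r) set"
  where "can_map R H \<Delta> Q =
    quot_lift (tensor_lift R H H (tensor R H Q)
      (\<lambda>h h'. tensor_map R H H H Q (\<lambda>x. h \<otimes>\<^bsub>H\<^esub> x) (quot_proj H Q) (\<Delta> h')))"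

definition galois_extension ::
  "('r, 'a) ring_scheme \<Rightarrow> ('r, 'h, 'b) module_scheme \<Rightarrow> ('h \<Rightarrow> ('h \<times> 'h \<Rightarrow> 'r) set)
    \<Rightarrow> ('r, 'h set) module \<Rightarrow> bool"
  where "galois_extension R H \<Delta> Q \<longleftrightarrow>
    bij_betw (can_map R H \<Delta> Q)
      (carrier (balanced_tensor R H (coinvariants R H \<Delta> Q))) (carrier (tensor R H Q))"

text \<open>\<open>H \<box>\<^sub>D H\<close> as a submodule of \<open>H \<otimes> H\<close>; the two maps are compared in \<open>(H \<otimes> D) \<otimes> H\<close>.\<close>

definition cotensor ::
  "('r, 'a) ring_scheme \<Rightarrow> ('r, 'h, 'b) module_scheme \<Rightarrow> ('h \<Rightarrow> ('h \<times> 'h \<Rightarrow> 'r) set)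
    \<Rightarrow> ('r, 'h set) module \<Rightarrow> ('r, ('h \<times> 'h \<Rightarrow> 'r) set) module"
  where "cotensor R H \<Delta> D =
    (let \<pi> = quot_proj H D in
      (tensor R H H)\<lparr>carrier := {t \<in> carrier (tensor R H H).
        tensor_map R H H (tensor R H D) H (\<lambda>h. tensor_map R H H H D id \<pi> (\<Delta> h)) id t =
        tensor_assoc R H D H
          (tensor_map R H H H (tensor R D H) id (\<lambda>h'. tensor_map R H H D H \<pi> id (\<Delta> h')) t)}\<rparr>)"

text \<open>\<open>K \<otimes> H \<rightarrow> H \<otimes> H\<close>, \<open>k \<otimes> h \<mapsto> kh\<^sub>(\<^sub>1\<^sub>) \<otimes> h\<^sub>(\<^sub>2\<^sub>)\<close>.\<close>

definition cocan_map ::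
  "('r, 'a) ring_scheme \<Rightarrow> ('r, 'h, 'b) module_scheme \<Rightarrow> ('h \<Rightarrow> ('h \<times> 'h \<Rightarrow> 'r) set)
    \<Rightarrow> 'h set \<Rightarrow> ('h \<times> 'h \<Rightarrow> 'r) set \<Rightarrow> ('h \<times> 'h \<Rightarrow> 'r) set"
  where "cocan_map R H \<Delta> K =
    tensor_lift R (H\<lparr>carrier := K\<rparr>) H (tensor R H H)
      (\<lambda>k h. tensor_map R H H H H (\<lambda>x. k \<otimes>\<^bsub>H\<^esub> x) id (\<Delta> h))"

definition galois_coextension ::
  "('r, 'a) ring_scheme \<Rightarrow> ('r, 'h, 'b) module_scheme \<Rightarrow> ('h \<Rightarrow> ('h \<times> 'h \<Rightarrow> 'r) set) \<Rightarrow> ('h \<Rightarrow> 'r)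
    \<Rightarrow> 'h set \<Rightarrow> bool"
  where "galois_coextension R H \<Delta> \<epsilon> K \<longleftrightarrow>
    cocan_map R H \<Delta> K \<in>
      linear_iso R (tensor R (H\<lparr>carrier := K\<rparr>) H) (cotensor R H \<Delta> (quot_of_sub R H \<epsilon> K))"

end

theory Submission
  imports Defs
begin

text \<open>
  Everything is read off from the bijection \<open>\<alpha>(x \<otimes> h) = x h\<^sub>(\<^sub>1\<^sub>) \<otimes> h\<^sub>(\<^sub>2\<^sub>)\<close> of \<open>H \<otimes> H\<close>, whose inverse is
  \<open>\<alpha>'(x \<otimes> h) = x S(h\<^sub>(\<^sub>1\<^sub>)) \<otimes> h\<^sub>(\<^sub>2\<^sub>)\<close>. Both canonical maps are \<open>\<alpha>\<close> followed by a projection or preceded by an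
  inclusion, so that each of the two claims becomes a comparison of submodules of \<open>H \<otimes> H\<close>.

  \<^bold>\<open>Extensions.\<close> Let \<open>Q = H/I\<close>, \<open>B = H\<^sup>c\<^sup>o \<^sup>Q\<close>, and let \<open>N\<close> be the span of the balancing relations, so that
  \<open>H \<otimes>\<^sub>B H = (H \<otimes> H)/N\<close>. The lift of \<open>can\<^sub>Q\<close> to \<open>H \<otimes> H\<close> is \<open>(id \<otimes> \<pi>) \<circ> \<alpha>\<close>. It is onto, and it kills \<open>N\<close>. Hence
  \<open>can\<^sub>Q\<close> is bijective iff \<open>\<alpha>'\<close> sends the kernel of \<open>id \<otimes> \<pi>\<close>, which is the image of \<open>H \<otimes> I\<close>, into \<open>N\<close>. This
  holds iff \<open>I = B\<^sup>+H\<close> (\<open>extension_iff\<close>):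
  \<^item> The map \<open>(\<epsilon> \<otimes> id) \<circ> \<alpha>\<close> sends \<open>N\<close> into \<open>B\<^sup>+H\<close> and \<open>\<alpha>'(1 \<otimes> x)\<close> to \<open>x\<close>. So injectivity of \<open>can\<^sub>Q\<close> forces
    \<open>I \<subseteq> B\<^sup>+H\<close>; the other inclusion always holds.
  \<^item> For \<open>b \<in> B\<^sup>+\<close> the element \<open>\<alpha>'(1 \<otimes> b) = S(b\<^sub>(\<^sub>1\<^sub>)) \<otimes> b\<^sub>(\<^sub>2\<^sub>)\<close> is congruent to \<open>S(b\<^sub>(\<^sub>1\<^sub>))b\<^sub>(\<^sub>2\<^sub>) \<otimes> 1 = 0\<close> modulo \<open>N\<close>,
    because \<open>\<Delta>(b)\<close> lies in the image of \<open>H \<otimes> B\<close> by flatness. As \<open>\<alpha>(N)\<close> is stable under multiplication of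
    the first factor by \<open>H\<close> from the left and under multiplication by \<open>\<Delta>(H)\<close> from the right, it then contains
    all \<open>y \<otimes> bk\<close>, that is, the image of \<open>H \<otimes> B\<^sup>+H\<close>.

  \<^bold>\<open>Coextensions.\<close> Let \<open>D = H/K\<^sup>+H\<close> and \<open>B = H\<^sup>c\<^sup>o \<^sup>D\<close>, the kernel of the map \<open>g(x) = x\<^sub>(\<^sub>1\<^sub>) \<otimes> \<pi>(x\<^sub>(\<^sub>2\<^sub>)) - x \<otimes> \<pi>(1)\<close>.
  The two maps whose equaliser is \<open>H \<box>\<^sub>D H\<close> differ at \<open>\<alpha>(t)\<close> by \<open>\<gamma>((g \<otimes> id)(t))\<close>, where \<open>\<gamma>\<close> is the analogue of \<open>\<alpha>\<close>
  for the right \<open>H\<close>-module \<open>H \<otimes> D\<close> and is a bijection as well. Hence \<open>H \<box>\<^sub>D H = \<alpha>(ker (g \<otimes> id))\<close>, and flatness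
  identifies \<open>ker (g \<otimes> id)\<close> with the image of \<open>B \<otimes> H\<close>. The canonical map is the injection
  \<open>K \<otimes> H \<rightarrow> H \<otimes> H\<close> followed by \<open>\<alpha>\<close>. It is an isomorphism onto \<open>H \<box>\<^sub>D H\<close> iff \<open>K \<otimes> H\<close> and \<open>B \<otimes> H\<close> have the same
  image in \<open>H \<otimes> H\<close>, and \<open>id \<otimes> \<epsilon>\<close> recovers \<open>K\<close> and \<open>B\<close> from these images (\<open>coextension_iff\<close>).

  Flatness enters through \<open>flat_exact\<close> alone, always for a map into \<open>H \<otimes> Q\<close> or \<open>H \<otimes> D\<close>; the flatness
  hypothesis is about modules with elements in the type of these.
\<close>

section \<open>Linear maps and quotient modules\<close>

lemma (in abelian_group) zero_minus_zero_minus: "x \<in> carrier G \<Longrightarrow> \<zero> \<ominus> (\<zero> \<ominus> x) = x"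
  by (simp add: a_minus_def)

lemma (in abelian_group) minus_eq_zero_iff:
  "\<lbrakk>x \<in> carrier G; y \<in> carrier G\<rbrakk> \<Longrightarrow> x \<ominus> y = \<zero> \<longleftrightarrow> x = y"
  by (metis a_minus_def a_inv_closed minus_equality minus_minus r_neg)

lemma (in abelian_group) minus_zero: "x \<in> carrier G \<Longrightarrow> x \<ominus> \<zero> = x"
  by (simp add: a_minus_def)

lemma linear_mapI:
  assumes "\<And>x. x \<in> carrier M \<Longrightarrow> f x \<in> carrier N"
    and "\<And>x y. \<lbrakk>x \<in> carrier M; y \<in> carrier M\<rbrakk> \<Longrightarrow> f (x \<oplus>\<^bsub>M\<^esub> y) = f x \<oplus>\<^bsub>N\<^esub> f y"
    and "\<And>a x. \<lbrakk>a \<in> carrier R; x \<in> carrier M\<rbrakk> \<Longrightarrow> f (a \<odot>\<^bsub>M\<^esub> x) = a \<odot>\<^bsub>N\<^esub> f x"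
  shows "f \<in> linear_map R M N"
  using assms by (auto simp: linear_map_def)

lemma
  assumes "f \<in> linear_map R M N"
  shows linear_map_closed: "x \<in> carrier M \<Longrightarrow> f x \<in> carrier N"
    and linear_map_add: "\<lbrakk>x \<in> carrier M; y \<in> carrier M\<rbrakk> \<Longrightarrow> f (x \<oplus>\<^bsub>M\<^esub> y) = f x \<oplus>\<^bsub>N\<^esub> f y"
    and linear_map_smult: "\<lbrakk>a \<in> carrier R; x \<in> carrier M\<rbrakk> \<Longrightarrow> f (a \<odot>\<^bsub>M\<^esub> x) = a \<odot>\<^bsub>N\<^esub> f x"
  using assms by (auto simp: linear_map_def)

lemma linear_map_zero:
  assumes "f \<in> linear_map R M N" "module R M" "module R N"
  shows "f \<zero>\<^bsub>M\<^esub> = \<zero>\<^bsub>N\<^esub>"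
proof -
  interpret M: module R M by fact
  interpret N: module R N by fact
  have "f (\<zero>\<^bsub>R\<^esub> \<odot>\<^bsub>M\<^esub> \<zero>\<^bsub>M\<^esub>) = \<zero>\<^bsub>R\<^esub> \<odot>\<^bsub>N\<^esub> f \<zero>\<^bsub>M\<^esub>"
    by (rule linear_map_smult[OF assms(1)]) simp_all
  moreover have "f \<zero>\<^bsub>M\<^esub> \<in> carrier N" using linear_map_closed[OF assms(1)] by simp
  ultimately show ?thesis by simp
qed

lemma linear_map_neg:
  assumes "f \<in> linear_map R M N" "module R M" "module R N" "x \<in> carrier M"
  shows "f (\<ominus>\<^bsub>M\<^esub> x) = \<ominus>\<^bsub>N\<^esub> f x"
proof -
  interpret M: module R M by fact
  interpret N: module R N by fact
  have "f (\<ominus>\<^bsub>M\<^esub> x) \<oplus>\<^bsub>N\<^esub> f x = \<zero>\<^bsub>N\<^esub>"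
    using assms(4) linear_map_zero[OF assms(1-3)]
    by (simp flip: linear_map_add[OF assms(1)] add: M.l_neg)
  then show ?thesis using assms(4) linear_map_closed[OF assms(1)]
    by (metis M.a_inv_closed N.minus_equality)
qed

lemma linear_map_minus:
  assumes "f \<in> linear_map R M N" "module R M" "module R N" "x \<in> carrier M" "y \<in> carrier M"
  shows "f (x \<ominus>\<^bsub>M\<^esub> y) = f x \<ominus>\<^bsub>N\<^esub> f y"
proof -
  interpret M: module R M by fact
  interpret N: module R N by fact
  show ?thesis using assms(4,5) unfolding a_minus_def
    by (simp add: linear_map_add[OF assms(1)] linear_map_neg[OF assms(1-3)])
qed

lemma linear_map_id: "(\<lambda>x. x) \<in> linear_map R M M"
  by (simp add: linear_map_def)

lemma linear_map_comp:
  assumes "g \<in> linear_map R N P" "f \<in> linear_map R M N"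
  shows "(\<lambda>x. g (f x)) \<in> linear_map R M P"
  using assms by (auto simp: linear_map_def Pi_iff)

lemma linear_map_cong:
  assumes "f \<in> linear_map R M N" "module R M" "\<And>x. x \<in> carrier M \<Longrightarrow> f x = g x"
  shows "g \<in> linear_map R M N"
proof -
  interpret module R M by fact
  show ?thesis using assms(1,3) by (auto simp: linear_map_def Pi_def)
qed

lemma linear_map_plus:
  assumes "f \<in> linear_map R M N" "g \<in> linear_map R M N" "module R N"
  shows "(\<lambda>x. f x \<oplus>\<^bsub>N\<^esub> g x) \<in> linear_map R M N"
proof -
  interpret N: module R N by fact
  note [simp] = linear_map_closed[OF assms(1)] linear_map_closed[OF assms(2)]
     linear_map_add[OF assms(1)] linear_map_add[OF assms(2)]
     linear_map_smult[OF assms(1)] linear_map_smult[OF assms(2)]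
  show ?thesis by (rule linear_mapI) (simp_all add: N.a_ac N.smult_r_distr)
qed

lemma linear_map_const_smult:
  assumes "f \<in> linear_map R M N" "module R N" "a \<in> carrier R"
  shows "(\<lambda>x. a \<odot>\<^bsub>N\<^esub> f x) \<in> linear_map R M N"
proof -
  interpret N: module R N by fact
  note [simp] = linear_map_closed[OF assms(1)]
     linear_map_add[OF assms(1)] linear_map_smult[OF assms(1)] 
  show ?thesis using assms(3)
    by (intro linear_mapI) (simp_all add: N.smult_r_distr N.R.m_comm flip: N.smult_assoc1)
qed

lemma linear_map_smult_const:
  assumes "f \<in> linear_map R M (regular_module R)" "module R N" "n \<in> carrier N"
  shows "(\<lambda>x. f x \<odot>\<^bsub>N\<^esub> n) \<in> linear_map R M N"
proof -
  interpret N: module R N by fact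
  have f: "f x \<in> carrier R" if "x \<in> carrier M" for x
    using linear_map_closed[OF assms(1) that] by (simp add: regular_module_def)
  show ?thesis using assms(3) linear_map_add[OF assms(1)] linear_map_smult[OF assms(1)]
    by (intro linear_mapI) (simp_all add: f N.smult_l_distr N.smult_assoc1 regular_module_def)
qed

lemma linear_map_diff:
  assumes "f \<in> linear_map R M N" "g \<in> linear_map R M N" "module R N"
  shows "(\<lambda>x. f x \<ominus>\<^bsub>N\<^esub> g x) \<in> linear_map R M N"
proof -
  interpret N: module R N by fact
  note [simp] = linear_map_closed[OF assms(1)] linear_map_closed[OF assms(2)]
     linear_map_add[OF assms(1)] linear_map_add[OF assms(2)]
     linear_map_smult[OF assms(1)] linear_map_smult[OF assms(2)]
  show ?thesis unfolding a_minus_def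
    by (rule linear_mapI) (simp_all add: N.a_ac N.smult_r_distr N.minus_add N.smult_r_minus)
qed

lemma submodule_preimage:
  assumes "f \<in> linear_map R M N" "module R M" "module R N" "submodule L R N"
  shows "submodule {x \<in> carrier M. f x \<in> L} R M"
proof -
  interpret M: module R M by fact
  interpret N: module R N by fact
  note L = N.submoduleE[OF assms(4)]
  have 0: "\<zero>\<^bsub>N\<^esub> \<in> L" using submodule.axioms(1)[OF assms(4)] by (simp add: subgroup_def)
  show ?thesis
    by (rule M.submoduleI)
       (auto simp: linear_map_zero[OF assms(1-3)] linear_map_add[OF assms(1)]
          linear_map_smult[OF assms(1)] linear_map_neg[OF assms(1-3)] L 0)
qed

lemma submodule_zero: "module R M \<Longrightarrow> submodule {\<zero>\<^bsub>M\<^esub>} R M"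
proof -
  assume "module R M"
  then interpret module R M .
  show ?thesis by (rule submoduleI) auto
qed

lemma submodule_zero_mem: "submodule L R M \<Longrightarrow> \<zero>\<^bsub>M\<^esub> \<in> L"
  using submodule.axioms(1) by (fastforce simp: subgroup_def)

lemma submodule_minus:
  assumes "submodule L R M" "module R M" "x \<in> L" "y \<in> L"
  shows "x \<ominus>\<^bsub>M\<^esub> y \<in> L"
proof -
  interpret module R M by fact
  show ?thesis using submoduleE[OF assms(1)] assms by (simp add: a_minus_def)
qed

lemma submodule_kernel:
  assumes "f \<in> linear_map R M N" "module R M" "module R N"
  shows "submodule {x \<in> carrier M. f x = \<zero>\<^bsub>N\<^esub>} R M"
  using submodule_preimage[OF assms submodule_zero[OF assms(3)]] by simp

lemma submodule_image:
  assumes "f \<in> linear_map R M N" "module R M" "module R N"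
  shows "submodule (f ` carrier M) R N"
proof -
  interpret M: module R M by fact
  interpret N: module R N by fact
  show ?thesis
  proof (rule N.submoduleI)
    show "\<zero>\<^bsub>N\<^esub> \<in> f ` carrier M"
      using linear_map_zero[OF assms] M.zero_closed by (metis imageI)
  qed (auto simp: linear_map_closed[OF assms(1)]
      simp flip: linear_map_neg[OF assms] linear_map_add[OF assms(1)] linear_map_smult[OF assms(1)])
qed

lemma linear_map_injI:
  assumes "f \<in> linear_map R M N" "module R M" "module R N"
    and "\<And>x. \<lbrakk>x \<in> carrier M; f x = \<zero>\<^bsub>N\<^esub>\<rbrakk> \<Longrightarrow> x = \<zero>\<^bsub>M\<^esub>"
  shows "inj_on f (carrier M)"
proof (rule inj_onI)
  interpret M: module R M by fact
  interpret N: module R N by fact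
  fix x y assume xy: "x \<in> carrier M" "y \<in> carrier M" "f x = f y"
  then have "f (x \<ominus>\<^bsub>M\<^esub> y) = \<zero>\<^bsub>N\<^esub>"
    using linear_map_closed[OF assms(1)]
    by (simp add: linear_map_minus[OF assms(1-3)] N.minus_eq_zero_iff)
  then have "x \<ominus>\<^bsub>M\<^esub> y = \<zero>\<^bsub>M\<^esub>" using xy assms(4) by simp
  then show "x = y" using xy by (simp add: M.minus_eq_zero_iff)
qed

lemma module_span_submodule:
  assumes "module R M" "X \<subseteq> carrier M"
  shows "submodule (module_span R M X) R M"
proof -
  interpret module R M by fact
  have "carrier M \<in> {N. submodule N R M \<and> X \<subseteq> N}"
    using carrier_is_submodule assms(2) by simp
  then have sub: "module_span R M X \<subseteq> carrier M"
    unfolding module_span_def by blast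
  show ?thesis
    by (rule submoduleI[OF sub])
       (auto simp: module_span_def submodule_zero_mem intro: submoduleE submodule_zero_mem)
qed

lemma module_span_incl: "x \<in> X \<Longrightarrow> x \<in> module_span R M X"
  by (auto simp: module_span_def)

lemma module_span_least: "submodule N R M \<Longrightarrow> X \<subseteq> N \<Longrightarrow> module_span R M X \<subseteq> N"
  by (auto simp: module_span_def)

locale quotient = M?: module R M for R and M (structure) +
  fixes N
  assumes subm: "submodule N R M"
begin

sublocale abelian_subgroup N M
  by (rule abelian_subgroupI3, rule additive_subgroupI, rule submodule.axioms(1)[OF subm])
     (rule M.abelian_group_axioms)

lemma quot_carrier: "carrier (quot_module M N) = (\<lambda>x. N +> x) ` carrier M"
  by (auto simp: quot_module_def A_RCOSETS_def')

lemma quot_eq_iff: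
  assumes "x \<in> carrier M" "y \<in> carrier M"
  shows "N +> x = N +> y \<longleftrightarrow> x \<ominus> y \<in> N"
  by (metis a_minus_def a_rcos_module a_rcos_self a_repr_independence' assms)

lemma quot_add:
  "\<lbrakk>x \<in> carrier M; y \<in> carrier M\<rbrakk> \<Longrightarrow>
    (N +> x) \<oplus>\<^bsub>quot_module M N\<^esub> (N +> y) = N +> (x \<oplus> y)"
  by (simp add: quot_module_def a_rcos_sum)

lemma quot_zero: "\<zero>\<^bsub>quot_module M N\<^esub> = N"
  by (simp add: quot_module_def)

lemma coset_zero: "N +> \<zero> = N"
  by (rule a_rcos_const) simp

lemma quot_smult:
  assumes "a \<in> carrier R" "x \<in> carrier M"
  shows "a \<odot>\<^bsub>quot_module M N\<^esub> (N +> x) = N +> (a \<odot> x)"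
proof -
  have "N +> (a \<odot> y) = N +> (a \<odot> x)" if "y \<in> N +> x" for y
  proof -
    have y: "y \<in> carrier M" using that assms a_elemrcos_carrier by blast
    have "y \<ominus> x \<in> N" using that y assms by (simp add: a_rcos_module a_minus_def)
    then have "a \<odot> (y \<ominus> x) \<in> N" using subm assms by (simp add: submodule.smult_closed)
    moreover have "a \<odot> (y \<ominus> x) = a \<odot> y \<ominus> a \<odot> x"
      using y assms by (simp add: a_minus_def smult_r_distr smult_r_minus)
    ultimately show ?thesis using y assms by (simp add: quot_eq_iff)
  qed
  moreover have "x \<in> N +> x" using assms by (simp add: a_rcos_self)
  ultimately have "(\<Union>y\<in>N +> x. N +> (a \<odot> y)) = N +> (a \<odot> x)" by blast
  then show ?thesis by (simp add: quot_module_def)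
qed

lemma coset_in_quot: "x \<in> carrier M \<Longrightarrow> N +> x \<in> carrier (quot_module M N)"
  by (simp add: quot_carrier)

lemma module_quot: "module R (quot_module M N)"
proof (rule moduleI)
  show "cring R" by (rule R.is_cring)
  show "abelian_group (quot_module M N)"
  proof (rule abelian_groupI)
    show "\<zero>\<^bsub>quot_module M N\<^esub> \<in> carrier (quot_module M N)"
      using coset_zero quot_zero coset_in_quot by (metis M.zero_closed)
    fix X assume "X \<in> carrier (quot_module M N)"
    then obtain x where x: "x \<in> carrier M" "X = N +> x" by (auto simp: quot_carrier)
    show "\<zero>\<^bsub>quot_module M N\<^esub> \<oplus>\<^bsub>quot_module M N\<^esub> X = X"
      using x quot_add[of \<zero> x] by (simp add: quot_zero coset_zero)
    have "(N +> \<ominus> x) \<oplus>\<^bsub>quot_module M N\<^esub> X = \<zero>\<^bsub>quot_module M N\<^esub>"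
      using x by (simp add: quot_add M.l_neg coset_zero quot_zero)
    then show "\<exists>Y\<in>carrier (quot_module M N). Y \<oplus>\<^bsub>quot_module M N\<^esub> X = \<zero>\<^bsub>quot_module M N\<^esub>"
      using x coset_in_quot by blast
  qed (auto simp: quot_carrier quot_add M.a_ac)
qed (auto simp: quot_carrier quot_add quot_smult smult_l_distr smult_r_distr smult_assoc1)

lemma coset_linear: "(\<lambda>x. N +> x) \<in> linear_map R M (quot_module M N)"
  by (rule linear_mapI) (auto simp: coset_in_quot quot_add quot_smult)

lemma coset_eq_zero_iff: "x \<in> carrier M \<Longrightarrow> N +> x = \<zero>\<^bsub>quot_module M N\<^esub> \<longleftrightarrow> x \<in> N"
  using quot_eq_iff[of x \<zero>] by (simp add: quot_zero coset_zero M.minus_zero)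

text \<open>
  The value of \<^const>\<open>quot_lift\<close> on a coset is the only element of the image of the coset, which exists
  because the map is constant on cosets.
\<close>

lemma quot_lift_coset:
  assumes f: "f \<in> linear_map R M P" "module R P"
    and "\<forall>n\<in>N. f n = \<zero>\<^bsub>P\<^esub>" and x: "x \<in> carrier M"
  shows "quot_lift f (N +> x) = f x"
proof -
  interpret P: module R P by fact
  have "f y = f x" if "y \<in> N +> x" for y
  proof -
    have y: "y \<in> carrier M" using that x a_elemrcos_carrier by blast
    have "y \<ominus> x \<in> N" using that y x by (simp add: a_rcos_module a_minus_def)
    then have "f y \<ominus>\<^bsub>P\<^esub> f x = \<zero>\<^bsub>P\<^esub>"
      using assms(3) linear_map_minus[OF f(1) M.module_axioms f(2) y x] by simp
    then show ?thesis using linear_map_closed[OF f(1)] x y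
      by (simp add: P.minus_eq_zero_iff)
  qed
  moreover have "x \<in> N +> x" using x by (simp add: a_rcos_self)
  ultimately have "f ` (N +> x) = {f x}" by blast
  then show ?thesis by (simp add: quot_lift_def)
qed

lemma quot_lift_linear:
  assumes f: "f \<in> linear_map R M P" "module R P"
    and "\<forall>n\<in>N. f n = \<zero>\<^bsub>P\<^esub>"
  shows "quot_lift f \<in> linear_map R (quot_module M N) P"
proof -
  note lift = quot_lift_coset[OF assms]
  show ?thesis
    by (rule linear_mapI)
       (auto simp: quot_carrier quot_add quot_smult lift linear_map_closed[OF f(1)]
         linear_map_add[OF f(1)] linear_map_smult[OF f(1)])
qed

end

lemma module_regular: "cring R \<Longrightarrow> module R (regular_module R)"
proof -
  assume R: "cring R"
  then interpret cring R .
  show ?thesis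
    by (rule moduleI[OF R])
       (auto simp: regular_module_def l_distr r_distr m_assoc
         intro!: abelian_groupI a_assoc a_comm bexI[of _ "\<ominus>\<^bsub>R\<^esub> _"] l_neg)
qed

section \<open>Tensor products\<close>

lemma module_free:
  assumes "cring R"
  shows "module R (free_module R X)"
proof -
  interpret cring R by fact
  have fin: "finite {x. s x \<oplus>\<^bsub>R\<^esub> t x \<noteq> \<zero>\<^bsub>R\<^esub>}" "{x. s x \<oplus>\<^bsub>R\<^esub> t x \<noteq> \<zero>\<^bsub>R\<^esub>} \<subseteq> X"
    if "finite {x. s x \<noteq> \<zero>\<^bsub>R\<^esub>}" "finite {x. t x \<noteq> \<zero>\<^bsub>R\<^esub>}"
      "{x. s x \<noteq> \<zero>\<^bsub>R\<^esub>} \<subseteq> X" "{x. t x \<noteq> \<zero>\<^bsub>R\<^esub>} \<subseteq> X" for s t :: "_ \<Rightarrow> _"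
  proof -
    have *: "{x. s x \<oplus>\<^bsub>R\<^esub> t x \<noteq> \<zero>\<^bsub>R\<^esub>} \<subseteq> {x. s x \<noteq> \<zero>\<^bsub>R\<^esub>} \<union> {x. t x \<noteq> \<zero>\<^bsub>R\<^esub>}" by auto
    show "finite {x. s x \<oplus>\<^bsub>R\<^esub> t x \<noteq> \<zero>\<^bsub>R\<^esub>}"
      by (rule finite_subset[OF *]) (use that in simp)
    show "{x. s x \<oplus>\<^bsub>R\<^esub> t x \<noteq> \<zero>\<^bsub>R\<^esub>} \<subseteq> X" using * that by blast
  qed
  have fin2: "finite {x. a \<otimes>\<^bsub>R\<^esub> t x \<noteq> \<zero>\<^bsub>R\<^esub>}" "{x. a \<otimes>\<^bsub>R\<^esub> t x \<noteq> \<zero>\<^bsub>R\<^esub>} \<subseteq> X"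
    if "finite {x. t x \<noteq> \<zero>\<^bsub>R\<^esub>}" "{x. t x \<noteq> \<zero>\<^bsub>R\<^esub>} \<subseteq> X" "a \<in> carrier R" for a and t :: "_ \<Rightarrow> _"
  proof -
    have *: "{x. a \<otimes>\<^bsub>R\<^esub> t x \<noteq> \<zero>\<^bsub>R\<^esub>} \<subseteq> {x. t x \<noteq> \<zero>\<^bsub>R\<^esub>}" using that(3) by auto
    show "finite {x. a \<otimes>\<^bsub>R\<^esub> t x \<noteq> \<zero>\<^bsub>R\<^esub>}"
      by (rule finite_subset[OF *]) (use that in simp)
    show "{x. a \<otimes>\<^bsub>R\<^esub> t x \<noteq> \<zero>\<^bsub>R\<^esub>} \<subseteq> X" using * that by blast
  qed
  have car: "t x \<in> carrier R" if "range t \<subseteq> carrier R" for t and x :: 'd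
    using that by auto
  show ?thesis
  proof (rule moduleI)
    show "cring R" by fact
    show "abelian_group (free_module R X)"
    proof (rule abelian_groupI)
      fix t assume t: "t \<in> carrier (free_module R X)"
      then have "(\<lambda>x. \<ominus>\<^bsub>R\<^esub> \<one>\<^bsub>R\<^esub> \<otimes>\<^bsub>R\<^esub> t x) \<in> carrier (free_module R X)"
        by (auto simp: free_module_def intro: fin2 fin2(2)[THEN subsetD])
      moreover have "\<ominus>\<^bsub>R\<^esub> \<one>\<^bsub>R\<^esub> \<otimes>\<^bsub>R\<^esub> t x \<oplus>\<^bsub>R\<^esub> t x = \<zero>\<^bsub>R\<^esub>" for x
      proof -
        have "t x \<in> carrier R" using t by (auto simp: free_module_def)
        then show ?thesis by (simp add: l_minus l_neg)
      qed
      \<comment> \<open>The pointwise negative is taken as multiplication by minus one, so that scalar closure gives its finite support.\<close>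
      ultimately show "\<exists>s\<in>carrier (free_module R X).
          s \<oplus>\<^bsub>free_module R X\<^esub> t = \<zero>\<^bsub>free_module R X\<^esub>"
        by (auto simp: free_module_def intro!: bexI[of _ "\<lambda>x. \<ominus>\<^bsub>R\<^esub> \<one>\<^bsub>R\<^esub> \<otimes>\<^bsub>R\<^esub> t x"])
    qed (auto simp: free_module_def car fin a_ac fin(2)[THEN subsetD])
  qed (auto simp: free_module_def car fin2 fin2(2)[THEN subsetD] l_distr r_distr m_assoc)
qed

lemma free_basis_closed:
  assumes "cring R" "x \<in> X"
  shows "free_basis R x \<in> carrier (free_module R X)"
proof -
  interpret cring R by fact
  have "{y. (if y = x then \<one>\<^bsub>R\<^esub> else \<zero>\<^bsub>R\<^esub>) \<noteq> \<zero>\<^bsub>R\<^esub>} \<subseteq> {x}" by auto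
  then show ?thesis using assms(2)
    by (auto simp: free_module_def free_basis_def intro: finite_subset)
qed

text \<open>
  Stated for submodules rather than as an expansion in the basis: every later proof by extension from
  pure tensors takes the submodule where the claim holds.
\<close>

lemma free_module_spanned:
  assumes "cring R" "submodule L R (free_module R X)" "\<And>x. x \<in> X \<Longrightarrow> free_basis R x \<in> L"
    and "t \<in> carrier (free_module R X)"
  shows "t \<in> L"
proof -
  interpret cring R by fact
  interpret F: module R "free_module R X" by (rule module_free) fact
  note L = F.submoduleE[OF assms(2)]
  have "t \<in> L" if "finite A" "t \<in> carrier (free_module R X)" "{x. t x \<noteq> \<zero>\<^bsub>R\<^esub>} \<subseteq> A" for A t
    using that
  proof (induct A arbitrary: t)
    case empty
    then have "t = \<zero>\<^bsub>free_module R X\<^esub>" by (auto simp: free_module_def)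
    then show ?case using submodule_zero_mem[OF assms(2)] by simp
  next
    case (insert y A)
    let ?s = "\<lambda>x. if x = y then \<zero>\<^bsub>R\<^esub> else t x"
    have car: "t x \<in> carrier R" for x using insert.prems by (auto simp: free_module_def)
    show ?case
    proof (cases "t y = \<zero>\<^bsub>R\<^esub>")
      case True
      then show ?thesis using insert by blast
    next
      case False
      then have y: "y \<in> X" using insert.prems by (auto simp: free_module_def)
      have "{x. ?s x \<noteq> \<zero>\<^bsub>R\<^esub>} \<subseteq> {x. t x \<noteq> \<zero>\<^bsub>R\<^esub>}" by auto
      then have s: "?s \<in> carrier (free_module R X)"
        using insert.prems(1) by (auto simp: free_module_def intro: finite_subset)
      have "?s \<in> L" by (rule insert.hyps(3)[OF s]) (use insert.prems in auto)
      moreover have "t y \<odot>\<^bsub>free_module R X\<^esub> free_basis R y \<in> L"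
        using L(4) assms(3) y car by blast
      moreover have "t = ?s \<oplus>\<^bsub>free_module R X\<^esub> t y \<odot>\<^bsub>free_module R X\<^esub> free_basis R y"
        using car by (auto simp: free_module_def free_basis_def)
      ultimately show ?thesis using L(5) by metis
    qed
  qed
  then show ?thesis using assms(4) by (auto simp: free_module_def)
qed

definition free_lift where
  "free_lift R P \<beta> t = (\<Oplus>\<^bsub>P\<^esub>p\<in>{p. t p \<noteq> \<zero>\<^bsub>R\<^esub>}. t p \<odot>\<^bsub>P\<^esub> \<beta> p)"

text \<open>
  Sums over different supports can only be added after both are extended to a common finite set.
\<close>

lemma free_lift_superset:
  assumes "module R P" "t \<in> carrier (free_module R X)" "finite A" "A \<subseteq> X"
    and "{p. t p \<noteq> \<zero>\<^bsub>R\<^esub>} \<subseteq> A" "\<And>x. x \<in> X \<Longrightarrow> \<beta> x \<in> carrier P"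
  shows "free_lift R P \<beta> t = (\<Oplus>\<^bsub>P\<^esub>p\<in>A. t p \<odot>\<^bsub>P\<^esub> \<beta> p)"
proof -
  interpret P: module R P by fact
  have "t x \<in> carrier R" for x using assms(2) by (auto simp: free_module_def)
  then show ?thesis unfolding free_lift_def using assms
    by (intro P.add.finprod_mono_neutral_cong_left) (auto simp: subset_iff)
qed

lemma free_lift_basis:
  assumes "module R P" "x \<in> X" "\<And>x. x \<in> X \<Longrightarrow> \<beta> x \<in> carrier P"
  shows "free_lift R P \<beta> (free_basis R x) = \<beta> x"
proof -
  interpret P: module R P by fact
  have "free_lift R P \<beta> (free_basis R x) = (\<Oplus>\<^bsub>P\<^esub>p\<in>{x}. free_basis R x p \<odot>\<^bsub>P\<^esub> \<beta> p)"
    using assms free_basis_closed[OF P.R.is_cring assms(2)]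
    by (intro free_lift_superset) (auto simp: free_basis_def)
  then show ?thesis using assms by (simp add: free_basis_def)
qed

lemma free_lift_linear:
  assumes P: "module R P" and \<beta>: "\<And>x. x \<in> X \<Longrightarrow> \<beta> x \<in> carrier P"
  shows "free_lift R P \<beta> \<in> linear_map R (free_module R X) P"
proof (rule linear_mapI)
  interpret P: module R P by fact
  interpret F: module R "free_module R X" by (rule module_free) (rule P.R.is_cring)
  note sup = free_lift_superset[OF P _ _ _ _ \<beta>]
  fix s assume s: "s \<in> carrier (free_module R X)"
  have cs: "s x \<in> carrier R" for x using s by (auto simp: free_module_def)
  show "free_lift R P \<beta> s \<in> carrier P"
    unfolding free_lift_def using s \<beta> cs
    by (intro P.finsum_closed) (auto simp: free_module_def subset_iff)
  {
    fix t assume t: "t \<in> carrier (free_module R X)"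
    have ct: "t x \<in> carrier R" for x using t by (auto simp: free_module_def)
    let ?A = "{p. s p \<noteq> \<zero>\<^bsub>R\<^esub>} \<union> {p. t p \<noteq> \<zero>\<^bsub>R\<^esub>}"
    have A: "finite ?A" "?A \<subseteq> X" using s t by (auto simp: free_module_def)
    have st: "s \<oplus>\<^bsub>free_module R X\<^esub> t \<in> carrier (free_module R X)" using s t by simp
    have st': "(s \<oplus>\<^bsub>free_module R X\<^esub> t) p = s p \<oplus>\<^bsub>R\<^esub> t p" for p by (simp add: free_module_def)
    have "free_lift R P \<beta> (s \<oplus>\<^bsub>free_module R X\<^esub> t) = (\<Oplus>\<^bsub>P\<^esub>p\<in>?A. (s p \<oplus>\<^bsub>R\<^esub> t p) \<odot>\<^bsub>P\<^esub> \<beta> p)"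
      by (subst sup[OF st A]) (auto simp: st')
    also have "\<dots> = (\<Oplus>\<^bsub>P\<^esub>p\<in>?A. s p \<odot>\<^bsub>P\<^esub> \<beta> p \<oplus>\<^bsub>P\<^esub> t p \<odot>\<^bsub>P\<^esub> \<beta> p)"
      using A cs ct \<beta> by (intro P.finsum_cong') (auto simp: P.smult_l_distr subset_iff)
    also have "\<dots> = free_lift R P \<beta> s \<oplus>\<^bsub>P\<^esub> free_lift R P \<beta> t"
      using A cs ct \<beta> by (subst P.finsum_addf) (auto simp: sup[OF s A] sup[OF t A] subset_iff)
    finally show "free_lift R P \<beta> (s \<oplus>\<^bsub>free_module R X\<^esub> t) =
        free_lift R P \<beta> s \<oplus>\<^bsub>P\<^esub> free_lift R P \<beta> t" .
  }
  fix a assume a: "a \<in> carrier R"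
  let ?A = "{p. s p \<noteq> \<zero>\<^bsub>R\<^esub>}"
  have A: "finite ?A" "?A \<subseteq> X" using s by (auto simp: free_module_def)
  have as: "a \<odot>\<^bsub>free_module R X\<^esub> s \<in> carrier (free_module R X)" using s a by simp
  have as': "(a \<odot>\<^bsub>free_module R X\<^esub> s) p = a \<otimes>\<^bsub>R\<^esub> s p" for p by (simp add: free_module_def)
  have "free_lift R P \<beta> (a \<odot>\<^bsub>free_module R X\<^esub> s) = (\<Oplus>\<^bsub>P\<^esub>p\<in>?A. (a \<otimes>\<^bsub>R\<^esub> s p) \<odot>\<^bsub>P\<^esub> \<beta> p)"
    by (subst sup[OF as A]) (use a in \<open>auto simp: as'\<close>)
  also have "\<dots> = (\<Oplus>\<^bsub>P\<^esub>p\<in>?A. a \<odot>\<^bsub>P\<^esub> (s p \<odot>\<^bsub>P\<^esub> \<beta> p))"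
    using A cs \<beta> a by (intro P.finsum_cong') (auto simp: P.smult_assoc1 subset_iff)
  also have "\<dots> = a \<odot>\<^bsub>P\<^esub> (\<Oplus>\<^bsub>P\<^esub>p\<in>?A. s p \<odot>\<^bsub>P\<^esub> \<beta> p)"
    using A cs \<beta> a by (intro P.finsum_smult_ldistr[symmetric]) (auto simp: subset_iff)
  finally show "free_lift R P \<beta> (a \<odot>\<^bsub>free_module R X\<^esub> s) = a \<odot>\<^bsub>P\<^esub> free_lift R P \<beta> s"
    by (simp add: free_lift_def)
qed

text \<open>
  Linearity in each argument is stated in terms of \<^const>\<open>linear_map\<close>, so that the rules for linear maps decide
  bilinearity of every expression met below.
\<close>

definition bilinear ::
  "('r, 'a) ring_scheme \<Rightarrow> ('r, 'm, 'b) module_scheme \<Rightarrow> ('r, 'n, 'c) module_scheme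
    \<Rightarrow> ('r, 'p, 'd) module_scheme \<Rightarrow> ('m \<Rightarrow> 'n \<Rightarrow> 'p) \<Rightarrow> bool"
  where "bilinear R M N P \<beta> \<longleftrightarrow>
    (\<forall>x\<in>carrier M. (\<lambda>y. \<beta> x y) \<in> linear_map R N P) \<and>
    (\<forall>y\<in>carrier N. (\<lambda>x. \<beta> x y) \<in> linear_map R M P)"

lemma bilinearI:
  assumes "\<And>x. x \<in> carrier M \<Longrightarrow> (\<lambda>y. \<beta> x y) \<in> linear_map R N P"
    and "\<And>y. y \<in> carrier N \<Longrightarrow> (\<lambda>x. \<beta> x y) \<in> linear_map R M P"
  shows "bilinear R M N P \<beta>"
  using assms by (simp add: bilinear_def)

lemma bilinear_left: "bilinear R M N P \<beta> \<Longrightarrow> y \<in> carrier N \<Longrightarrow> (\<lambda>x. \<beta> x y) \<in> linear_map R M P"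
  and bilinear_right: "bilinear R M N P \<beta> \<Longrightarrow> x \<in> carrier M \<Longrightarrow> (\<lambda>y. \<beta> x y) \<in> linear_map R N P"
  by (simp_all add: bilinear_def)

lemma bilinear_closed:
  "bilinear R M N P \<beta> \<Longrightarrow> x \<in> carrier M \<Longrightarrow> y \<in> carrier N \<Longrightarrow> \<beta> x y \<in> carrier P"
  using linear_map_closed by (fastforce simp: bilinear_def)

locale two_modules = M?: module R M + N?: module R N for R and M and N
begin

abbreviation (input) "F \<equiv> free_module R (carrier M \<times> carrier N)"
abbreviation (input) "T \<equiv> tensor R M N"

lemma cring: "cring R" by (rule M.R.is_cring)

lemma module_F: "module R F" by (rule module_free) (rule cring)

lemma basis_closed: "m \<in> carrier M \<Longrightarrow> n \<in> carrier N \<Longrightarrow> free_basis R (m, n) \<in> carrier F"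
  by (rule free_basis_closed) (auto intro: cring)

lemma rels_closed: "tensor_rels R M N \<subseteq> carrier F"
proof -
  interpret F: module R F by (rule module_F)
  show ?thesis unfolding tensor_rels_def Let_def
    by (auto intro!: F.minus_closed F.add.m_closed F.smult_closed basis_closed)
qed

sublocale K: quotient R F "tensor_kernel R M N"
  unfolding tensor_kernel_def
  by (intro quotient.intro quotient_axioms.intro module_F module_span_submodule rels_closed)

lemma pure_closed: "m \<in> carrier M \<Longrightarrow> n \<in> carrier N \<Longrightarrow> pure_tensor R M N m n \<in> carrier T"
  by (simp add: tensor_def pure_tensor_def K.coset_in_quot basis_closed)

lemma module_tensor: "module R T"
  unfolding tensor_def by (rule K.module_quot)

text \<open>
  Each of the four families of relations becomes an equation between cosets in this way.
\<close>

lemma pure_rel: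
  assumes "u \<ominus>\<^bsub>F\<^esub> v \<in> tensor_rels R M N" "u \<in> carrier F" "v \<in> carrier F"
  shows "tensor_kernel R M N +>\<^bsub>F\<^esub> u = tensor_kernel R M N +>\<^bsub>F\<^esub> v"
  using assms by (simp add: K.quot_eq_iff) (simp add: tensor_kernel_def module_span_incl)

lemma pure_bilinear: "bilinear R M N T (pure_tensor R M N)"
proof (rule bilinearI)
  interpret F: module R F by (rule module_F)
  fix x assume x: "x \<in> carrier M"
  show "(\<lambda>y. pure_tensor R M N x y) \<in> linear_map R N T"
  proof (rule linear_mapI)
    fix y z assume y: "y \<in> carrier N" and z: "z \<in> carrier N"
    have "pure_tensor R M N x (y \<oplus>\<^bsub>N\<^esub> z) =
        tensor_kernel R M N +>\<^bsub>F\<^esub> (free_basis R (x, y) \<oplus>\<^bsub>F\<^esub> free_basis R (x, z))"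
      unfolding pure_tensor_def
      by (rule pure_rel) (use x y z in \<open>auto simp: basis_closed tensor_rels_def Let_def\<close>)
    then show "pure_tensor R M N x (y \<oplus>\<^bsub>N\<^esub> z) =
        pure_tensor R M N x y \<oplus>\<^bsub>T\<^esub> pure_tensor R M N x z"
      using x y z by (simp add: pure_tensor_def tensor_def K.quot_add basis_closed)
  next
    fix a y assume y: "a \<in> carrier R" "y \<in> carrier N"
    have "pure_tensor R M N x (a \<odot>\<^bsub>N\<^esub> y) =
        tensor_kernel R M N +>\<^bsub>F\<^esub> (a \<odot>\<^bsub>F\<^esub> free_basis R (x, y))"
      unfolding pure_tensor_def
      by (rule pure_rel) (use x y in \<open>auto simp: basis_closed tensor_rels_def Let_def\<close>)
    then show "pure_tensor R M N x (a \<odot>\<^bsub>N\<^esub> y) = a \<odot>\<^bsub>T\<^esub> pure_tensor R M N x y"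
      using x y by (simp add: pure_tensor_def tensor_def K.quot_smult basis_closed)
  qed (simp add: pure_closed x)
next
  interpret F: module R F by (rule module_F)
  fix x assume x: "x \<in> carrier N"
  show "(\<lambda>y. pure_tensor R M N y x) \<in> linear_map R M T"
  proof (rule linear_mapI)
    fix y z assume y: "y \<in> carrier M" and z: "z \<in> carrier M"
    have "pure_tensor R M N (y \<oplus>\<^bsub>M\<^esub> z) x =
        tensor_kernel R M N +>\<^bsub>F\<^esub> (free_basis R (y, x) \<oplus>\<^bsub>F\<^esub> free_basis R (z, x))"
      unfolding pure_tensor_def
      by (rule pure_rel) (use x y z in \<open>auto simp: basis_closed tensor_rels_def Let_def\<close>)
    then show "pure_tensor R M N (y \<oplus>\<^bsub>M\<^esub> z) x =
        pure_tensor R M N y x \<oplus>\<^bsub>T\<^esub> pure_tensor R M N z x"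
      using x y z by (simp add: pure_tensor_def tensor_def K.quot_add basis_closed)
  next
    fix a y assume y: "a \<in> carrier R" "y \<in> carrier M"
    have "pure_tensor R M N (a \<odot>\<^bsub>M\<^esub> y) x =
        tensor_kernel R M N +>\<^bsub>F\<^esub> (a \<odot>\<^bsub>F\<^esub> free_basis R (y, x))"
      unfolding pure_tensor_def
      by (rule pure_rel) (use x y in \<open>auto simp: basis_closed tensor_rels_def Let_def\<close>)
    then show "pure_tensor R M N (a \<odot>\<^bsub>M\<^esub> y) x = a \<odot>\<^bsub>T\<^esub> pure_tensor R M N y x"
      using x y by (simp add: pure_tensor_def tensor_def K.quot_smult basis_closed)
  qed (simp add: pure_closed x)
qed

text \<open>
  The universal property: the linear extension of a bilinear map to the free module kills the relations.
\<close>

lemma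
  assumes P: "module R P" and \<beta>: "bilinear R M N P \<beta>"
  shows lift_linear: "tensor_lift R M N P \<beta> \<in> linear_map R T P"
    and lift_pure: "\<lbrakk>m \<in> carrier M; n \<in> carrier N\<rbrakk> \<Longrightarrow>
      tensor_lift R M N P \<beta> (pure_tensor R M N m n) = \<beta> m n"
proof -
  interpret P: module R P by fact
  interpret F: module R F by (rule module_F)
  let ?\<beta> = "\<lambda>p. \<beta> (fst p) (snd p)"
  have c: "\<And>x. x \<in> carrier M \<times> carrier N \<Longrightarrow> ?\<beta> x \<in> carrier P"
    using bilinear_closed[OF \<beta>] by auto
  note lin = free_lift_linear[where \<beta> = ?\<beta>, OF P c]
  have basis: "free_lift R P ?\<beta> (free_basis R (m, n)) = \<beta> m n"
    if "m \<in> carrier M" "n \<in> carrier N" for m n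
    using free_lift_basis[where \<beta> = ?\<beta> and X = "carrier M \<times> carrier N" and x = "(m, n)", OF P _ c] that
    by simp
  note ls = linear_map_minus[OF lin module_F P] linear_map_add[OF lin] linear_map_smult[OF lin]
  have "tensor_rels R M N \<subseteq> {t \<in> carrier F. free_lift R P ?\<beta> t = \<zero>\<^bsub>P\<^esub>}"
  proof -
    have "free_lift R P ?\<beta> t = \<zero>\<^bsub>P\<^esub>" if "t \<in> tensor_rels R M N" for t
      using that bilinear_closed[OF \<beta>]
        linear_map_add[OF bilinear_left[OF \<beta>]] linear_map_add[OF bilinear_right[OF \<beta>]]
        linear_map_smult[OF bilinear_left[OF \<beta>]] linear_map_smult[OF bilinear_right[OF \<beta>]]
      unfolding tensor_rels_def Let_def
      by (auto simp: ls basis basis_closed P.minus_eq_zero_iff)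
    then show ?thesis using rels_closed by auto
  qed
  then have "tensor_kernel R M N \<subseteq> {t \<in> carrier F. free_lift R P ?\<beta> t = \<zero>\<^bsub>P\<^esub>}"
    unfolding tensor_kernel_def by (intro module_span_least submodule_kernel lin module_F P)
  then have ker: "\<forall>t\<in>tensor_kernel R M N. free_lift R P ?\<beta> t = \<zero>\<^bsub>P\<^esub>" by auto
  have eq: "tensor_lift R M N P \<beta> = quot_lift (free_lift R P ?\<beta>)"
    by (simp add: tensor_lift_def free_lift_def[abs_def])
  show "tensor_lift R M N P \<beta> \<in> linear_map R T P"
    unfolding eq tensor_def by (rule K.quot_lift_linear[OF lin P ker])
  show "tensor_lift R M N P \<beta> (pure_tensor R M N m n) = \<beta> m n"
    if "m \<in> carrier M" "n \<in> carrier N"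
    unfolding eq pure_tensor_def using K.quot_lift_coset[OF lin P ker basis_closed[OF that]] basis[OF that]
    by simp
qed

text \<open>
  The tensor product is a quotient of the free module, hence it is spanned by the images of the basis,
  which are the pure tensors.
\<close>

lemma spanned:
  assumes L: "submodule L R T"
    and pure: "\<And>m n. m \<in> carrier M \<Longrightarrow> n \<in> carrier N \<Longrightarrow> pure_tensor R M N m n \<in> L"
    and t: "t \<in> carrier T"
  shows "t \<in> L"
proof -
  have lin: "(\<lambda>x. tensor_kernel R M N +>\<^bsub>F\<^esub> x) \<in> linear_map R F T"
    unfolding tensor_def by (rule K.coset_linear)
  obtain x where x: "x \<in> carrier F" "t = tensor_kernel R M N +>\<^bsub>F\<^esub> x"
    using t by (auto simp: tensor_def K.quot_carrier)
  have "x \<in> {x \<in> carrier F. tensor_kernel R M N +>\<^bsub>F\<^esub> x \<in> L}"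
    by (rule free_module_spanned[OF cring submodule_preimage[OF lin module_F module_tensor L] _ x(1)])
       (use pure in \<open>auto simp: pure_tensor_def basis_closed\<close>)
  then show ?thesis using x by simp
qed

lemma ext:
  assumes f: "f \<in> linear_map R T P" and g: "g \<in> linear_map R T P" and P: "module R P"
    and eq: "\<And>m n. m \<in> carrier M \<Longrightarrow> n \<in> carrier N \<Longrightarrow>
      f (pure_tensor R M N m n) = g (pure_tensor R M N m n)"
    and t: "t \<in> carrier T"
  shows "f t = g t"
proof -
  interpret P: module R P by fact
  have "t \<in> {t \<in> carrier T. f t \<ominus>\<^bsub>P\<^esub> g t = \<zero>\<^bsub>P\<^esub>}"
    by (rule spanned[OF submodule_kernel[OF linear_map_diff[OF f g P] module_tensor P] _ t])
       (auto simp: pure_closed eq linear_map_closed[OF g] P.minus_eq_zero_iff)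
  then show ?thesis
    using linear_map_closed[OF f t] linear_map_closed[OF g t] by (simp add: P.minus_eq_zero_iff)
qed

end

text \<open>
  The fold behind a finite sum inspects the summands at the indices only, whether or not they lie in the
  carrier. So terms below a \<^const>\<open>tensor_lift\<close> can be rewritten before anything is known to be bilinear.
\<close>

lemma finsum_cong_unconditional:
  fixes f g :: "'x \<Rightarrow> 'y"
  assumes "\<And>x. x \<in> A \<Longrightarrow> f x = g x"
  shows "finsum G f A = finsum G g A"
proof -
  have *: "(B, z) \<in> foldSetD D k e" 
    if "(B, z) \<in> foldSetD D h e" "B \<subseteq> A" "\<And>x. x \<in> A \<Longrightarrow> h x = k x" for B z D e and h k :: "'x \<Rightarrow> 'y \<Rightarrow> 'y"
    using that
  proof induct
    case emptyI then show ?case by (auto intro: foldSetD.intros)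
  next
    case (insertI x B y)
    then have "(insert x B, k x y) \<in> foldSetD D k e"
      by (intro foldSetD.insertI) auto
    then show ?case using insertI by simp
  qed
  have "foldD D (mult (add_monoid G) \<circ> f) e A = foldD D (mult (add_monoid G) \<circ> g) e A" for D e
  proof -
    have "(A, z) \<in> foldSetD D (mult (add_monoid G) \<circ> f) e \<longleftrightarrow>
        (A, z) \<in> foldSetD D (mult (add_monoid G) \<circ> g) e" for z
      using *[of A z D _ e] assms by auto
    then show ?thesis by (simp add: foldD_def)
  qed
  then show ?thesis by (simp add: finsum_def finprod_def)
qed

lemma two_modulesI: "module R M \<Longrightarrow> module R N \<Longrightarrow> two_modules R M N"
  by (rule two_modules.intro)

lemmas module_tensor = two_modules.module_tensor[OF two_modulesI]
lemmas pure_tensor_closed = two_modules.pure_closed[OF two_modulesI]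
lemmas pure_tensor_bilinear = two_modules.pure_bilinear[OF two_modulesI]
lemmas tensor_lift_linear = two_modules.lift_linear[OF two_modulesI]
lemmas tensor_lift_pure = two_modules.lift_pure[OF two_modulesI]
lemmas tensor_spanned = two_modules.spanned[OF two_modulesI]
lemmas tensor_ext = two_modules.ext[OF two_modulesI]

lemma tensor_lift_cong:
  assumes "module R M" "module R N" "t \<in> carrier (tensor R M N)"
    and "\<And>x y. \<lbrakk>x \<in> carrier M; y \<in> carrier N\<rbrakk> \<Longrightarrow> \<beta> x y = \<beta>' x y"
  shows "tensor_lift R M N P \<beta> t = tensor_lift R M N P \<beta>' t"
proof -
  interpret two_modules R M N by (rule two_modulesI) fact+
  obtain s where s: "s \<in> carrier F" "t = tensor_kernel R M N +>\<^bsub>F\<^esub> s"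
    using assms(3) by (auto simp: tensor_def K.quot_carrier)
  have "u \<in> carrier F" if "u \<in> t" for u
    using that s K.a_elemrcos_carrier by blast
  then have "{p. u p \<noteq> \<zero>\<^bsub>R\<^esub>} \<subseteq> carrier M \<times> carrier N" if "u \<in> t" for u
    using that by (auto simp: free_module_def)
  then show ?thesis unfolding tensor_lift_def quot_lift_def
    by (intro arg_cong[where f = the_elem] image_cong refl finsum_cong_unconditional)
       (use assms(4) in force)
qed

lemma pure_linear_left:
  assumes "module R M" "module R N" "f \<in> linear_map R Z M" "n \<in> carrier N"
  shows "(\<lambda>z. pure_tensor R M N (f z) n) \<in> linear_map R Z (tensor R M N)"
  by (rule linear_map_comp[OF bilinear_left[OF pure_tensor_bilinear] assms(3)]) fact+

lemma pure_linear_right: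
  assumes "module R M" "module R N" "f \<in> linear_map R Z N" "m \<in> carrier M"
  shows "(\<lambda>z. pure_tensor R M N m (f z)) \<in> linear_map R Z (tensor R M N)"
  by (rule linear_map_comp[OF bilinear_right[OF pure_tensor_bilinear] assms(3)]) fact+

lemma tensor_lift_closed:
  assumes "module R M" "module R N" "module R P" "bilinear R M N P \<beta>" "t \<in> carrier (tensor R M N)"
  shows "tensor_lift R M N P \<beta> t \<in> carrier P"
  by (rule linear_map_closed[OF tensor_lift_linear]) fact+

lemma tensor_lift_linear_arg:
  assumes "module R M" "module R N" "module R P" "bilinear R M N P \<beta>"
    and "f \<in> linear_map R Z (tensor R M N)"
  shows "(\<lambda>z. tensor_lift R M N P \<beta> (f z)) \<in> linear_map R Z P"
  by (rule linear_map_comp[OF tensor_lift_linear]) fact+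

text \<open>
  Together with the linearity in the tensor, this settles nested lifts, in which a variable may occur in
  the bilinear map as well as in the tensor.
\<close>

lemma tensor_lift_linear_param:
  assumes M: "module R M" and N: "module R N" and P: "module R P" and Z: "module R Z"
    and "\<And>z. z \<in> carrier Z \<Longrightarrow> bilinear R M N P (\<beta> z)"
    and "\<And>x y. \<lbrakk>x \<in> carrier M; y \<in> carrier N\<rbrakk> \<Longrightarrow> (\<lambda>z. \<beta> z x y) \<in> linear_map R Z P"
    and t: "t \<in> carrier (tensor R M N)"
  shows "(\<lambda>z. tensor_lift R M N P (\<beta> z) t) \<in> linear_map R Z P"
proof (rule linear_mapI)
  interpret Z: module R Z by fact
  interpret P: module R P by fact
  note lin = tensor_lift_linear[OF M N P assms(5)]
  note lift = tensor_lift_pure[OF M N P assms(5)]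
  fix z assume z: "z \<in> carrier Z"
  show "tensor_lift R M N P (\<beta> z) t \<in> carrier P" by (rule linear_map_closed[OF lin[OF z] t])
  {
    fix w assume w: "w \<in> carrier Z"
    show "tensor_lift R M N P (\<beta> (z \<oplus>\<^bsub>Z\<^esub> w)) t =
        tensor_lift R M N P (\<beta> z) t \<oplus>\<^bsub>P\<^esub> tensor_lift R M N P (\<beta> w) t"
      by (rule tensor_ext[OF M N _ linear_map_plus[OF lin[OF z] lin[OF w] P] P _ t])
         (use z w in \<open>simp_all add: lin lift linear_map_add[OF assms(6)]\<close>)
  }
  fix a assume a: "a \<in> carrier R"
  show "tensor_lift R M N P (\<beta> (a \<odot>\<^bsub>Z\<^esub> z)) t = a \<odot>\<^bsub>P\<^esub> tensor_lift R M N P (\<beta> z) t"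
    by (rule tensor_ext[OF M N _ linear_map_const_smult[OF lin[OF z] P a] P _ t])
       (use z a in \<open>simp_all add: lin lift linear_map_smult[OF assms(6)]\<close>)
qed

lemma linear_map_tensor_lift:
  assumes M: "module R M" and N: "module R N" and P: "module R P" and P': "module R P'"
    and g: "g \<in> linear_map R P P'" and \<beta>: "bilinear R M N P \<beta>"
    and t: "t \<in> carrier (tensor R M N)"
  shows "g (tensor_lift R M N P \<beta> t) = tensor_lift R M N P' (\<lambda>x y. g (\<beta> x y)) t"
proof (rule tensor_ext[OF M N _ _ P' _ t])
  have b: "bilinear R M N P' (\<lambda>x y. g (\<beta> x y))"
    by (rule bilinearI; rule linear_map_comp[OF g]) (simp_all add: bilinear_left[OF \<beta>] bilinear_right[OF \<beta>])
  show "tensor_lift R M N P' (\<lambda>x y. g (\<beta> x y)) \<in> linear_map R (tensor R M N) P'"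
    by (rule tensor_lift_linear[OF M N P' b])
  show "(\<lambda>t. g (tensor_lift R M N P \<beta> t)) \<in> linear_map R (tensor R M N) P'"
    by (rule linear_map_comp[OF g tensor_lift_linear[OF M N P \<beta>]])
  fix m n assume "m \<in> carrier M" "n \<in> carrier N"
  then show "g (tensor_lift R M N P \<beta> (pure_tensor R M N m n)) =
      tensor_lift R M N P' (\<lambda>x y. g (\<beta> x y)) (pure_tensor R M N m n)"
    by (simp add: tensor_lift_pure[OF M N P \<beta>] tensor_lift_pure[OF M N P' b])
qed

lemma tensor_map_bilinear:
  assumes "module R M'" "module R N'" "f \<in> linear_map R M M'" "g \<in> linear_map R N N'"
  shows "bilinear R M N (tensor R M' N') (\<lambda>m n. pure_tensor R M' N' (f m) (g n))"
  by (intro bilinearI pure_linear_left pure_linear_right linear_map_closed[OF assms(3)]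
      linear_map_closed[OF assms(4)] assms)

context
  fixes R M N M' N' f g
  assumes M: "module R M" and N: "module R N" and M': "module R M'" and N': "module R N'"
    and f: "f \<in> linear_map R M M'" and g: "g \<in> linear_map R N N'"
begin

lemma tensor_map_linear:
  "tensor_map R M N M' N' f g \<in> linear_map R (tensor R M N) (tensor R M' N')"
  unfolding tensor_map_def
  by (rule tensor_lift_linear[OF M N module_tensor[OF M' N'] tensor_map_bilinear[OF M' N' f g]])

lemma tensor_map_pure:
  "\<lbrakk>m \<in> carrier M; n \<in> carrier N\<rbrakk> \<Longrightarrow>
    tensor_map R M N M' N' f g (pure_tensor R M N m n) = pure_tensor R M' N' (f m) (g n)"
  unfolding tensor_map_def
  by (rule tensor_lift_pure[OF M N module_tensor[OF M' N'] tensor_map_bilinear[OF M' N' f g]])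

end

lemma id_linear: "id \<in> linear_map R M M"
  using linear_map_id by (simp add: id_def)

lemma tensor_assoc_bilinear:
  assumes M: "module R M" and N: "module R N" and P: "module R P"
  shows "bilinear R M (tensor R N P) (tensor R (tensor R M N) P)
    (\<lambda>m. tensor_map R N P (tensor R M N) P (pure_tensor R M N m) id)"
proof -
  note mods = M N P module_tensor[OF M N] module_tensor[OF N P] module_tensor[OF module_tensor[OF M N] P]
  note p = bilinear_right[OF pure_tensor_bilinear[OF M N]]
  show ?thesis
  proof (rule bilinearI)
    fix x assume x: "x \<in> carrier M"
    then show "tensor_map R N P (tensor R M N) P (pure_tensor R M N x) id \<in>
        linear_map R (tensor R N P) (tensor R (tensor R M N) P)"
      by (intro tensor_map_linear mods p id_linear)
  next
    fix t assume t: "t \<in> carrier (tensor R N P)"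
    show "(\<lambda>x. tensor_map R N P (tensor R M N) P (pure_tensor R M N x) id t) \<in>
        linear_map R M (tensor R (tensor R M N) P)"
      unfolding tensor_map_def
      by (intro tensor_lift_linear_param mods t tensor_map_bilinear p id_linear)
         (auto intro!: mods pure_linear_left bilinear_left[OF pure_tensor_bilinear])
  qed
qed

lemma tensor_assoc_linear:
  assumes M: "module R M" and N: "module R N" and P: "module R P"
  shows "tensor_assoc R M N P \<in>
    linear_map R (tensor R M (tensor R N P)) (tensor R (tensor R M N) P)"
  unfolding tensor_assoc_def
  by (intro tensor_lift_linear tensor_assoc_bilinear module_tensor assms)

lemma tensor_assoc_pure:
  assumes M: "module R M" and N: "module R N" and P: "module R P"
    and m: "m \<in> carrier M" "n \<in> carrier N" "p \<in> carrier P"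
  shows "tensor_assoc R M N P (pure_tensor R M (tensor R N P) m (pure_tensor R N P n p)) =
    pure_tensor R (tensor R M N) P (pure_tensor R M N m n) p"
proof -
  note mods = M N P module_tensor[OF M N] module_tensor[OF N P] module_tensor[OF module_tensor[OF M N] P]
  show ?thesis unfolding tensor_assoc_def
    using m bilinear_right[OF pure_tensor_bilinear[OF M N]]
    by (simp add: tensor_lift_pure[OF _ _ _ tensor_assoc_bilinear] mods tensor_map_pure id_linear
        pure_tensor_closed)
qed

text \<open>
  Flatness of \<open>H\<close> concerns \<open>H \<otimes> -\<close>; the symmetry transports its consequences to \<open>- \<otimes> H\<close>.
\<close>

definition tensor_swap where
  "tensor_swap R M N = tensor_lift R M N (tensor R N M) (\<lambda>m n. pure_tensor R N M n m)"

lemma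
  assumes M: "module R M" and N: "module R N"
  shows tensor_swap_linear: "tensor_swap R M N \<in> linear_map R (tensor R M N) (tensor R N M)"
    and tensor_swap_pure: "\<lbrakk>m \<in> carrier M; n \<in> carrier N\<rbrakk> \<Longrightarrow>
      tensor_swap R M N (pure_tensor R M N m n) = pure_tensor R N M n m"
proof -
  have b: "bilinear R M N (tensor R N M) (\<lambda>m n. pure_tensor R N M n m)"
    using pure_tensor_bilinear[OF N M] by (auto simp: bilinear_def)
  show "tensor_swap R M N \<in> linear_map R (tensor R M N) (tensor R N M)"
    unfolding tensor_swap_def by (rule tensor_lift_linear[OF M N module_tensor[OF N M] b])
  show "tensor_swap R M N (pure_tensor R M N m n) = pure_tensor R N M n m"
    if "m \<in> carrier M" "n \<in> carrier N"
    unfolding tensor_swap_def by (rule tensor_lift_pure[OF M N module_tensor[OF N M] b that])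
qed

lemma tensor_swap_swap:
  assumes M: "module R M" and N: "module R N" and t: "t \<in> carrier (tensor R M N)"
  shows "tensor_swap R N M (tensor_swap R M N t) = t"
  by (rule tensor_ext[OF M N linear_map_comp[OF tensor_swap_linear tensor_swap_linear] linear_map_id])
     (use assms in \<open>simp_all add: tensor_swap_pure module_tensor\<close>)

text \<open>
  Right exactness of \<open>P \<otimes> -\<close>. The kernel of \<open>id \<otimes> f\<close> is the image of \<open>P \<otimes> ker f\<close>; that is, it lies in every
  submodule \<open>L\<close> that contains the pure tensors \<open>p \<otimes> m\<close> with \<open>f m = 0\<close>. For the proof, \<open>p \<otimes> f m \<mapsto> [p \<otimes> m]\<close> is a
  well-defined map \<open>P \<otimes> N \<rightarrow> (P \<otimes> M)/L\<close>, and composed with \<open>id \<otimes> f\<close> it is the projection.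
\<close>

lemma right_exact:
  assumes P: "module R P" and M: "module R M" and N: "module R N"
    and f: "f \<in> linear_map R M N" and surj: "f ` carrier M = carrier N"
    and L: "submodule L R (tensor R P M)"
    and ker: "\<And>p m. \<lbrakk>p \<in> carrier P; m \<in> carrier M; f m = \<zero>\<^bsub>N\<^esub>\<rbrakk> \<Longrightarrow> pure_tensor R P M p m \<in> L"
    and t: "t \<in> carrier (tensor R P M)"
    and 0: "tensor_map R P M P N id f t = \<zero>\<^bsub>tensor R P N\<^esub>"
  shows "t \<in> L"
proof -
  interpret M: module R M by (rule M)
  interpret N: module R N by (rule N)
  interpret T: module R "tensor R P M" by (rule module_tensor[OF P M])
  interpret Q: quotient R "tensor R P M" L by (intro quotient.intro quotient_axioms.intro T.module_axioms L)
  let ?Q = "quot_module (tensor R P M) L"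
  \<comment> \<open>An arbitrary set-theoretic section; it becomes linear modulo \<open>L\<close> because its ambiguity lies in the kernel of \<open>f\<close>.\<close>
  define sec where "sec n = (SOME m. m \<in> carrier M \<and> f m = n)" for n
  have sec: "sec n \<in> carrier M" "f (sec n) = n" if "n \<in> carrier N" for n
  proof -
    have "\<exists>m. m \<in> carrier M \<and> f m = n" using that unfolding surj[symmetric] by (auto simp: image_iff)
    then have "sec n \<in> carrier M \<and> f (sec n) = n" unfolding sec_def by (rule someI_ex)
    then show "sec n \<in> carrier M" "f (sec n) = n" by blast+
  qed
  define q where "q p m = L +>\<^bsub>tensor R P M\<^esub> pure_tensor R P M p m" for p m
  have q: "bilinear R P M ?Q q" unfolding q_def
    by (intro bilinearI linear_map_comp[OF Q.coset_linear] bilinear_left[OF pure_tensor_bilinear]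
        bilinear_right[OF pure_tensor_bilinear] P M)
  note qr = bilinear_right[OF q] and ql = bilinear_left[OF q]
  have eq: "q p m = q p m'" if "p \<in> carrier P" "m \<in> carrier M" "m' \<in> carrier M" "f m = f m'" for p m m'
  proof -
    have "f (m \<ominus>\<^bsub>M\<^esub> m') = \<zero>\<^bsub>N\<^esub>"
      using that linear_map_closed[OF f] by (simp add: linear_map_minus[OF f M N] N.minus_eq_zero_iff)
    then have "q p (m \<ominus>\<^bsub>M\<^esub> m') = \<zero>\<^bsub>?Q\<^esub>"
      using ker that unfolding q_def by (subst Q.coset_eq_zero_iff) (simp_all add: pure_tensor_closed P M)
    then show ?thesis
      using that unfolding linear_map_minus[OF qr[OF that(1)] M Q.module_quot that(2,3)]
      by (subst (asm) abelian_group.minus_eq_zero_iff[OF module.axioms(2)[OF Q.module_quot]])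
         (auto intro: bilinear_closed[OF q])
  qed
  have \<beta>: "bilinear R P N ?Q (\<lambda>p n. q p (sec n))"
  proof (rule bilinearI)
    fix p assume p: "p \<in> carrier P"
    show "(\<lambda>n. q p (sec n)) \<in> linear_map R N ?Q"
    proof (rule linear_mapI)
      fix x assume x: "x \<in> carrier N"
      show "q p (sec x) \<in> carrier ?Q" using bilinear_closed[OF q] p sec x by blast
      {
        fix y assume y: "y \<in> carrier N"
        have "q p (sec (x \<oplus>\<^bsub>N\<^esub> y)) = q p (sec x \<oplus>\<^bsub>M\<^esub> sec y)"
          by (rule eq) (use x y p sec linear_map_add[OF f] in simp_all)
        then show "q p (sec (x \<oplus>\<^bsub>N\<^esub> y)) = q p (sec x) \<oplus>\<^bsub>?Q\<^esub> q p (sec y)"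
          using x y p sec by (simp add: linear_map_add[OF qr])
      }
      fix a assume a: "a \<in> carrier R"
      have "q p (sec (a \<odot>\<^bsub>N\<^esub> x)) = q p (a \<odot>\<^bsub>M\<^esub> sec x)"
        by (rule eq) (use x a p sec linear_map_smult[OF f] in simp_all)
      then show "q p (sec (a \<odot>\<^bsub>N\<^esub> x)) = a \<odot>\<^bsub>?Q\<^esub> q p (sec x)"
        using x a p sec by (simp add: linear_map_smult[OF qr])
    qed
  next
    fix n assume "n \<in> carrier N"
    then show "(\<lambda>p. q p (sec n)) \<in> linear_map R P ?Q" by (rule ql[OF sec(1)])
  qed
  have "tensor_lift R P N ?Q (\<lambda>p n. q p (sec n)) (tensor_map R P M P N id f t) = L +>\<^bsub>tensor R P M\<^esub> t"
  proof (rule tensor_ext[OF P M _ Q.coset_linear Q.module_quot _ t])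
    show "(\<lambda>t. tensor_lift R P N ?Q (\<lambda>p n. q p (sec n)) (tensor_map R P M P N id f t))
      \<in> linear_map R (tensor R P M) ?Q"
      by (intro tensor_lift_linear_arg tensor_map_linear P M N Q.module_quot \<beta> id_linear f)
    fix p m assume pm: "p \<in> carrier P" "m \<in> carrier M"
    then have "q p (sec (f m)) = q p m"
      by (intro eq) (simp_all add: sec linear_map_closed[OF f])
    then have "tensor_lift R P N ?Q (\<lambda>p n. q p (sec n)) (tensor_map R P M P N id f (pure_tensor R P M p m)) = q p m"
      using pm linear_map_closed[OF f]
      by (simp add: tensor_map_pure[OF P M P N id_linear f] tensor_lift_pure[OF P N Q.module_quot \<beta>])
    then show "tensor_lift R P N ?Q (\<lambda>p n. q p (sec n)) (tensor_map R P M P N id f (pure_tensor R P M p m)) =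
        L +>\<^bsub>tensor R P M\<^esub> pure_tensor R P M p m" by (simp only: q_def)
  qed
  moreover have "tensor_lift R P N ?Q (\<lambda>p n. q p (sec n)) \<zero>\<^bsub>tensor R P N\<^esub> = \<zero>\<^bsub>?Q\<^esub>"
    by (intro linear_map_zero[OF tensor_lift_linear] P N Q.module_quot \<beta> module_tensor)
  ultimately show ?thesis using Q.coset_eq_zero_iff[OF t] unfolding 0 by simp
qed

text \<open>
  For flat \<open>P\<close> the same holds when \<open>f\<close> is not surjective: \<open>f\<close> factors through its image \<open>f(M) \<subseteq> N\<close>, and \<open>P \<otimes> f(M) \<rightarrow> P \<otimes> N\<close>
  is injective. Since \<open>f(M)\<close> has elements in the type of \<open>N\<close>, the domain \<open>M\<close> may live in any type. With
  \<open>L = 0\<close> this gives injectivity of \<open>id \<otimes> f\<close> for injective \<open>f\<close>.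
\<close>

lemma flat_exact:
  fixes N :: "('r, 'x) module"
  assumes flat: "flat_module TYPE('x) R P"
    and P: "module R P" and M: "module R M" and N: "module R N"
    and f: "f \<in> linear_map R M N"
    and L: "submodule L R (tensor R P M)"
    and ker: "\<And>p m. \<lbrakk>p \<in> carrier P; m \<in> carrier M; f m = \<zero>\<^bsub>N\<^esub>\<rbrakk> \<Longrightarrow> pure_tensor R P M p m \<in> L"
    and t: "t \<in> carrier (tensor R P M)"
    and 0: "tensor_map R P M P N id f t = \<zero>\<^bsub>tensor R P N\<^esub>"
  shows "t \<in> L"
proof -
  let ?I = "N\<lparr>carrier := f ` carrier M\<rparr>"
  have I: "module R ?I"
    by (rule submodule.submodule_is_module[OF submodule_image[OF f M N] N])
  have inc: "(\<lambda>x. x) \<in> linear_map R ?I N"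
    using linear_map_closed[OF f] by (auto simp: linear_map_def)
  have fI: "f \<in> linear_map R M ?I"
    using f by (auto simp: linear_map_def)
  note lin = tensor_map_linear[OF P I P N id_linear inc] tensor_map_linear[OF P M P I id_linear fI]
  have inj: "inj_on (tensor_map R P ?I P N id (\<lambda>x. x)) (carrier (tensor R P ?I))"
    using flat I N inc unfolding flat_module_def by (metis inj_on_id2)
  have "tensor_map R P ?I P N id (\<lambda>x. x) (tensor_map R P M P ?I id f t) = tensor_map R P M P N id f t"
    by (rule tensor_ext[OF P M linear_map_comp[OF lin] tensor_map_linear[OF P M P N id_linear f]
          module_tensor[OF P N] _ t])
       (simp add: tensor_map_pure[OF P M P I id_linear fI] tensor_map_pure[OF P I P N id_linear inc]
         tensor_map_pure[OF P M P N id_linear f])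
  also have "\<dots> = tensor_map R P ?I P N id (\<lambda>x. x) \<zero>\<^bsub>tensor R P ?I\<^esub>"
    by (simp add: 0 linear_map_zero[OF lin(1) module_tensor[OF P I] module_tensor[OF P N]])
  finally have "tensor_map R P M P ?I id f t = \<zero>\<^bsub>tensor R P ?I\<^esub>"
    using inj linear_map_closed[OF lin(2) t] abelian_monoid.zero_closed[OF abelian_group.axioms(1)[OF module.axioms(2)[OF module_tensor[OF P I]]]]
    by (auto dest: inj_onD)
  then show ?thesis
    by (intro right_exact[OF P M I fI _ L _ t]) (auto intro: ker)
qed

lemma tensor_lift_mem:
  assumes "module R M" "module R N" "module R P" "bilinear R M N P \<beta>" "submodule L R P"
    and "\<And>x y. \<lbrakk>x \<in> carrier M; y \<in> carrier N\<rbrakk> \<Longrightarrow> \<beta> x y \<in> L"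
    and t: "t \<in> carrier (tensor R M N)"
  shows "tensor_lift R M N P \<beta> t \<in> L"
proof -
  have "t \<in> {t \<in> carrier (tensor R M N). tensor_lift R M N P \<beta> t \<in> L}"
    by (rule tensor_spanned[OF assms(1,2) submodule_preimage _ t])
       (auto intro!: tensor_lift_linear module_tensor pure_tensor_closed assms simp: tensor_lift_pure[OF assms(1-4)])
  then show ?thesis by simp
qed

lemma tensor_map_comp:
  assumes M: "module R M" and N: "module R N" and M': "module R M'" and N': "module R N'"
    and M'': "module R M''" and N'': "module R N''"
    and f: "f \<in> linear_map R M M'" and g: "g \<in> linear_map R N N'"
    and f': "f' \<in> linear_map R M' M''" and g': "g' \<in> linear_map R N' N''"
    and t: "t \<in> carrier (tensor R M N)"
  shows "tensor_map R M' N' M'' N'' f' g' (tensor_map R M N M' N' f g t) =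
    tensor_map R M N M'' N'' (\<lambda>x. f' (f x)) (\<lambda>x. g' (g x)) t"
proof (rule tensor_ext[OF M N _ _ module_tensor[OF M'' N''] _ t])
  show "(\<lambda>t. tensor_map R M' N' M'' N'' f' g' (tensor_map R M N M' N' f g t))
      \<in> linear_map R (tensor R M N) (tensor R M'' N'')"
    by (rule linear_map_comp[OF tensor_map_linear[OF M' N' M'' N'' f' g'] tensor_map_linear[OF M N M' N' f g]])
  note fg = linear_map_comp[OF f' f] linear_map_comp[OF g' g]
  show "tensor_map R M N M'' N'' (\<lambda>x. f' (f x)) (\<lambda>x. g' (g x)) \<in> linear_map R (tensor R M N) (tensor R M'' N'')"
    by (rule tensor_map_linear[OF M N M'' N'' fg])
  fix m n assume mn: "m \<in> carrier M" "n \<in> carrier N"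
  then show "tensor_map R M' N' M'' N'' f' g' (tensor_map R M N M' N' f g (pure_tensor R M N m n)) =
      tensor_map R M N M'' N'' (\<lambda>x. f' (f x)) (\<lambda>x. g' (g x)) (pure_tensor R M N m n)"
    by (simp add: tensor_map_pure[OF M N M' N' f g] tensor_map_pure[OF M' N' M'' N'' f' g']
        tensor_map_pure[OF M N M'' N'' fg] linear_map_closed[OF f] linear_map_closed[OF g])
qed

lemma tensor_swap_map:
  assumes M: "module R M" and N: "module R N" and M': "module R M'" and N': "module R N'"
    and f: "f \<in> linear_map R M M'" and g: "g \<in> linear_map R N N'"
    and t: "t \<in> carrier (tensor R M N)"
  shows "tensor_map R N M N' M' g f (tensor_swap R M N t) = tensor_swap R M' N' (tensor_map R M N M' N' f g t)"
proof (rule tensor_ext[OF M N _ _ module_tensor[OF N' M'] _ t])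
  show "(\<lambda>t. tensor_map R N M N' M' g f (tensor_swap R M N t)) \<in> linear_map R (tensor R M N) (tensor R N' M')"
    by (rule linear_map_comp[OF tensor_map_linear[OF N M N' M' g f] tensor_swap_linear[OF M N]])
  show "(\<lambda>t. tensor_swap R M' N' (tensor_map R M N M' N' f g t)) \<in> linear_map R (tensor R M N) (tensor R N' M')"
    by (rule linear_map_comp[OF tensor_swap_linear[OF M' N'] tensor_map_linear[OF M N M' N' f g]])
  fix m n assume "m \<in> carrier M" "n \<in> carrier N"
  then show "tensor_map R N M N' M' g f (tensor_swap R M N (pure_tensor R M N m n)) =
      tensor_swap R M' N' (tensor_map R M N M' N' f g (pure_tensor R M N m n))"
    by (simp add: tensor_map_pure[OF M N M' N' f g] tensor_map_pure[OF N M N' M' g f]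
        tensor_swap_pure[OF M N] tensor_swap_pure[OF M' N'] linear_map_closed[OF f] linear_map_closed[OF g])
qed

lemma tensor_map_diff_left:
  assumes M: "module R M" and N: "module R N" and M': "module R M'" and N': "module R N'"
    and f: "f \<in> linear_map R M M'" and f': "f' \<in> linear_map R M M'" and g: "g \<in> linear_map R N N'"
    and t: "t \<in> carrier (tensor R M N)"
  shows "tensor_map R M N M' N' (\<lambda>x. f x \<ominus>\<^bsub>M'\<^esub> f' x) g t =
    tensor_map R M N M' N' f g t \<ominus>\<^bsub>tensor R M' N'\<^esub> tensor_map R M N M' N' f' g t"
proof -
  note T = module_tensor[OF M' N']
  note d = linear_map_diff[OF f f' M']
  show ?thesis
    by (rule tensor_ext[OF M N tensor_map_linear[OF M N M' N' d g]
          linear_map_diff[OF tensor_map_linear[OF M N M' N' f g] tensor_map_linear[OF M N M' N' f' g] T] T _ t])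
       (simp add: tensor_map_pure[OF M N M' N' f g] tensor_map_pure[OF M N M' N' f' g]
         tensor_map_pure[OF M N M' N' d g] linear_map_closed[OF f] linear_map_closed[OF f'] linear_map_closed[OF g]
         linear_map_minus[OF bilinear_left[OF pure_tensor_bilinear[OF M' N']] M' T])
qed

lemma tensor_map_diff_right:
  assumes M: "module R M" and N: "module R N" and M': "module R M'" and N': "module R N'"
    and f: "f \<in> linear_map R M M'" and g: "g \<in> linear_map R N N'" and g': "g' \<in> linear_map R N N'"
    and t: "t \<in> carrier (tensor R M N)"
  shows "tensor_map R M N M' N' f (\<lambda>x. g x \<ominus>\<^bsub>N'\<^esub> g' x) t =
    tensor_map R M N M' N' f g t \<ominus>\<^bsub>tensor R M' N'\<^esub> tensor_map R M N M' N' f g' t"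
proof -
  note T = module_tensor[OF M' N']
  note d = linear_map_diff[OF g g' N']
  show ?thesis
    by (rule tensor_ext[OF M N tensor_map_linear[OF M N M' N' f d]
          linear_map_diff[OF tensor_map_linear[OF M N M' N' f g] tensor_map_linear[OF M N M' N' f g'] T] T _ t])
       (simp add: tensor_map_pure[OF M N M' N' f g] tensor_map_pure[OF M N M' N' f g']
         tensor_map_pure[OF M N M' N' f d] linear_map_closed[OF f] linear_map_closed[OF g'] linear_map_closed[OF g]
         linear_map_minus[OF bilinear_right[OF pure_tensor_bilinear[OF M' N']] N' T])
qed

section \<open>Sweedler calculus in a Hopf algebra\<close>

lemma bilinear_linear_left:
  "bilinear R M N P \<beta> \<Longrightarrow> f \<in> linear_map R Z M \<Longrightarrow> n \<in> carrier N \<Longrightarrow>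
    (\<lambda>z. \<beta> (f z) n) \<in> linear_map R Z P"
  by (rule linear_map_comp[OF bilinear_left])

lemma bilinear_linear_right:
  "bilinear R M N P \<beta> \<Longrightarrow> f \<in> linear_map R Z N \<Longrightarrow> m \<in> carrier M \<Longrightarrow>
    (\<lambda>z. \<beta> m (f z)) \<in> linear_map R Z P"
  by (rule linear_map_comp[OF bilinear_right])

context hopf_algebra
begin

abbreviation mul (infixl "\<cdot>" 70) where "x \<cdot> y \<equiv> x \<otimes>\<^bsub>H\<^esub> y"

text \<open>
  \<open>sweedler P \<beta> h\<close> is \<open>\<beta> h\<^sub>(\<^sub>1\<^sub>) h\<^sub>(\<^sub>2\<^sub>)\<close>, and nesting gives \<open>h\<^sub>(\<^sub>1\<^sub>), h\<^sub>(\<^sub>2\<^sub>), h\<^sub>(\<^sub>3\<^sub>)\<close>. The lemmas named after it are the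
  axioms of a Hopf algebra in the form in which Sweedler notation uses them.
\<close>

abbreviation sweedler where "sweedler P \<beta> h \<equiv> tensor_lift R H H P \<beta> (\<Delta> h)"

lemma H_module: "module R H" by unfold_locales

lemma cring_R: "cring R" by unfold_locales

lemma mul_closed: "x \<in> carrier H \<Longrightarrow> y \<in> carrier H \<Longrightarrow> x \<cdot> y \<in> carrier H" by simp

lemma one_H_closed: "\<one>\<^bsub>H\<^esub> \<in> carrier H" by simp

lemma mul_assoc:
  "\<lbrakk>x \<in> carrier H; y \<in> carrier H; z \<in> carrier H\<rbrakk> \<Longrightarrow> x \<cdot> y \<cdot> z = x \<cdot> (y \<cdot> z)"
  by (rule m_assoc)

lemma mul_bilinear: "bilinear R H H H (\<lambda>x y. x \<cdot> y)"
  by (intro bilinearI linear_mapI)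
     (simp_all add: l_distr r_distr smult_mult_left smult_mult_right)

lemmas mul_linear_left = bilinear_linear_left[OF mul_bilinear]
lemmas mul_linear_right = bilinear_linear_right[OF mul_bilinear]

lemma comult_closed: "h \<in> carrier H \<Longrightarrow> \<Delta> h \<in> carrier (tensor R H H)"
  by (rule linear_map_closed[OF comult_linear])

lemma comult_linear_comp: "f \<in> linear_map R Z H \<Longrightarrow> (\<lambda>z. \<Delta> (f z)) \<in> linear_map R Z (tensor R H H)"
  by (rule linear_map_comp[OF comult_linear])

lemma antipode_closed: "h \<in> carrier H \<Longrightarrow> S h \<in> carrier H"
  by (rule linear_map_closed[OF antipode_linear])

lemma antipode_linear_comp: "f \<in> linear_map R Z H \<Longrightarrow> (\<lambda>z. S (f z)) \<in> linear_map R Z H"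
  by (rule linear_map_comp[OF antipode_linear])

lemma counit_closed: "h \<in> carrier H \<Longrightarrow> \<epsilon> h \<in> carrier R"
  using linear_map_closed[OF counit_linear] by (simp add: regular_module_def)

lemma counit_smult_linear:
  "f \<in> linear_map R Z H \<Longrightarrow> module R P \<Longrightarrow> p \<in> carrier P \<Longrightarrow>
    (\<lambda>z. \<epsilon> (f z) \<odot>\<^bsub>P\<^esub> p) \<in> linear_map R Z P"
  by (rule linear_map_smult_const[OF linear_map_comp[OF counit_linear]])

lemma smult_in_module: "module R P \<Longrightarrow> a \<in> carrier R \<Longrightarrow> p \<in> carrier P \<Longrightarrow> a \<odot>\<^bsub>P\<^esub> p \<in> carrier P"
  by (rule module.smult_closed)

text \<open>
  Rules that decide linearity of a map by the position of its variable in the term; in each case at most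
  one of them applies.
\<close>

lemmas lin = linear_map_id pure_linear_left pure_linear_right tensor_lift_linear_arg
  tensor_lift_linear_param mul_linear_left mul_linear_right comult_linear_comp antipode_linear_comp
  counit_smult_linear linear_map_const_smult linear_map_diff bilinearI

lemmas closed = pure_tensor_closed tensor_lift_closed mul_closed comult_closed antipode_closed
  counit_closed smult_in_module one_H_closed

lemmas mods = H_module module_tensor

text \<open>
  The trilinear map induces a linear map on \<open>(H \<otimes> H) \<otimes> H\<close>, which is applied to both sides of the
  coassociativity law.
\<close>

lemma coassoc_sweedler:
  assumes P: "module R P"
    and 1: "\<And>v w. \<lbrakk>v \<in> carrier H; w \<in> carrier H\<rbrakk> \<Longrightarrow> (\<lambda>u. \<beta> u v w) \<in> linear_map R H P"
    and 2: "\<And>u w. \<lbrakk>u \<in> carrier H; w \<in> carrier H\<rbrakk> \<Longrightarrow> (\<lambda>v. \<beta> u v w) \<in> linear_map R H P"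
    and 3: "\<And>u v. \<lbrakk>u \<in> carrier H; v \<in> carrier H\<rbrakk> \<Longrightarrow> (\<lambda>w. \<beta> u v w) \<in> linear_map R H P"
    and h: "h \<in> carrier H"
  shows "sweedler P (\<lambda>x y. sweedler P (\<lambda>u v. \<beta> u v y) x) h = sweedler P (\<lambda>x y. sweedler P (\<lambda>u v. \<beta> x u v) y) h"
proof -
  let ?HH = "tensor R H H"
  define \<Phi> where "\<Phi> = tensor_lift R ?HH H P (\<lambda>t y. tensor_lift R H H P (\<lambda>u v. \<beta> u v y) t)"
  have b: "bilinear R ?HH H P (\<lambda>t y. tensor_lift R H H P (\<lambda>u v. \<beta> u v y) t)"
    by (auto intro!: lin mods P 1 2 3)
  have \<Phi>: "\<Phi> \<in> linear_map R (tensor R ?HH H) P"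
    unfolding \<Phi>_def by (intro tensor_lift_linear b mods P)
  have \<Phi>_pure: "\<Phi> (pure_tensor R ?HH H t y) = tensor_lift R H H P (\<lambda>u v. \<beta> u v y) t"
    if "t \<in> carrier ?HH" "y \<in> carrier H" for t y
    unfolding \<Phi>_def using that by (subst tensor_lift_pure) (auto intro!: b mods P)
  have assoc: "\<Phi> (tensor_assoc R H H H (pure_tensor R H ?HH x t)) = tensor_lift R H H P (\<lambda>u v. \<beta> x u v) t"
    if x: "x \<in> carrier H" and t: "t \<in> carrier ?HH" for x t
  proof (rule tensor_ext[OF H_module H_module _ _ P _ t])
    show "(\<lambda>t. \<Phi> (tensor_assoc R H H H (pure_tensor R H ?HH x t))) \<in> linear_map R ?HH P"
      by (intro linear_map_comp[OF \<Phi>] linear_map_comp[OF tensor_assoc_linear] lin mods x)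
    show "tensor_lift R H H P (\<lambda>u v. \<beta> x u v) \<in> linear_map R ?HH P"
      by (intro tensor_lift_linear mods P lin 2 3 x)
    fix m n assume "m \<in> carrier H" "n \<in> carrier H"
    then show "\<Phi> (tensor_assoc R H H H (pure_tensor R H ?HH x (pure_tensor R H H m n))) =
        tensor_lift R H H P (\<beta> x) (pure_tensor R H H m n)"
      using x by (simp add: tensor_assoc_pure mods \<Phi>_pure closed tensor_lift_pure P lin 1 2 3)
  qed
  have "\<Phi> (tensor_map R H H ?HH H \<Delta> id (\<Delta> h)) = sweedler P (\<lambda>x y. \<Phi> (pure_tensor R ?HH H (\<Delta> x) (id y))) h"
    unfolding tensor_map_def using h
    by (intro linear_map_tensor_lift \<Phi> P mods closed) (auto intro!: lin mods closed)
  also have "\<dots> = sweedler P (\<lambda>x y. sweedler P (\<lambda>u v. \<beta> u v y) x) h"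
    using h by (intro tensor_lift_cong mods closed) (auto simp: \<Phi>_pure closed)
  finally have l: "\<Phi> (tensor_map R H H ?HH H \<Delta> id (\<Delta> h)) = \<dots>" .
  have "\<Phi> (tensor_assoc R H H H (tensor_map R H H H ?HH id \<Delta> (\<Delta> h))) =
      sweedler P (\<lambda>x y. \<Phi> (tensor_assoc R H H H (pure_tensor R H ?HH (id x) (\<Delta> y)))) h"
    unfolding tensor_map_def using h
    by (intro linear_map_tensor_lift[OF _ _ _ _ linear_map_comp[OF \<Phi> tensor_assoc_linear]] P mods closed)
       (auto intro!: lin mods closed)
  also have "\<dots> = sweedler P (\<lambda>x y. sweedler P (\<lambda>u v. \<beta> x u v) y) h"
    using h by (intro tensor_lift_cong mods closed) (auto simp: assoc closed)
  finally show ?thesis using l coassoc[OF h] by simp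
qed

lemma counit_left_sweedler:
  assumes P: "module R P" and f: "f \<in> linear_map R H P" and h: "h \<in> carrier H"
  shows "sweedler P (\<lambda>x y. \<epsilon> x \<odot>\<^bsub>P\<^esub> f y) h = f h"
proof -
  have "f (sweedler H (\<lambda>x y. \<epsilon> x \<odot>\<^bsub>H\<^esub> y) h) = sweedler P (\<lambda>x y. f (\<epsilon> x \<odot>\<^bsub>H\<^esub> y)) h"
    using h by (intro linear_map_tensor_lift mods P f closed) (auto intro!: lin mods closed)
  also have "\<dots> = sweedler P (\<lambda>x y. \<epsilon> x \<odot>\<^bsub>P\<^esub> f y) h"
    using h by (intro tensor_lift_cong mods closed) (simp_all add: linear_map_smult[OF f] closed)
  finally show ?thesis using counit_left[OF h] by simp
qed

lemma antipode_left_sweedler: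
  assumes P: "module R P" and f: "f \<in> linear_map R H P" and h: "h \<in> carrier H"
  shows "sweedler P (\<lambda>x y. f (S x \<cdot> y)) h = \<epsilon> h \<odot>\<^bsub>P\<^esub> f \<one>\<^bsub>H\<^esub>"
proof -
  have "f (sweedler H (\<lambda>x y. S x \<cdot> y) h) = sweedler P (\<lambda>x y. f (S x \<cdot> y)) h"
    using h by (intro linear_map_tensor_lift mods P f closed) (auto intro!: lin mods closed)
  then show ?thesis using antipode_left[OF h] by (simp add: linear_map_smult[OF f] closed h)
qed

lemma antipode_right_sweedler:
  assumes P: "module R P" and f: "f \<in> linear_map R H P" and h: "h \<in> carrier H"
  shows "sweedler P (\<lambda>x y. f (x \<cdot> S y)) h = \<epsilon> h \<odot>\<^bsub>P\<^esub> f \<one>\<^bsub>H\<^esub>"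
proof -
  have "f (sweedler H (\<lambda>x y. x \<cdot> S y) h) = sweedler P (\<lambda>x y. f (x \<cdot> S y)) h"
    using h by (intro linear_map_tensor_lift mods P f closed) (auto intro!: lin mods closed)
  then show ?thesis using antipode_right[OF h] by (simp add: linear_map_smult[OF f] closed h)
qed

lemma one_sweedler:
  assumes "module R P" "bilinear R H H P \<beta>"
  shows "sweedler P \<beta> \<one>\<^bsub>H\<^esub> = \<beta> \<one>\<^bsub>H\<^esub> \<one>\<^bsub>H\<^esub>"
  by (simp add: comult_one tensor_lift_pure mods assms)

lemma mult_sweedler:
  assumes P: "module R P" and \<beta>: "bilinear R H H P \<beta>" and x: "x \<in> carrier H" and y: "y \<in> carrier H"
  shows "sweedler P \<beta> (x \<cdot> y) = sweedler P (\<lambda>a b. sweedler P (\<lambda>c d. \<beta> (a \<cdot> c) (b \<cdot> d)) y) x"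
proof -
  note b = bilinear_linear_left[OF \<beta>] bilinear_linear_right[OF \<beta>]
  have "sweedler P \<beta> (x \<cdot> y) =
      sweedler P (\<lambda>a b. tensor_lift R H H P \<beta> (tensor_map R H H H H (\<lambda>c. a \<cdot> c) (\<lambda>d. b \<cdot> d) (\<Delta> y))) x"
    unfolding comult_mult[OF x y] tensor_mult_def tensor_map_def
    by (intro linear_map_tensor_lift tensor_lift_linear mods P closed x \<beta>)
       (auto intro!: lin mods closed y)
  also have "\<dots> = sweedler P (\<lambda>a b. sweedler P (\<lambda>c d. tensor_lift R H H P \<beta> (pure_tensor R H H (a \<cdot> c) (b \<cdot> d))) y) x"
    unfolding tensor_map_def
    by (intro tensor_lift_cong mods closed x)
       (auto intro!: linear_map_tensor_lift tensor_lift_linear lin mods closed y P \<beta>)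
  also have "\<dots> = sweedler P (\<lambda>a b. sweedler P (\<lambda>c d. \<beta> (a \<cdot> c) (b \<cdot> d)) y) x"
    by (intro tensor_lift_cong mods closed x y)
       (simp_all add: tensor_lift_pure mods P \<beta> closed)
  finally show ?thesis .
qed

end

section \<open>Translating along a right action\<close>

context hopf_algebra
begin

text \<open>
  The map \<open>v \<otimes> h \<mapsto> v h\<^sub>(\<^sub>1\<^sub>) \<otimes> h\<^sub>(\<^sub>2\<^sub>)\<close> of \<open>V \<otimes> H\<close>. For \<open>V = H\<close> it is \<open>\<alpha>\<close>, and for \<open>V = H \<otimes> H/J\<close> it is the map \<open>\<gamma>\<close> that
  relates the cotensor product to the coinvariants. It is formed for any bilinear \<open>act\<close>, so that the
  inverse is the same construction for \<open>v \<mapsto> v S(h)\<close>, which is not an action.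
\<close>

definition twist where
  "twist V act = tensor_lift R V H (tensor R V H)
    (\<lambda>v h. sweedler (tensor R V H) (\<lambda>a q. pure_tensor R V H (act v a) q) h)"

context
  fixes V :: "('r, 'v, 'w) module_scheme"
  assumes V: "module R V"
begin

lemma twist_bilinear:
  assumes "bilinear R V H V act"
  shows "bilinear R V H (tensor R V H) (\<lambda>v h. sweedler (tensor R V H) (\<lambda>a q. pure_tensor R V H (act v a) q) h)"
  by (auto intro!: lin mods closed V bilinear_linear_left[OF assms] bilinear_linear_right[OF assms]
      bilinear_closed[OF assms])

lemma twist_linear:
  assumes "bilinear R V H V act"
  shows "twist V act \<in> linear_map R (tensor R V H) (tensor R V H)"
  unfolding twist_def by (intro tensor_lift_linear twist_bilinear assms V mods)

lemma twist_pure: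
  assumes "bilinear R V H V act" "v \<in> carrier V" "h \<in> carrier H"
  shows "twist V act (pure_tensor R V H v h) =
    sweedler (tensor R V H) (\<lambda>a q. pure_tensor R V H (act v a) q) h"
  unfolding twist_def by (intro tensor_lift_pure twist_bilinear assms V mods)

lemma twist_twist_pure:
  assumes act: "bilinear R V H V act" and act': "bilinear R V H V act'"
    and v: "v \<in> carrier V" and h: "h \<in> carrier H"
  shows "twist V act' (twist V act (pure_tensor R V H v h)) =
    sweedler (tensor R V H) (\<lambda>x c. sweedler (tensor R V H) (\<lambda>a b. pure_tensor R V H (act' (act v a) b) c) x) h"
proof -
  let ?T = "tensor R V H"
  note b = bilinear_linear_left[OF act] bilinear_linear_right[OF act] bilinear_closed[OF act]
    bilinear_linear_left[OF act'] bilinear_linear_right[OF act'] bilinear_closed[OF act']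
  have "twist V act' (twist V act (pure_tensor R V H v h)) =
      sweedler ?T (\<lambda>a q. twist V act' (pure_tensor R V H (act v a) q)) h"
    unfolding twist_pure[OF act v h]
    by (rule linear_map_tensor_lift[OF _ _ _ _ twist_linear[OF act']])
       (auto intro!: lin mods closed V b v h)
  also have "\<dots> = sweedler ?T (\<lambda>a q. sweedler ?T (\<lambda>b c. pure_tensor R V H (act' (act v a) b) c) q) h"
    by (intro tensor_lift_cong mods closed h) (simp add: twist_pure[OF act'] b v)
  also have "\<dots> = sweedler ?T (\<lambda>x c. sweedler ?T (\<lambda>a b. pure_tensor R V H (act' (act v a) b) c) x) h"
    by (rule coassoc_sweedler[symmetric]) (auto intro!: lin mods V b v h)
  finally show ?thesis .
qed

end

definition right_action where
  "right_action V act \<longleftrightarrow> module R V \<and> bilinear R V H V act \<and> (\<forall>v\<in>carrier V. act v \<one>\<^bsub>H\<^esub> = v) \<and>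
    (\<forall>v\<in>carrier V. \<forall>h\<in>carrier H. \<forall>k\<in>carrier H. act (act v h) k = act v (h \<cdot> k))"

lemma antipode_action_bilinear:
  assumes act: "bilinear R V H V act"
  shows "bilinear R V H V (\<lambda>v h. act v (S h))"
  by (auto intro!: lin bilinear_linear_left[OF act] bilinear_linear_right[OF act] closed)

text \<open>
  The composite sends \<open>v \<otimes> h\<close> to \<open>v h\<^sub>(\<^sub>1\<^sub>) S(h\<^sub>(\<^sub>2\<^sub>)) \<otimes> h\<^sub>(\<^sub>3\<^sub>) = v \<epsilon>(h\<^sub>(\<^sub>1\<^sub>)) \<otimes> h\<^sub>(\<^sub>2\<^sub>) = v \<otimes> h\<close>.
\<close>

lemma untwist_twist:
  assumes "right_action V act" and t: "t \<in> carrier (tensor R V H)"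
  shows "twist V (\<lambda>v h. act v (S h)) (twist V act t) = t"
proof -
  from assms(1) have V: "module R V" and act: "bilinear R V H V act"
    and one: "\<And>v. v \<in> carrier V \<Longrightarrow> act v \<one>\<^bsub>H\<^esub> = v"
    and assoc: "\<And>v h k. v \<in> carrier V \<Longrightarrow> h \<in> carrier H \<Longrightarrow> k \<in> carrier H \<Longrightarrow>
      act (act v h) k = act v (h \<cdot> k)"
    by (auto simp: right_action_def)
  note act' = antipode_action_bilinear[OF act]
  note b = bilinear_linear_left[OF act] bilinear_linear_right[OF act] bilinear_closed[OF act]
  let ?T = "tensor R V H"
  show ?thesis
  proof (rule tensor_ext[OF V H_module linear_map_comp[OF twist_linear[OF V act'] twist_linear[OF V act]]
        linear_map_id module_tensor[OF V H_module] _ t])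
    fix v h assume v: "v \<in> carrier V" and h: "h \<in> carrier H"
    have "twist V (\<lambda>v h. act v (S h)) (twist V act (pure_tensor R V H v h)) =
      sweedler ?T (\<lambda>x c. sweedler ?T (\<lambda>a b. pure_tensor R V H (act v (a \<cdot> S b)) c) x) h"
      unfolding twist_twist_pure[OF V act act' v h]
      by (intro tensor_lift_cong mods closed h) (simp_all add: assoc v closed)
    also have "\<dots> = sweedler ?T (\<lambda>x c. \<epsilon> x \<odot>\<^bsub>?T\<^esub> pure_tensor R V H (act v \<one>\<^bsub>H\<^esub>) c) h"
      by (intro tensor_lift_cong mods closed h antipode_right_sweedler V) (auto intro!: lin b v mods V)
    also have "\<dots> = sweedler ?T (\<lambda>x c. \<epsilon> x \<odot>\<^bsub>?T\<^esub> pure_tensor R V H v c) h"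
      by (simp add: one v)
    also have "\<dots> = pure_tensor R V H v h"
      by (intro counit_left_sweedler mods V h) (auto intro!: lin mods V v)
    finally show "twist V (\<lambda>v h. act v (S h)) (twist V act (pure_tensor R V H v h)) = pure_tensor R V H v h" .
  qed
qed

lemma twist_untwist:
  assumes "right_action V act" and t: "t \<in> carrier (tensor R V H)"
  shows "twist V act (twist V (\<lambda>v h. act v (S h)) t) = t"
proof -
  from assms(1) have V: "module R V" and act: "bilinear R V H V act"
    and one: "\<And>v. v \<in> carrier V \<Longrightarrow> act v \<one>\<^bsub>H\<^esub> = v"
    and assoc: "\<And>v h k. v \<in> carrier V \<Longrightarrow> h \<in> carrier H \<Longrightarrow> k \<in> carrier H \<Longrightarrow>
      act (act v h) k = act v (h \<cdot> k)"
    by (auto simp: right_action_def)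
  note act' = antipode_action_bilinear[OF act]
  note b = bilinear_linear_left[OF act] bilinear_linear_right[OF act] bilinear_closed[OF act]
  let ?T = "tensor R V H"
  show ?thesis
  proof (rule tensor_ext[OF V H_module linear_map_comp[OF twist_linear[OF V act] twist_linear[OF V act']]
        linear_map_id module_tensor[OF V H_module] _ t])
    fix v h assume v: "v \<in> carrier V" and h: "h \<in> carrier H"
    have "twist V act (twist V (\<lambda>v h. act v (S h)) (pure_tensor R V H v h)) =
      sweedler ?T (\<lambda>x c. sweedler ?T (\<lambda>a b. pure_tensor R V H (act v (S a \<cdot> b)) c) x) h"
      unfolding twist_twist_pure[OF V act' act v h]
      by (intro tensor_lift_cong mods closed h) (simp_all add: assoc v closed)
    also have "\<dots> = sweedler ?T (\<lambda>x c. \<epsilon> x \<odot>\<^bsub>?T\<^esub> pure_tensor R V H (act v \<one>\<^bsub>H\<^esub>) c) h"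
      by (intro tensor_lift_cong mods closed h antipode_left_sweedler V) (auto intro!: lin b v mods V)
    also have "\<dots> = sweedler ?T (\<lambda>x c. \<epsilon> x \<odot>\<^bsub>?T\<^esub> pure_tensor R V H v c) h"
      by (simp add: one v)
    also have "\<dots> = pure_tensor R V H v h"
      by (intro counit_left_sweedler mods V h) (auto intro!: lin mods V v)
    finally show "twist V act (twist V (\<lambda>v h. act v (S h)) (pure_tensor R V H v h)) = pure_tensor R V H v h" .
  qed
qed

lemma twist_bij:
  assumes "right_action V act"
  shows "bij_betw (twist V act) (carrier (tensor R V H)) (carrier (tensor R V H))"
proof (rule bij_betw_byWitness[where f' = "twist V (\<lambda>v h. act v (S h))"])
  have V: "module R V" and act: "bilinear R V H V act"
    using assms by (auto simp: right_action_def)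
  show "twist V act ` carrier (tensor R V H) \<subseteq> carrier (tensor R V H)"
    using linear_map_closed[OF twist_linear[OF V act]] by blast
  show "twist V (\<lambda>v h. act v (S h)) ` carrier (tensor R V H) \<subseteq> carrier (tensor R V H)"
    using linear_map_closed[OF twist_linear[OF V antipode_action_bilinear[OF act]]] by blast
qed (simp_all add: untwist_twist twist_untwist assms)

lemma regular_action: "right_action H (\<lambda>x y. x \<cdot> y)"
  unfolding right_action_def by (simp add: H_module mul_bilinear mul_assoc)

end

section \<open>The quotient by a right ideal and its coinvariants\<close>

locale hopf_quotient = hopf_algebra R H \<Delta> \<epsilon> S
  for R :: "('r, 'a) ring_scheme" (structure) and H :: "('r, 'h, 'b) module_scheme" (structure)
    and \<Delta> \<epsilon> S +
  fixes J
  assumes J_submodule: "submodule J R H"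
    and J_right: "\<lbrakk>x \<in> J; h \<in> carrier H\<rbrakk> \<Longrightarrow> x \<cdot> h \<in> J"
begin

abbreviation Q where "Q \<equiv> quot_module H J"
abbreviation \<pi> where "\<pi> \<equiv> quot_proj H Q"
abbreviation HQ where "HQ \<equiv> tensor R H Q"

lemma quotient_J: "quotient R H J"
  by (intro quotient.intro quotient_axioms.intro H_module J_submodule)

lemma proj_eq: "\<pi> = (\<lambda>x. J +>\<^bsub>H\<^esub> x)"
  by (rule ext) (simp add: quot_proj_def quot_module_def)

lemma Q_module: "module R Q"
  by (rule quotient.module_quot[OF quotient_J])

lemma proj_linear: "\<pi> \<in> linear_map R H Q"
  unfolding proj_eq by (rule quotient.coset_linear[OF quotient_J])

lemma proj_linear_comp: "f \<in> linear_map R Z H \<Longrightarrow> (\<lambda>z. \<pi> (f z)) \<in> linear_map R Z Q"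
  by (rule linear_map_comp[OF proj_linear])

lemma proj_closed: "h \<in> carrier H \<Longrightarrow> \<pi> h \<in> carrier Q"
  by (rule linear_map_closed[OF proj_linear])

lemma proj_surj: "\<pi> ` carrier H = carrier Q"
  unfolding proj_eq by (rule quotient.quot_carrier[OF quotient_J, symmetric])

lemma proj_zero_iff: "h \<in> carrier H \<Longrightarrow> \<pi> h = \<zero>\<^bsub>Q\<^esub> \<longleftrightarrow> h \<in> J"
  unfolding proj_eq by (rule quotient.coset_eq_zero_iff[OF quotient_J])

lemmas Qmods = mods Q_module
lemmas Qclosed = closed proj_closed
lemmas Qlin = lin proj_linear_comp

text \<open>
  The action of \<open>H\<close> on the right of \<open>H/J\<close>, which exists because \<open>J\<close> is a right ideal.
\<close>

definition ract where "ract d w = quot_lift (\<lambda>z. \<pi> (z \<cdot> w)) d"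

lemma ract_proj:
  assumes "z \<in> carrier H" "w \<in> carrier H"
  shows "ract (\<pi> z) w = \<pi> (z \<cdot> w)"
  unfolding ract_def proj_eq
proof (rule quotient.quot_lift_coset[OF quotient_J _ Q_module _ assms(1)])
  show "(\<lambda>z. J +>\<^bsub>H\<^esub> (z \<cdot> w)) \<in> linear_map R H Q"
    using assms by (intro Qlin[unfolded proj_eq])
  show "\<forall>n\<in>J. J +>\<^bsub>H\<^esub> (n \<cdot> w) = \<zero>\<^bsub>Q\<^esub>"
    using proj_zero_iff J_right assms(2) submodule.axioms(1)[OF J_submodule, THEN subgroup.subset]
    by (auto simp: proj_eq)
qed

lemma ract_bilinear: "bilinear R Q H Q ract"
proof (rule bilinearI)
  fix w assume w: "w \<in> carrier H"
  have "\<forall>n\<in>J. \<pi> (n \<cdot> w) = \<zero>\<^bsub>Q\<^esub>"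
    using proj_zero_iff J_right w submodule.axioms(1)[OF J_submodule, THEN subgroup.subset]
    by auto
  then show "(\<lambda>d. ract d w) \<in> linear_map R Q Q"
    unfolding ract_def using w
    by (intro quotient.quot_lift_linear[OF quotient_J] Q_module) (auto intro!: Qlin)
next
  fix d assume "d \<in> carrier Q"
  then obtain z where z: "z \<in> carrier H" "d = \<pi> z" using proj_surj by blast
  have "(\<lambda>w. \<pi> (z \<cdot> w)) \<in> linear_map R H Q" using z by (intro Qlin)
  then show "(\<lambda>w. ract d w) \<in> linear_map R H Q"
    by (rule linear_map_cong[OF _ H_module]) (simp add: z ract_proj)
qed

text \<open>
  The diagonal action on \<open>H \<otimes> H/J\<close>, \<open>(y \<otimes> d) h = y h\<^sub>(\<^sub>1\<^sub>) \<otimes> d h\<^sub>(\<^sub>2\<^sub>)\<close>.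
\<close>

definition act where
  "act v h = tensor_lift R H Q HQ (\<lambda>y d. sweedler HQ (\<lambda>u w. pure_tensor R H Q (y \<cdot> u) (ract d w)) h) v"

lemmas ract_lin = bilinear_linear_left[OF ract_bilinear] bilinear_linear_right[OF ract_bilinear]
lemmas ract_closed = bilinear_closed[OF ract_bilinear]

lemma act_bilinear: "bilinear R HQ H HQ act"
  unfolding act_def
  by (auto intro!: Qlin Qmods Qclosed ract_lin ract_closed)

lemmas act_lin = bilinear_linear_left[OF act_bilinear] bilinear_linear_right[OF act_bilinear]

lemma act_pure:
  assumes "y \<in> carrier H" "z \<in> carrier H" "h \<in> carrier H"
  shows "act (pure_tensor R H Q y (\<pi> z)) h = sweedler HQ (\<lambda>u w. pure_tensor R H Q (y \<cdot> u) (\<pi> (z \<cdot> w))) h"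
proof -
  have "act (pure_tensor R H Q y (\<pi> z)) h = sweedler HQ (\<lambda>u w. pure_tensor R H Q (y \<cdot> u) (ract (\<pi> z) w)) h"
    unfolding act_def
    by (rule tensor_lift_pure) (auto intro!: Qlin Qmods Qclosed ract_lin ract_closed assms)
  also have "\<dots> = sweedler HQ (\<lambda>u w. pure_tensor R H Q (y \<cdot> u) (\<pi> (z \<cdot> w))) h"
    by (intro tensor_lift_cong mods closed assms) (simp add: ract_proj assms)
  finally show ?thesis .
qed

lemma HQ_ext:
  assumes "f \<in> linear_map R HQ P" "g \<in> linear_map R HQ P" "module R P"
    and "\<And>y z. \<lbrakk>y \<in> carrier H; z \<in> carrier H\<rbrakk> \<Longrightarrow>
      f (pure_tensor R H Q y (\<pi> z)) = g (pure_tensor R H Q y (\<pi> z))"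
    and "v \<in> carrier HQ"
  shows "f v = g v"
proof (rule tensor_ext[OF H_module Q_module assms(1,2,3) _ assms(5)])
  fix m n assume m: "m \<in> carrier H" and "n \<in> carrier Q"
  then obtain z where z: "z \<in> carrier H" "n = \<pi> z" using proj_surj by blast
  show "f (pure_tensor R H Q m n) = g (pure_tensor R H Q m n)"
    unfolding z(2) by (rule assms(4)[OF m z(1)])
qed

lemma act_right_action: "right_action HQ act"
  unfolding right_action_def
proof (intro conjI ballI)
  show "module R HQ" by (intro Qmods)
  show "bilinear R HQ H HQ act" by (rule act_bilinear)
  fix v assume v: "v \<in> carrier HQ"
  show "act v \<one>\<^bsub>H\<^esub> = v"
  proof (rule HQ_ext[OF _ linear_map_id _ _ v])
    fix y z assume y: "y \<in> carrier H" and z: "z \<in> carrier H"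
    have "sweedler HQ (\<lambda>u w. pure_tensor R H Q (y \<cdot> u) (\<pi> (z \<cdot> w))) \<one>\<^bsub>H\<^esub> =
        pure_tensor R H Q (y \<cdot> \<one>\<^bsub>H\<^esub>) (\<pi> (z \<cdot> \<one>\<^bsub>H\<^esub>))"
      by (rule one_sweedler) (auto intro!: Qmods Qlin Qclosed y z)
    then show "act (pure_tensor R H Q y (\<pi> z)) \<one>\<^bsub>H\<^esub> = pure_tensor R H Q y (\<pi> z)"
      by (simp add: act_pure y z)
  qed (auto intro!: Qmods act_lin Qlin Qclosed)
  fix h k assume h: "h \<in> carrier H" and k: "k \<in> carrier H"
  show "act (act v h) k = act v (h \<cdot> k)"
  proof (rule HQ_ext[OF _ _ _ _ v])
    fix y z assume y: "y \<in> carrier H" and z: "z \<in> carrier H"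
    have "act (act (pure_tensor R H Q y (\<pi> z)) h) k =
        sweedler HQ (\<lambda>u w. act (pure_tensor R H Q (y \<cdot> u) (\<pi> (z \<cdot> w))) k) h"
      unfolding act_pure[OF y z h]
      by (rule linear_map_tensor_lift[OF _ _ _ _ bilinear_left[OF act_bilinear k]])
         (auto intro!: Qmods Qlin Qclosed y z h)
    also have "\<dots> = sweedler HQ (\<lambda>u w. sweedler HQ (\<lambda>c d. pure_tensor R H Q (y \<cdot> (u \<cdot> c)) (\<pi> (z \<cdot> (w \<cdot> d)))) k) h"
    proof (intro tensor_lift_cong Qmods Qclosed h)
      fix u w assume u: "u \<in> carrier H" and w: "w \<in> carrier H"
      show "act (pure_tensor R H Q (y \<cdot> u) (\<pi> (z \<cdot> w))) k =
          sweedler HQ (\<lambda>c d. pure_tensor R H Q (y \<cdot> (u \<cdot> c)) (\<pi> (z \<cdot> (w \<cdot> d)))) k"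
        unfolding act_pure[OF mul_closed[OF y u] mul_closed[OF z w] k]
        by (intro tensor_lift_cong Qmods Qclosed k) (simp add: mul_assoc y z u w)
    qed
    also have "\<dots> = act (pure_tensor R H Q y (\<pi> z)) (h \<cdot> k)"
      unfolding act_pure[OF y z mul_closed[OF h k]]
      by (rule mult_sweedler[symmetric]) (auto intro!: Qmods Qlin Qclosed y z h k)
    finally show "act (act (pure_tensor R H Q y (\<pi> z)) h) k = act (pure_tensor R H Q y (\<pi> z)) (h \<cdot> k)" .
  qed (auto intro!: Qmods act_lin Qlin h k)
qed

text \<open>
  The coaction \<open>h \<mapsto> h\<^sub>(\<^sub>1\<^sub>) \<otimes> \<pi>(h\<^sub>(\<^sub>2\<^sub>))\<close>. Multiplicativity of the comultiplication makes it \<open>H\<close>-linear for the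
  diagonal action.
\<close>

definition \<delta> where "\<delta> h = tensor_map R H H H Q id \<pi> (\<Delta> h)"

lemma delta_eq: "\<delta> h = sweedler HQ (\<lambda>p q. pure_tensor R H Q p (\<pi> q)) h"
  by (simp add: \<delta>_def tensor_map_def)

lemma delta_linear: "\<delta> \<in> linear_map R H HQ"
  unfolding delta_eq[abs_def] by (auto intro!: Qmods Qlin Qclosed)

lemma delta_mult:
  assumes x: "x \<in> carrier H" and u: "u \<in> carrier H"
  shows "\<delta> (x \<cdot> u) = act (\<delta> x) u"
proof -
  have "act (\<delta> x) u = sweedler HQ (\<lambda>p q. act (pure_tensor R H Q p (\<pi> q)) u) x"
    unfolding delta_eq
    by (rule linear_map_tensor_lift[OF _ _ _ _ bilinear_left[OF act_bilinear u]])
       (auto intro!: Qmods Qlin Qclosed x)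
  also have "\<dots> = sweedler HQ (\<lambda>p q. sweedler HQ (\<lambda>c d. pure_tensor R H Q (p \<cdot> c) (\<pi> (q \<cdot> d))) u) x"
    by (intro tensor_lift_cong Qmods Qclosed x) (simp add: act_pure u)
  also have "\<dots> = \<delta> (x \<cdot> u)"
    unfolding delta_eq
    by (rule mult_sweedler[symmetric]) (auto intro!: Qmods Qlin Qclosed x u)
  finally show ?thesis by simp
qed

text \<open>
  The coinvariants are the elements where the coaction agrees with \<open>x \<mapsto> x \<otimes> \<pi>(1)\<close>, hence the kernel of a
  linear map into \<open>H \<otimes> H/J\<close>.
\<close>

definition right_unit where "right_unit x = pure_tensor R H Q x (\<pi> \<one>\<^bsub>H\<^esub>)"

lemma right_unit_linear: "right_unit \<in> linear_map R H HQ"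
  unfolding right_unit_def[abs_def] by (intro Qlin Qmods Qclosed)

definition defect where "defect x = \<delta> x \<ominus>\<^bsub>HQ\<^esub> right_unit x"

lemma defect_linear: "defect \<in> linear_map R H HQ"
  unfolding defect_def[abs_def] by (intro Qlin delta_linear right_unit_linear Qmods)

abbreviation B where "B \<equiv> coinvariants R H \<Delta> Q"

lemma B_eq: "B = {x \<in> carrier H. defect x = \<zero>\<^bsub>HQ\<^esub>}"
proof -
  have "defect x = \<zero>\<^bsub>HQ\<^esub> \<longleftrightarrow> \<delta> x = pure_tensor R H Q x (\<pi> \<one>\<^bsub>H\<^esub>)" if "x \<in> carrier H" for x
    unfolding defect_def right_unit_def using that linear_map_closed[OF delta_linear]
    by (intro abelian_group.minus_eq_zero_iff module.axioms(2)[OF module_tensor] Qmods Qclosed)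
  then show ?thesis by (auto simp: coinvariants_def \<delta>_def)
qed

lemma B_submodule: "submodule B R H"
  unfolding B_eq by (intro submodule_kernel defect_linear Qmods)

lemma delta_B: "b \<in> B \<Longrightarrow> \<delta> b = pure_tensor R H Q b (\<pi> \<one>\<^bsub>H\<^esub>)"
  by (simp add: coinvariants_def \<delta>_def)

lemma B_closed: "b \<in> B \<Longrightarrow> b \<in> carrier H"
  by (simp add: coinvariants_def)

lemma one_in_B: "\<one>\<^bsub>H\<^esub> \<in> B"
proof -
  have "\<delta> \<one>\<^bsub>H\<^esub> = pure_tensor R H Q \<one>\<^bsub>H\<^esub> (\<pi> \<one>\<^bsub>H\<^esub>)"
    unfolding delta_eq by (rule one_sweedler) (auto intro!: Qmods Qlin Qclosed)
  then show ?thesis by (simp add: coinvariants_def \<delta>_def)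
qed

end

section \<open>The cotensor product\<close>

context hopf_algebra
begin

abbreviation HH where "HH \<equiv> tensor R H H"
abbreviation \<alpha> where "\<alpha> \<equiv> twist H (\<lambda>x y. x \<cdot> y)"
abbreviation \<alpha>' where "\<alpha>' \<equiv> twist H (\<lambda>x y. x \<cdot> S y)"

lemmas \<alpha>_linear = twist_linear[OF H_module mul_bilinear]
lemmas \<alpha>_pure = twist_pure[OF H_module mul_bilinear]
lemmas \<alpha>'_linear = twist_linear[OF H_module antipode_action_bilinear[OF mul_bilinear]]
lemmas \<alpha>'_pure = twist_pure[OF H_module antipode_action_bilinear[OF mul_bilinear]]
lemmas \<alpha>'_\<alpha> = untwist_twist[OF regular_action]
lemmas \<alpha>_\<alpha>' = twist_untwist[OF regular_action]
lemmas \<alpha>_bij = twist_bij[OF regular_action]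

lemma counit_one: "\<epsilon> \<one>\<^bsub>H\<^esub> = \<one>\<^bsub>R\<^esub>"
  using counit_ring_hom by (simp add: ring_hom_def)

lemma counit_mult: "\<lbrakk>x \<in> carrier H; y \<in> carrier H\<rbrakk> \<Longrightarrow> \<epsilon> (x \<cdot> y) = \<epsilon> x \<otimes>\<^bsub>R\<^esub> \<epsilon> y"
  using counit_ring_hom by (simp add: ring_hom_def)

lemma H_smult_one: "module R P \<Longrightarrow> x \<in> carrier P \<Longrightarrow> \<one>\<^bsub>R\<^esub> \<odot>\<^bsub>P\<^esub> x = x"
  by (rule module.smult_one)

end

context hopf_quotient
begin

lemmas delta_closed = linear_map_closed[OF delta_linear]
lemmas right_unit_closed = linear_map_closed[OF right_unit_linear]

lemma HQ_module: "module R HQ" by (intro Qmods)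

text \<open>
  The two maps that the cotensor product equalises. Precomposed with \<open>\<alpha>\<close> they become the bijection \<open>\<gamma>\<close> after
  \<open>\<delta> \<otimes> id\<close> and after \<open>right_unit \<otimes> id\<close>.
\<close>

definition cotensor_left where
  "cotensor_left t = tensor_map R H H HQ H (\<lambda>h. tensor_map R H H H Q id \<pi> (\<Delta> h)) id t"
definition cotensor_right where
  "cotensor_right t = tensor_assoc R H Q H
    (tensor_map R H H H (tensor R Q H) id (\<lambda>h'. tensor_map R H H Q H \<pi> id (\<Delta> h')) t)"

lemma cotensor_left_eq: "cotensor_left = tensor_map R H H HQ H \<delta> id"
  by (simp add: cotensor_left_def[abs_def] \<delta>_def[abs_def])

text \<open>
  The left side at \<open>x \<otimes> h\<close> is \<open>\<delta>(x h\<^sub>(\<^sub>1\<^sub>)) \<otimes> h\<^sub>(\<^sub>2\<^sub>) = \<delta>(x) h\<^sub>(\<^sub>1\<^sub>) \<otimes> h\<^sub>(\<^sub>2\<^sub>)\<close>.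
\<close>

lemma cotensor_left_alpha:
  assumes t: "t \<in> carrier HH"
  shows "cotensor_left (\<alpha> t) = twist HQ act (tensor_map R H H HQ H \<delta> id t)"
proof (rule tensor_ext[OF H_module H_module _ _ _ _ t])
  note T = tensor_map_linear[OF H_module H_module HQ_module H_module delta_linear id_linear]
  note Tp = tensor_map_pure[OF H_module H_module HQ_module H_module delta_linear id_linear]
  show "(\<lambda>t. cotensor_left (\<alpha> t)) \<in> linear_map R HH (tensor R HQ H)"
    unfolding cotensor_left_eq by (rule linear_map_comp[OF T \<alpha>_linear])
  show "(\<lambda>t. twist HQ act (tensor_map R H H HQ H \<delta> id t)) \<in> linear_map R HH (tensor R HQ H)"
    by (rule linear_map_comp[OF twist_linear[OF HQ_module act_bilinear] T])
  fix x h assume x: "x \<in> carrier H" and h: "h \<in> carrier H"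
  have "cotensor_left (\<alpha> (pure_tensor R H H x h)) = sweedler (tensor R HQ H) (\<lambda>u v. cotensor_left (pure_tensor R H H (x \<cdot> u) v)) h"
    unfolding cotensor_left_eq \<alpha>_pure[OF x h]
    by (rule linear_map_tensor_lift[OF _ _ _ _ T]) (auto intro!: Qmods Qlin Qclosed x h)
  also have "\<dots> = sweedler (tensor R HQ H) (\<lambda>u v. pure_tensor R HQ H (act (\<delta> x) u) v) h"
    by (intro tensor_lift_cong mods closed h) (simp add: cotensor_left_eq Tp x delta_mult)
  also have "\<dots> = twist HQ act (tensor_map R H H HQ H \<delta> id (pure_tensor R H H x h))"
    using x h by (simp add: Tp twist_pure[OF HQ_module act_bilinear] delta_closed)
  finally show "cotensor_left (\<alpha> (pure_tensor R H H x h)) =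
      twist HQ act (tensor_map R H H HQ H \<delta> id (pure_tensor R H H x h))" .
qed (intro Qmods)

lemma cotensor_right_linear: "cotensor_right \<in> linear_map R HH (tensor R HQ H)"
  unfolding cotensor_right_def[abs_def] tensor_map_def
  by (rule linear_map_comp[OF tensor_assoc_linear]) (auto intro!: Qmods Qlin Qclosed id_linear simp: id_def)

lemma cotensor_right_pure:
  assumes y: "y \<in> carrier H" and k: "k \<in> carrier H"
  shows "cotensor_right (pure_tensor R H H y k) =
    sweedler (tensor R HQ H) (\<lambda>p q. pure_tensor R HQ H (pure_tensor R H Q y (\<pi> p)) q) k"
proof -
  let ?QH = "tensor R Q H"
  have l: "(\<lambda>h'. tensor_map R H H Q H \<pi> id (\<Delta> h')) \<in> linear_map R H ?QH"
    unfolding tensor_map_def by (auto intro!: Qmods Qlin Qclosed simp: id_def)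
  have QH: "module R ?QH" by (intro Qmods)
  have "cotensor_right (pure_tensor R H H y k) = tensor_assoc R H Q H (pure_tensor R H ?QH y (tensor_map R H H Q H \<pi> id (\<Delta> k)))"
    unfolding cotensor_right_def using y k by (simp add: tensor_map_pure[OF H_module H_module H_module QH id_linear l])
  also have "\<dots> = sweedler (tensor R HQ H) (\<lambda>p q. tensor_assoc R H Q H (pure_tensor R H ?QH y (pure_tensor R Q H (\<pi> p) (id q)))) k"
    unfolding tensor_map_def
    by (rule linear_map_tensor_lift[OF _ _ _ _
          linear_map_comp[OF tensor_assoc_linear bilinear_right[OF pure_tensor_bilinear]]])
       (auto intro!: Qmods Qlin Qclosed y k simp: id_def)
  also have "\<dots> = sweedler (tensor R HQ H) (\<lambda>p q. pure_tensor R HQ H (pure_tensor R H Q y (\<pi> p)) q) k"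
    by (intro tensor_lift_cong mods closed k) (simp add: tensor_assoc_pure Qmods y Qclosed)
  finally show ?thesis .
qed

text \<open>
  The left side at \<open>x \<otimes> h\<close> is \<open>x h\<^sub>(\<^sub>1\<^sub>) \<otimes> \<pi>(h\<^sub>(\<^sub>2\<^sub>)) \<otimes> h\<^sub>(\<^sub>3\<^sub>) = (x \<otimes> \<pi>(1)) h\<^sub>(\<^sub>1\<^sub>) \<otimes> h\<^sub>(\<^sub>2\<^sub>)\<close>.
\<close>

lemma cotensor_right_alpha:
  assumes t: "t \<in> carrier HH"
  shows "cotensor_right (\<alpha> t) = twist HQ act (tensor_map R H H HQ H right_unit id t)"
proof (rule tensor_ext[OF H_module H_module _ _ _ _ t])
  let ?P = "tensor R HQ H"
  have P: "module R ?P" by (intro Qmods)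
  note T = tensor_map_linear[OF H_module H_module HQ_module H_module right_unit_linear id_linear]
  note Tp = tensor_map_pure[OF H_module H_module HQ_module H_module right_unit_linear id_linear]
  show "(\<lambda>t. cotensor_right (\<alpha> t)) \<in> linear_map R HH (tensor R HQ H)"
    by (rule linear_map_comp[OF cotensor_right_linear \<alpha>_linear])
  show "(\<lambda>t. twist HQ act (tensor_map R H H HQ H right_unit id t)) \<in> linear_map R HH (tensor R HQ H)"
    by (rule linear_map_comp[OF twist_linear[OF HQ_module act_bilinear] T])
  fix x h assume x: "x \<in> carrier H" and h: "h \<in> carrier H"
  have "cotensor_right (\<alpha> (pure_tensor R H H x h)) = sweedler ?P (\<lambda>u v. cotensor_right (pure_tensor R H H (x \<cdot> u) v)) h"
    unfolding \<alpha>_pure[OF x h]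
    by (rule linear_map_tensor_lift[OF _ _ _ _ cotensor_right_linear]) (auto intro!: Qmods Qlin Qclosed x h)
  also have "\<dots> = sweedler ?P (\<lambda>u v. sweedler ?P (\<lambda>p q. pure_tensor R HQ H (pure_tensor R H Q (x \<cdot> u) (\<pi> p)) q) v) h"
    by (intro tensor_lift_cong mods closed h) (simp add: cotensor_right_pure x)
  also have "\<dots> = sweedler ?P (\<lambda>a q. sweedler ?P (\<lambda>u p. pure_tensor R HQ H (pure_tensor R H Q (x \<cdot> u) (\<pi> p)) q) a) h"
    by (rule coassoc_sweedler[symmetric]) (auto intro!: Qmods Qlin Qclosed x h)
  also have "\<dots> = sweedler ?P (\<lambda>a q. pure_tensor R HQ H (act (right_unit x) a) q) h"
  proof (intro tensor_lift_cong mods closed h)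
    fix a q assume a: "a \<in> carrier H" and q: "q \<in> carrier H"
    have "act (right_unit x) a = sweedler HQ (\<lambda>u p. pure_tensor R H Q (x \<cdot> u) (\<pi> p)) a"
      unfolding right_unit_def act_pure[OF x one_H_closed a]
      by (intro tensor_lift_cong mods closed a) simp
    then have "pure_tensor R HQ H (act (right_unit x) a) q =
        pure_tensor R HQ H (sweedler HQ (\<lambda>u p. pure_tensor R H Q (x \<cdot> u) (\<pi> p)) a) q" by simp
    also have "\<dots> = sweedler ?P (\<lambda>u p. pure_tensor R HQ H (pure_tensor R H Q (x \<cdot> u) (\<pi> p)) q) a"
      by (rule linear_map_tensor_lift[OF _ _ _ _ bilinear_left[OF pure_tensor_bilinear]])
         (auto intro!: Qmods Qlin Qclosed x a q)
    finally show "sweedler ?P (\<lambda>u p. pure_tensor R HQ H (pure_tensor R H Q (x \<cdot> u) (\<pi> p)) q) a =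
        pure_tensor R HQ H (act (right_unit x) a) q" by simp
  qed
  also have "\<dots> = twist HQ act (tensor_map R H H HQ H right_unit id (pure_tensor R H H x h))"
    using x h by (simp add: Tp twist_pure[OF HQ_module act_bilinear] right_unit_closed)
  finally show "cotensor_right (\<alpha> (pure_tensor R H H x h)) =
      twist HQ act (tensor_map R H H HQ H right_unit id (pure_tensor R H H x h))" .
qed (intro Qmods)

abbreviation defect_id where "defect_id \<equiv> tensor_map R H H HQ H defect id"

lemma defect_id_linear: "defect_id \<in> linear_map R HH (tensor R HQ H)"
  by (intro tensor_map_linear Qmods defect_linear id_linear)

lemma defect_id_pure: "\<lbrakk>x \<in> carrier H; h \<in> carrier H\<rbrakk> \<Longrightarrow> defect_id (pure_tensor R H H x h) = pure_tensor R HQ H (defect x) h"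
  using tensor_map_pure[OF H_module H_module HQ_module H_module defect_linear id_linear] by simp

lemma cotensor_carrier: "carrier (cotensor R H \<Delta> Q) = {t \<in> carrier HH. cotensor_left t = cotensor_right t}"
  by (simp add: cotensor_def Let_def cotensor_left_def cotensor_right_def)

text \<open>
  Injectivity of \<open>\<gamma>\<close> cancels it from the equation that defines the cotensor product.
\<close>

lemma alpha_in_cotensor_iff:
  assumes t: "t \<in> carrier HH"
  shows "\<alpha> t \<in> carrier (cotensor R H \<Delta> Q) \<longleftrightarrow> defect_id t = \<zero>\<^bsub>tensor R HQ H\<^esub>"
proof -
  let ?d = "tensor_map R H H HQ H \<delta> id t" and ?right_unit = "tensor_map R H H HQ H right_unit id t"
  note c = linear_map_closed[OF tensor_map_linear[OF H_module H_module HQ_module H_module delta_linear id_linear] t]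
    linear_map_closed[OF tensor_map_linear[OF H_module H_module HQ_module H_module right_unit_linear id_linear] t]
  have "\<alpha> t \<in> carrier (cotensor R H \<Delta> Q) \<longleftrightarrow> twist HQ act ?d = twist HQ act ?right_unit"
    using linear_map_closed[OF \<alpha>_linear t] by (simp add: cotensor_carrier cotensor_left_alpha cotensor_right_alpha t)
  also have "\<dots> \<longleftrightarrow> ?d = ?right_unit"
    using bij_betw_imp_inj_on[OF twist_bij[OF act_right_action]] c by (auto dest: inj_onD)
  also have "\<dots> \<longleftrightarrow> defect_id t = \<zero>\<^bsub>tensor R HQ H\<^esub>"
    unfolding defect_def[abs_def] tensor_map_diff_left[OF H_module H_module HQ_module H_module delta_linear right_unit_linear id_linear t]
    by (intro abelian_group.minus_eq_zero_iff[symmetric] module.axioms(2)[OF module_tensor] HQ_module H_module c)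
  finally show ?thesis .
qed

end

section \<open>Consequences of flatness\<close>

locale flat_hopf_quotient = hopf_quotient R H \<Delta> \<epsilon> S J
  for R :: "('r, 'a) ring_scheme" (structure) and H :: "('r, 'h, 'b) module_scheme" (structure)
    and \<Delta> \<epsilon> S J +
  assumes flat: "flat_module TYPE(('h \<times> 'h set \<Rightarrow> 'r) set) R H"
begin

text \<open>
  Exactness of \<open>B \<otimes> H \<rightarrow> H \<otimes> H \<rightarrow> (H \<otimes> H/J) \<otimes> H\<close>, where the second map is \<open>g \<otimes> id\<close> for the defect map \<open>g\<close>, whose
  kernel is \<open>B\<close>. The symmetry reduces it to flatness of \<open>H \<otimes> -\<close>.
\<close>

lemma defect_id_kernel:
  assumes L: "submodule L R HH" and pure: "\<And>b h. \<lbrakk>b \<in> B; h \<in> carrier H\<rbrakk> \<Longrightarrow> pure_tensor R H H b h \<in> L"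
    and t: "t \<in> carrier HH" and 0: "defect_id t = \<zero>\<^bsub>tensor R HQ H\<^esub>"
  shows "t \<in> L"
proof -
  let ?s = "tensor_swap R H H"
  note s = tensor_swap_linear[OF H_module H_module]
  have st: "?s t \<in> carrier HH" by (rule linear_map_closed[OF s t])
  have HH: "module R HH" by (intro mods)
  have "?s t \<in> {y \<in> carrier HH. ?s y \<in> L}"
  proof (rule flat_exact[OF flat H_module H_module HQ_module defect_linear submodule_preimage[OF s HH HH L] _ st])
    show "tensor_map R H H H HQ id defect (?s t) = \<zero>\<^bsub>tensor R H HQ\<^esub>"
      using tensor_swap_map[OF H_module H_module HQ_module H_module defect_linear id_linear t]
        linear_map_zero[OF tensor_swap_linear[OF HQ_module H_module]] 0
      by (simp add: Qmods)
  qed (auto simp: tensor_swap_pure H_module closed B_eq intro!: pure)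
  then show ?thesis using tensor_swap_swap[OF H_module H_module t] by simp
qed

text \<open>
  The coinvariants form a left coideal: \<open>\<Delta>(b)\<close> lies in the image of \<open>H \<otimes> B\<close>, which is the kernel of \<open>id \<otimes> g\<close>.
  Indeed \<open>b\<^sub>(\<^sub>1\<^sub>) \<otimes> b\<^sub>(\<^sub>2\<^sub>) \<otimes> \<pi>(b\<^sub>(\<^sub>3\<^sub>)) = b\<^sub>(\<^sub>1\<^sub>) \<otimes> b\<^sub>(\<^sub>2\<^sub>) \<otimes> \<pi>(1)\<close> results from applying \<open>\<Delta> \<otimes> id\<close> to the equation that
  defines coinvariance.
\<close>

lemma comult_B_mem:
  assumes L: "submodule L R HH" and pure: "\<And>h b. \<lbrakk>h \<in> carrier H; b \<in> B\<rbrakk> \<Longrightarrow> pure_tensor R H H h b \<in> L"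
    and b: "b \<in> B"
  shows "\<Delta> b \<in> L"
proof -
  have bH: "b \<in> carrier H" using b by (rule B_closed)
  let ?P = "tensor R H HQ"
  have P: "module R ?P" by (intro Qmods)
  define \<xi> where "\<xi> = tensor_lift R H Q ?P (\<lambda>y d. sweedler ?P (\<lambda>u v. pure_tensor R H HQ u (pure_tensor R H Q v d)) y)"
  have \<xi>: "\<xi> \<in> linear_map R HQ ?P"
    unfolding \<xi>_def by (intro tensor_lift_linear Qmods) (auto intro!: Qmods Qlin Qclosed)
  have \<xi>_pure: "\<xi> (pure_tensor R H Q y d) = sweedler ?P (\<lambda>u v. pure_tensor R H HQ u (pure_tensor R H Q v d)) y"
    if "y \<in> carrier H" "d \<in> carrier Q" for y d
    unfolding \<xi>_def using that by (intro tensor_lift_pure Qmods) (auto intro!: Qmods Qlin Qclosed)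
  have "tensor_map R H H H HQ id \<delta> (\<Delta> b) = sweedler ?P (\<lambda>u w. pure_tensor R H HQ u (\<delta> w)) b"
    by (simp add: tensor_map_def)
  also have "\<dots> = sweedler ?P (\<lambda>u w. sweedler ?P (\<lambda>v q. pure_tensor R H HQ u (pure_tensor R H Q v (\<pi> q))) w) b"
    unfolding delta_eq
    by (intro tensor_lift_cong mods closed bH linear_map_tensor_lift[OF _ _ _ _ bilinear_right[OF pure_tensor_bilinear]])
       (auto intro!: Qmods Qlin Qclosed)
  also have "\<dots> = sweedler ?P (\<lambda>p q. sweedler ?P (\<lambda>u v. pure_tensor R H HQ u (pure_tensor R H Q v (\<pi> q))) p) b"
    by (rule coassoc_sweedler[symmetric]) (auto intro!: Qmods Qlin Qclosed bH)
  also have "\<dots> = sweedler ?P (\<lambda>p q. \<xi> (pure_tensor R H Q p (\<pi> q))) b"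
    by (intro tensor_lift_cong mods closed bH) (simp add: \<xi>_pure Qclosed)
  also have "\<dots> = \<xi> (\<delta> b)"
    unfolding delta_eq by (rule linear_map_tensor_lift[OF _ _ _ _ \<xi>, symmetric]) (auto intro!: Qmods Qlin Qclosed bH)
  also have "\<dots> = sweedler ?P (\<lambda>u v. pure_tensor R H HQ u (right_unit v)) b"
    by (simp add: delta_B[OF b] \<xi>_pure Qclosed bH right_unit_def)
  also have "\<dots> = tensor_map R H H H HQ id right_unit (\<Delta> b)"
    by (simp add: tensor_map_def)
  finally have "tensor_map R H H H HQ id \<delta> (\<Delta> b) = tensor_map R H H H HQ id right_unit (\<Delta> b)" .
  then have "tensor_map R H H H HQ id defect (\<Delta> b) = \<zero>\<^bsub>?P\<^esub>"
    unfolding defect_def[abs_def] tensor_map_diff_right[OF H_module H_module H_module HQ_module id_linear delta_linear right_unit_linear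
        comult_closed[OF bH]]
    by (subst abelian_group.minus_eq_zero_iff[OF module.axioms(2)[OF P]])
       (auto intro!: linear_map_closed[OF tensor_map_linear] Qmods closed bH id_linear delta_linear right_unit_linear)
  then show ?thesis
    by (intro flat_exact[OF flat H_module H_module HQ_module defect_linear L _ comult_closed[OF bH]])
       (auto intro: pure simp: B_eq)
qed

end

section \<open>Galois coextensions\<close>

text \<open>
  In the application \<open>J\<close> is \<open>K\<^sup>+H\<close>. Vanishing of the counit on \<open>J\<close> makes \<open>x \<mapsto> x \<otimes> \<pi>(1)\<close> injective, which embeds
  \<open>K\<close> into \<open>H \<otimes> H/J\<close>, where flatness can be applied.
\<close>

locale coextension = flat_hopf_quotient R H \<Delta> \<epsilon> S J
  for R :: "('r, 'a) ring_scheme" (structure) and H :: "('r, 'h, 'b) module_scheme" (structure)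
    and \<Delta> \<epsilon> S J +
  fixes K
  assumes K: "submodule K R H" and counit_J: "x \<in> J \<Longrightarrow> \<epsilon> x = \<zero>\<^bsub>R\<^esub>"
begin

abbreviation KM where "KM \<equiv> H\<lparr>carrier := K\<rparr>"
abbreviation KH where "KH \<equiv> tensor R KM H"
abbreviation \<iota> where "\<iota> \<equiv> tensor_map R KM H H H (\<lambda>x. x) id"

lemma K_closed: "k \<in> K \<Longrightarrow> k \<in> carrier H"
  using submodule.axioms(1)[OF K, THEN subgroup.subset] by auto

lemma KM_module: "module R KM"
  by (rule submodule.submodule_is_module[OF K H_module])

lemma incl_linear: "(\<lambda>x. x) \<in> linear_map R KM H"
  by (auto simp: linear_map_def K_closed)

lemma restrict_linear: "f \<in> linear_map R H P \<Longrightarrow> f \<in> linear_map R KM P"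
  by (auto simp: linear_map_def K_closed Pi_iff)

lemma \<iota>_linear: "\<iota> \<in> linear_map R KH HH"
  by (intro tensor_map_linear KM_module H_module incl_linear id_linear)

lemma \<iota>_pure: "k \<in> K \<Longrightarrow> h \<in> carrier H \<Longrightarrow> \<iota> (pure_tensor R KM H k h) = pure_tensor R H H k h"
  by (simp add: tensor_map_pure KM_module H_module incl_linear id_linear)

text \<open>
  The map \<open>y \<otimes> \<pi>(z) \<mapsto> \<epsilon>(z) y\<close> is a left inverse.
\<close>

lemma right_unit_inj:
  assumes x: "x \<in> carrier H" and 0: "right_unit x = \<zero>\<^bsub>HQ\<^esub>"
  shows "x = \<zero>\<^bsub>H\<^esub>"
proof -
  let ?e = "quot_lift \<epsilon>"
  have Rm: "module R (regular_module R)" by (rule module_regular) (rule cring_R)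
  have z: "\<forall>n\<in>J. \<epsilon> n = \<zero>\<^bsub>regular_module R\<^esub>" by (simp add: counit_J regular_module_def)
  have e: "?e \<in> linear_map R Q (regular_module R)"
    by (rule quotient.quot_lift_linear[OF quotient_J counit_linear Rm z])
  have e1: "?e (\<pi> \<one>\<^bsub>H\<^esub>) = \<one>\<^bsub>R\<^esub>"
    unfolding proj_eq using quotient.quot_lift_coset[OF quotient_J counit_linear Rm z one_H_closed]
    by (simp add: counit_one)
  have ec: "d \<in> carrier Q \<Longrightarrow> ?e d \<in> carrier R" for d
    using linear_map_closed[OF e] by (simp add: regular_module_def)
  have b: "bilinear R H Q H (\<lambda>y d. ?e d \<odot>\<^bsub>H\<^esub> y)"
    by (auto intro!: lin linear_map_smult_const e H_module ec)
  have "tensor_lift R H Q H (\<lambda>y d. ?e d \<odot>\<^bsub>H\<^esub> y) (right_unit x) = \<one>\<^bsub>R\<^esub> \<odot>\<^bsub>H\<^esub> x"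
    unfolding right_unit_def using x by (simp add: tensor_lift_pure[OF H_module Q_module H_module b] Qclosed e1)
  also have "\<dots> = x" using x by (rule H_smult_one[OF H_module])
  finally show ?thesis
    using linear_map_zero[OF tensor_lift_linear[OF H_module Q_module H_module b] HQ_module H_module] 0
    by simp
qed

text \<open>
  The composite \<open>K \<otimes> H \<rightarrow> H \<otimes> H \<rightarrow> (H \<otimes> H/J) \<otimes> H\<close> with \<open>right_unit \<otimes> id\<close> is injective by flatness.
\<close>

lemma \<iota>_inj: "inj_on \<iota> (carrier KH)"
proof (rule linear_map_injI[OF \<iota>_linear])
  show KH: "module R KH" "module R HH" by (intro module_tensor KM_module H_module)+
  fix t assume t: "t \<in> carrier KH" and 0: "\<iota> t = \<zero>\<^bsub>HH\<^esub>"
  let ?s = "tensor_swap R KM H"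
  have jK: "right_unit \<in> linear_map R KM HQ" by (rule restrict_linear[OF right_unit_linear])
  note s = tensor_swap_linear[OF KM_module H_module]
  have st: "?s t \<in> carrier (tensor R H KM)" by (rule linear_map_closed[OF s t])
  have HK: "module R (tensor R H KM)" by (intro module_tensor KM_module H_module)
  have "tensor_map R KM H HQ H right_unit id t = tensor_map R H H HQ H right_unit id (\<iota> t)"
    using tensor_map_comp[OF KM_module H_module H_module H_module HQ_module H_module incl_linear id_linear
        right_unit_linear id_linear t] by (simp add: id_def)
  also have "\<dots> = \<zero>\<^bsub>tensor R HQ H\<^esub>"
    unfolding 0 by (rule linear_map_zero[OF tensor_map_linear[OF H_module H_module HQ_module H_module
          right_unit_linear id_linear]]) (intro Qmods)+
  finally have 1: "tensor_map R KM H HQ H right_unit id t = \<zero>\<^bsub>tensor R HQ H\<^esub>" .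
  have "?s t \<in> {\<zero>\<^bsub>tensor R H KM\<^esub>}"
  proof (rule flat_exact[OF flat H_module KM_module HQ_module jK submodule_zero[OF HK] _ st])
    show "tensor_map R H KM H HQ id right_unit (?s t) = \<zero>\<^bsub>tensor R H HQ\<^esub>"
      unfolding tensor_swap_map[OF KM_module H_module HQ_module H_module jK id_linear t] 1
      by (rule linear_map_zero[OF tensor_swap_linear[OF HQ_module H_module]]) (intro Qmods)+
    fix p m assume p: "p \<in> carrier H" and m: "m \<in> carrier KM" "right_unit m = \<zero>\<^bsub>HQ\<^esub>"
    then have "m = \<zero>\<^bsub>KM\<^esub>" using right_unit_inj K_closed by simp
    then show "pure_tensor R H KM p m \<in> {\<zero>\<^bsub>tensor R H KM\<^esub>}"
      using linear_map_zero[OF bilinear_right[OF pure_tensor_bilinear[OF H_module KM_module] p] KM_module HK]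
      by simp
  qed
  then show "t = \<zero>\<^bsub>KH\<^esub>"
    using tensor_swap_swap[OF KM_module H_module t]
      linear_map_zero[OF tensor_swap_linear[OF H_module KM_module] HK KH(1)] by simp
qed

lemma cocan_eq:
  assumes t: "t \<in> carrier KH"
  shows "cocan_map R H \<Delta> K t = \<alpha> (\<iota> t)"
proof (rule tensor_ext[OF KM_module H_module _ linear_map_comp[OF \<alpha>_linear \<iota>_linear] _ _ t])
  have b: "bilinear R KM H HH (\<lambda>k h. tensor_map R H H H H (\<lambda>x. k \<cdot> x) id (\<Delta> h))"
  proof (rule bilinearI)
    fix k assume "k \<in> carrier KM"
    then have "k \<in> carrier H" by (simp add: K_closed)
    then show "(\<lambda>h. tensor_map R H H H H (\<lambda>x. k \<cdot> x) id (\<Delta> h)) \<in> linear_map R H HH"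
      unfolding tensor_map_def by (auto intro!: lin mods closed simp: id_def)
  next
    fix h assume "h \<in> carrier H"
    then show "(\<lambda>k. tensor_map R H H H H (\<lambda>x. k \<cdot> x) id (\<Delta> h)) \<in> linear_map R KM HH"
      unfolding tensor_map_def by (intro restrict_linear) (auto intro!: lin mods closed simp: id_def)
  qed
  show HH: "module R HH" by (intro mods)
  show "cocan_map R H \<Delta> K \<in> linear_map R KH HH"
    unfolding cocan_map_def by (rule tensor_lift_linear[OF KM_module H_module HH b])
  fix k h assume k: "k \<in> carrier KM" and h: "h \<in> carrier H"
  then have kK: "k \<in> K" and kH: "k \<in> carrier H" by (auto intro: K_closed)
  have "cocan_map R H \<Delta> K (pure_tensor R KM H k h) = tensor_map R H H H H (\<lambda>x. k \<cdot> x) id (\<Delta> h)"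
    unfolding cocan_map_def by (rule tensor_lift_pure[OF KM_module H_module HH b k h])
  also have "\<dots> = \<alpha> (\<iota> (pure_tensor R KM H k h))"
    unfolding \<iota>_pure[OF kK h] \<alpha>_pure[OF kH h] by (simp add: tensor_map_def)
  finally show "cocan_map R H \<Delta> K (pure_tensor R KM H k h) = \<alpha> (\<iota> (pure_tensor R KM H k h))" .
qed

text \<open>
  \<open>K\<close> is determined by the image of \<open>K \<otimes> H\<close>, as \<open>id \<otimes> \<epsilon>\<close> maps that image into \<open>K\<close>.
\<close>

lemma \<iota>_image_mem_iff: "x \<in> K \<longleftrightarrow> x \<in> carrier H \<and> pure_tensor R H H x \<one>\<^bsub>H\<^esub> \<in> \<iota> ` carrier KH"
proof (intro iffI conjI)
  assume x: "x \<in> K"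
  then show "x \<in> carrier H" by (rule K_closed)
  have "pure_tensor R KM H x \<one>\<^bsub>H\<^esub> \<in> carrier KH"
    using x by (intro pure_tensor_closed KM_module H_module) auto
  then show "pure_tensor R H H x \<one>\<^bsub>H\<^esub> \<in> \<iota> ` carrier KH"
    using \<iota>_pure[OF x one_H_closed] by (metis imageI)
next
  assume "x \<in> carrier H \<and> pure_tensor R H H x \<one>\<^bsub>H\<^esub> \<in> \<iota> ` carrier KH"
  then obtain s where x: "x \<in> carrier H" and s: "s \<in> carrier KH" "pure_tensor R H H x \<one>\<^bsub>H\<^esub> = \<iota> s" by auto
  let ?E = "tensor_lift R H H H (\<lambda>y z. \<epsilon> z \<odot>\<^bsub>H\<^esub> y)"
  have b: "bilinear R H H H (\<lambda>y z. \<epsilon> z \<odot>\<^bsub>H\<^esub> y)" by (auto intro!: lin mods closed)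
  note E = tensor_lift_linear[OF H_module H_module H_module b]
  note E_pure = tensor_lift_pure[OF H_module H_module H_module b]
  have KH: "module R KH" by (intro module_tensor KM_module H_module)
  have "s \<in> {s \<in> carrier KH. ?E (\<iota> s) \<in> K}"
    by (rule tensor_spanned[OF KM_module H_module submodule_preimage[OF linear_map_comp[OF E \<iota>_linear] KH H_module K] _ s(1)])
       (auto simp: \<iota>_pure E_pure K_closed closed intro!: pure_tensor_closed KM_module H_module submodule.smult_closed[OF K])
  then have "?E (pure_tensor R H H x \<one>\<^bsub>H\<^esub>) \<in> K" using s by simp
  then show "x \<in> K" using x by (simp add: E_pure counit_one H_smult_one H_module)
qed

text \<open>
  The same for the coinvariants: \<open>id \<otimes> \<epsilon>\<close> takes \<open>g(x) \<otimes> 1\<close> back to \<open>g(x)\<close>.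
\<close>

lemma B_mem_iff: "x \<in> B \<longleftrightarrow> x \<in> carrier H \<and> defect_id (pure_tensor R H H x \<one>\<^bsub>H\<^esub>) = \<zero>\<^bsub>tensor R HQ H\<^esub>"
proof (intro iffI conjI)
  have P: "module R (tensor R HQ H)" by (intro Qmods)
  show "x \<in> carrier H" if "x \<in> B" using that by (rule B_closed)
  show "defect_id (pure_tensor R H H x \<one>\<^bsub>H\<^esub>) = \<zero>\<^bsub>tensor R HQ H\<^esub>" if "x \<in> B"
    using that linear_map_zero[OF bilinear_left[OF pure_tensor_bilinear[OF HQ_module H_module] one_H_closed] HQ_module P]
    by (simp add: B_eq defect_id_pure)
  assume "x \<in> carrier H \<and> defect_id (pure_tensor R H H x \<one>\<^bsub>H\<^esub>) = \<zero>\<^bsub>tensor R HQ H\<^esub>"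
  then have x: "x \<in> carrier H" and 1: "defect_id (pure_tensor R H H x \<one>\<^bsub>H\<^esub>) = \<zero>\<^bsub>tensor R HQ H\<^esub>"
    by blast+
  have 0: "pure_tensor R HQ H (defect x) \<one>\<^bsub>H\<^esub> = \<zero>\<^bsub>tensor R HQ H\<^esub>"
    using 1 unfolding defect_id_pure[OF x one_H_closed] .
  have gx: "defect x \<in> carrier HQ" using x by (rule linear_map_closed[OF defect_linear])
  have b: "bilinear R HQ H HQ (\<lambda>y z. \<epsilon> z \<odot>\<^bsub>HQ\<^esub> y)" by (auto intro!: Qlin Qmods Qclosed)
  have "tensor_lift R HQ H HQ (\<lambda>y z. \<epsilon> z \<odot>\<^bsub>HQ\<^esub> y) (pure_tensor R HQ H (defect x) \<one>\<^bsub>H\<^esub>) = defect x"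
    by (simp add: tensor_lift_pure[OF HQ_module H_module HQ_module b] gx counit_one H_smult_one HQ_module)
  then show "x \<in> B"
    using linear_map_zero[OF tensor_lift_linear[OF HQ_module H_module HQ_module b] P HQ_module] x
    unfolding 0 by (simp add: B_eq)
qed

text \<open>
  With \<open>Z = ker (g \<otimes> id)\<close> the cotensor product is \<open>\<alpha>(Z)\<close>, and the image of the canonical map is the image of
  \<open>K \<otimes> H\<close> under \<open>\<alpha>\<close>. As \<open>\<alpha>\<close> is bijective, surjectivity means that \<open>Z\<close> is the image of \<open>K \<otimes> H\<close>.
\<close>

lemma coextension_iff:
  "cocan_map R H \<Delta> K \<in> linear_iso R KH (cotensor R H \<Delta> Q) \<longleftrightarrow> B = K"
proof
  let ?C = "cotensor R H \<Delta> Q" and ?Z = "{t \<in> carrier HH. defect_id t = \<zero>\<^bsub>tensor R HQ H\<^esub>}"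
  have HH: "module R HH" and KH: "module R KH" and P: "module R (tensor R HQ H)"
    by (intro Qmods KM_module)+
  have Z: "submodule ?Z R HH" by (rule submodule_kernel[OF defect_id_linear HH P])
  have CZ: "carrier ?C = \<alpha> ` ?Z"
  proof (intro equalityI subsetI)
    fix y assume y: "y \<in> carrier ?C"
    then have "y \<in> carrier HH" by (simp add: cotensor_carrier)
    then obtain t where t: "t \<in> carrier HH" "y = \<alpha> t"
      using bij_betw_imp_surj_on[OF \<alpha>_bij] by blast
    then have "t \<in> ?Z" using y alpha_in_cotensor_iff[OF t(1)] by simp
    then show "y \<in> \<alpha> ` ?Z" unfolding t(2) by (rule imageI)
  next
    fix y assume "y \<in> \<alpha> ` ?Z"
    then obtain t where t: "t \<in> ?Z" "y = \<alpha> t" by (rule imageE)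
    then show "y \<in> carrier ?C" using alpha_in_cotensor_iff[of t] by simp
  qed
  have im: "cocan_map R H \<Delta> K ` carrier KH = \<alpha> ` \<iota> ` carrier KH"
    unfolding image_image by (rule image_cong[OF refl cocan_eq])
  have \<iota>c: "\<iota> ` carrier KH \<subseteq> carrier HH" using linear_map_closed[OF \<iota>_linear] by blast
  {
    assume "cocan_map R H \<Delta> K \<in> linear_iso R KH ?C"
    then have "\<alpha> ` \<iota> ` carrier KH = \<alpha> ` ?Z"
      using im CZ by (simp add: linear_iso_def bij_betw_def)
    moreover have "?Z \<subseteq> carrier HH" by (rule Collect_restrict)
    ultimately have eq: "\<iota> ` carrier KH = ?Z"
      using inj_on_image_eq_iff[OF bij_betw_imp_inj_on[OF \<alpha>_bij] \<iota>c, of ?Z] by simp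
    show "B = K"
    proof (rule Set.set_eqI)
      fix x
      show "x \<in> B \<longleftrightarrow> x \<in> K"
        unfolding \<iota>_image_mem_iff[of x] B_mem_iff[of x] eq mem_Collect_eq
        by (rule conj_cong[OF refl]) (simp add: closed mods)
    qed
  next
    assume BK: "B = K"
    have eq: "\<iota> ` carrier KH = ?Z"
    proof (intro equalityI subsetI)
      fix t assume "t \<in> ?Z"
      then have t: "t \<in> carrier HH" "defect_id t = \<zero>\<^bsub>tensor R HQ H\<^esub>" by simp_all
      show "t \<in> \<iota> ` carrier KH"
      proof (rule defect_id_kernel[OF submodule_image[OF \<iota>_linear KH HH] _ t])
        fix b h assume b: "b \<in> B" and h: "h \<in> carrier H"
        then have "pure_tensor R KM H b h \<in> carrier KH"
          unfolding BK by (intro pure_tensor_closed KM_module H_module) auto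
        then show "pure_tensor R H H b h \<in> \<iota> ` carrier KH"
          using \<iota>_pure[of b h] b h BK by (metis imageI)
      qed
    next
      fix t assume "t \<in> \<iota> ` carrier KH"
      then obtain s where s: "s \<in> carrier KH" "t = \<iota> s" by (auto elim: imageE)
      have "s \<in> {s \<in> carrier KH. \<iota> s \<in> ?Z}"
      proof (rule tensor_spanned[OF KM_module H_module submodule_preimage[OF \<iota>_linear KH HH Z] _ s(1)])
        fix k h assume k: "k \<in> carrier KM" and h: "h \<in> carrier H"
        have "k \<in> B" using k by (simp add: BK)
        then have gk: "k \<in> carrier H" "defect k = \<zero>\<^bsub>HQ\<^esub>" unfolding B_eq by simp_all
        then have "defect_id (pure_tensor R H H k h) = \<zero>\<^bsub>tensor R HQ H\<^esub>"
          using linear_map_zero[OF bilinear_left[OF pure_tensor_bilinear[OF HQ_module H_module] h] HQ_module P] h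
          by (simp add: defect_id_pure)
        then show "pure_tensor R KM H k h \<in> {s \<in> carrier KH. \<iota> s \<in> ?Z}"
          using k h gk by (simp add: \<iota>_pure pure_tensor_closed KM_module H_module)
      qed
      then show "t \<in> ?Z" using s by simp
    qed
    have "inj_on (\<lambda>t. \<alpha> (\<iota> t)) (carrier KH)"
      using comp_inj_on[OF \<iota>_inj inj_on_subset[OF bij_betw_imp_inj_on[OF \<alpha>_bij] \<iota>c]] by (simp add: comp_def)
    then have "inj_on (cocan_map R H \<Delta> K) (carrier KH)"
      by (subst inj_on_cong[OF cocan_eq])
    moreover have surj: "cocan_map R H \<Delta> K ` carrier KH = carrier ?C"
      unfolding im eq CZ ..
    moreover have "cocan_map R H \<Delta> K \<in> linear_map R KH ?C"
    proof (rule linear_mapI)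
      have ops: "add ?C = add HH" "smult ?C = smult HH" by (simp_all add: cotensor_def Let_def)
      have l: "cocan_map R H \<Delta> K \<in> linear_map R KH HH"
        by (rule linear_map_cong[OF linear_map_comp[OF \<alpha>_linear \<iota>_linear] KH]) (simp add: cocan_eq)
      fix x assume x: "x \<in> carrier KH"
      show "cocan_map R H \<Delta> K x \<in> carrier ?C" using surj x by blast
      show "cocan_map R H \<Delta> K (x \<oplus>\<^bsub>KH\<^esub> y) = cocan_map R H \<Delta> K x \<oplus>\<^bsub>?C\<^esub> cocan_map R H \<Delta> K y"
        if "y \<in> carrier KH" for y
        unfolding ops by (rule linear_map_add[OF l x that])
      show "cocan_map R H \<Delta> K (a \<odot>\<^bsub>KH\<^esub> x) = a \<odot>\<^bsub>?C\<^esub> cocan_map R H \<Delta> K x"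
        if "a \<in> carrier R" for a
        unfolding ops by (rule linear_map_smult[OF l that x])
    qed
    ultimately show "cocan_map R H \<Delta> K \<in> linear_iso R KH ?C"
      by (simp add: linear_iso_def bij_betw_def)
  }
qed

end

section \<open>Galois extensions\<close>

context hopf_algebra
begin

text \<open>
  Both maps multiply the first factor by \<open>a\<close> from the left. On the right the first multiplies by \<open>1 \<otimes> q\<close>, the
  second by \<open>\<Delta>(q)\<close>, and \<open>\<alpha>\<close> intertwines them since \<open>\<Delta>\<close> is multiplicative.
\<close>

definition translate where
  "translate a q = tensor_map R H H H H (\<lambda>x. a \<cdot> x) (\<lambda>z. z \<cdot> q)"

definition diagonal_translate where
  "diagonal_translate a q = tensor_lift R H H HH
    (\<lambda>x z. sweedler HH (\<lambda>r s. pure_tensor R H H (a \<cdot> x \<cdot> r) (z \<cdot> s)) q)"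

lemma HH_module: "module R HH" by (intro mods)

lemma translate_linear: "\<lbrakk>a \<in> carrier H; q \<in> carrier H\<rbrakk> \<Longrightarrow> translate a q \<in> linear_map R HH HH"
  unfolding translate_def by (intro tensor_map_linear lin mods)

lemma translate_pure:
  "\<lbrakk>a \<in> carrier H; q \<in> carrier H; x \<in> carrier H; z \<in> carrier H\<rbrakk> \<Longrightarrow>
    translate a q (pure_tensor R H H x z) = pure_tensor R H H (a \<cdot> x) (z \<cdot> q)"
  unfolding translate_def by (intro tensor_map_pure lin mods)

lemma translate_bilinear:
  assumes n: "n \<in> carrier HH" and y: "y \<in> carrier H"
  shows "bilinear R H H HH (\<lambda>p q. translate (y \<cdot> S p) q n)"
  unfolding translate_def tensor_map_def by (auto intro!: lin mods closed n y)

lemma diagonal_translate_bilinear: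
  assumes "a \<in> carrier H" "q \<in> carrier H"
  shows "bilinear R H H HH (\<lambda>x z. sweedler HH (\<lambda>r s. pure_tensor R H H (a \<cdot> x \<cdot> r) (z \<cdot> s)) q)"
  by (auto intro!: lin mods closed assms)

lemma alpha_translate:
  assumes a: "a \<in> carrier H" and q: "q \<in> carrier H" and t: "t \<in> carrier HH"
  shows "\<alpha> (translate a q t) = diagonal_translate a q (\<alpha> t)"
proof (rule tensor_ext[OF H_module H_module _ _ HH_module _ t])
  note b = diagonal_translate_bilinear[OF a q]
  have D: "diagonal_translate a q \<in> linear_map R HH HH"
    unfolding diagonal_translate_def by (intro tensor_lift_linear mods b)
  show "(\<lambda>t. \<alpha> (translate a q t)) \<in> linear_map R HH HH"
    by (rule linear_map_comp[OF \<alpha>_linear translate_linear[OF a q]])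
  show "(\<lambda>t. diagonal_translate a q (\<alpha> t)) \<in> linear_map R HH HH"
    by (rule linear_map_comp[OF D \<alpha>_linear])
  fix x z assume x: "x \<in> carrier H" and z: "z \<in> carrier H"
  have "\<alpha> (translate a q (pure_tensor R H H x z)) = sweedler HH (\<lambda>u v. pure_tensor R H H (a \<cdot> x \<cdot> u) v) (z \<cdot> q)"
    by (simp add: translate_pure a q x z \<alpha>_pure)
  also have "\<dots> = sweedler HH (\<lambda>u v. sweedler HH (\<lambda>r s. pure_tensor R H H (a \<cdot> x \<cdot> (u \<cdot> r)) (v \<cdot> s)) q) z"
    by (rule mult_sweedler) (auto intro!: lin mods closed a q x z)
  also have "\<dots> = sweedler HH (\<lambda>u v. diagonal_translate a q (pure_tensor R H H (x \<cdot> u) v)) z"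
  proof (intro tensor_lift_cong mods closed z)
    fix u v assume u: "u \<in> carrier H" and v: "v \<in> carrier H"
    have "diagonal_translate a q (pure_tensor R H H (x \<cdot> u) v) =
        sweedler HH (\<lambda>r s. pure_tensor R H H (a \<cdot> (x \<cdot> u) \<cdot> r) (v \<cdot> s)) q"
      unfolding diagonal_translate_def
      by (rule tensor_lift_pure[OF H_module H_module HH_module b mul_closed[OF x u] v])
    also have "\<dots> = sweedler HH (\<lambda>r s. pure_tensor R H H (a \<cdot> x \<cdot> (u \<cdot> r)) (v \<cdot> s)) q"
      by (intro tensor_lift_cong mods closed q) (simp add: mul_assoc a x u)
    finally show "sweedler HH (\<lambda>r s. pure_tensor R H H (a \<cdot> x \<cdot> (u \<cdot> r)) (v \<cdot> s)) q =
        diagonal_translate a q (pure_tensor R H H (x \<cdot> u) v)" by (rule sym)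
  qed
  also have "\<dots> = diagonal_translate a q (\<alpha> (pure_tensor R H H x z))"
    unfolding \<alpha>_pure[OF x z]
    by (rule linear_map_tensor_lift[OF _ _ _ _ D, symmetric]) (auto intro!: lin mods closed x z)
  finally show "\<alpha> (translate a q (pure_tensor R H H x z)) = diagonal_translate a q (\<alpha> (pure_tensor R H H x z))" .
qed

text \<open>
  This expresses \<open>y \<otimes> bk\<close> as \<open>(y S(k\<^sub>(\<^sub>1\<^sub>)) \<otimes> 1) (1 \<otimes> b) \<Delta>(k\<^sub>(\<^sub>2\<^sub>))\<close>. It reduces membership of \<open>y \<otimes> bk\<close> in \<open>\<alpha>(N)\<close> to that of
  \<open>1 \<otimes> b\<close>.
\<close>

lemma alpha_translate_sum:
  assumes n: "n \<in> carrier HH" "\<alpha> n = pure_tensor R H H \<one>\<^bsub>H\<^esub> b"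
    and b: "b \<in> carrier H" and y: "y \<in> carrier H" and k: "k \<in> carrier H"
  shows "\<alpha> (sweedler HH (\<lambda>p q. translate (y \<cdot> S p) q n) k) = pure_tensor R H H y (b \<cdot> k)"
proof -
  have "\<alpha> (sweedler HH (\<lambda>p q. translate (y \<cdot> S p) q n) k) = sweedler HH (\<lambda>p q. \<alpha> (translate (y \<cdot> S p) q n)) k"
    by (rule linear_map_tensor_lift[OF _ _ _ _ \<alpha>_linear translate_bilinear[OF n(1) y]])
       (intro mods closed k)+
  also have "\<dots> = sweedler HH (\<lambda>p q. sweedler HH (\<lambda>r s. pure_tensor R H H (y \<cdot> (S p \<cdot> r)) (b \<cdot> s)) q) k"
  proof (intro tensor_lift_cong mods closed k)
    fix p q assume p: "p \<in> carrier H" and q: "q \<in> carrier H"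
    have yp: "y \<cdot> S p \<in> carrier H" using y p by (intro closed)
    have "\<alpha> (translate (y \<cdot> S p) q n) = sweedler HH (\<lambda>r s. pure_tensor R H H (y \<cdot> S p \<cdot> \<one>\<^bsub>H\<^esub> \<cdot> r) (b \<cdot> s)) q"
      unfolding alpha_translate[OF yp q n(1)] n(2) diagonal_translate_def
      by (rule tensor_lift_pure[OF H_module H_module HH_module diagonal_translate_bilinear[OF yp q] one_H_closed b])
    also have "\<dots> = sweedler HH (\<lambda>r s. pure_tensor R H H (y \<cdot> (S p \<cdot> r)) (b \<cdot> s)) q"
      using yp y p by (intro tensor_lift_cong mods closed q) (simp add: mul_assoc closed)
    finally show "\<alpha> (translate (y \<cdot> S p) q n) = \<dots>" .
  qed
  also have "\<dots> = sweedler HH (\<lambda>x s. sweedler HH (\<lambda>p r. pure_tensor R H H (y \<cdot> (S p \<cdot> r)) (b \<cdot> s)) x) k"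
    by (rule coassoc_sweedler[symmetric]) (auto intro!: lin mods closed y b k)
  also have "\<dots> = sweedler HH (\<lambda>x s. \<epsilon> x \<odot>\<^bsub>HH\<^esub> pure_tensor R H H (y \<cdot> \<one>\<^bsub>H\<^esub>) (b \<cdot> s)) k"
    by (intro tensor_lift_cong mods closed k antipode_left_sweedler) (auto intro!: lin mods closed y b)
  also have "\<dots> = pure_tensor R H H (y \<cdot> \<one>\<^bsub>H\<^esub>) (b \<cdot> k)"
    by (intro counit_left_sweedler mods k) (auto intro!: lin mods closed y b)
  finally show ?thesis using y by simp
qed

end

context hopf_quotient
begin

text \<open>
  \<open>H \<otimes>\<^sub>B H\<close> is the quotient of \<open>H \<otimes> H\<close> by \<open>balancing\<close>, written \<open>N\<close> in the comments.
\<close>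

definition balancing_rels where
  "balancing_rels = {pure_tensor R H H (h \<cdot> b) h' \<ominus>\<^bsub>HH\<^esub> pure_tensor R H H h (b \<cdot> h') | h b h'.
        h \<in> carrier H \<and> b \<in> B \<and> h' \<in> carrier H}"
definition balancing where "balancing = module_span R HH balancing_rels"
definition B_plus_H where
  "B_plus_H = module_span R H {k \<cdot> h | k h. k \<in> B \<inter> {x \<in> carrier H. \<epsilon> x = \<zero>\<^bsub>R\<^esub>} \<and> h \<in> carrier H}"

lemma relI:
  "\<lbrakk>h \<in> carrier H; b \<in> B; h' \<in> carrier H\<rbrakk> \<Longrightarrow>
    pure_tensor R H H (h \<cdot> b) h' \<ominus>\<^bsub>HH\<^esub> pure_tensor R H H h (b \<cdot> h') \<in> balancing"
  unfolding balancing_def balancing_rels_def by (rule module_span_incl) blast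

lemma balancing_rels_closed: "balancing_rels \<subseteq> carrier HH"
  unfolding balancing_rels_def
  by (auto intro!: abelian_group.minus_closed[OF module.axioms(2)[OF HH_module]] mods closed dest!: B_closed)

lemma balancing_submodule: "submodule balancing R HH"
  unfolding balancing_def by (rule module_span_submodule[OF HH_module balancing_rels_closed])

lemma balancing_sub: "balancing \<subseteq> carrier HH"
  using submodule.axioms(1)[OF balancing_submodule, THEN subgroup.subset] by simp

lemma balancing_quotient: "quotient R HH balancing"
  by (intro quotient.intro quotient_axioms.intro HH_module balancing_submodule)

lemma balancing_least:
  assumes f: "f \<in> linear_map R HH P" and P: "module R P" and L: "submodule L R P"
    and "\<And>h b h'. \<lbrakk>h \<in> carrier H; b \<in> B; h' \<in> carrier H\<rbrakk> \<Longrightarrow>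
      f (pure_tensor R H H (h \<cdot> b) h') \<ominus>\<^bsub>P\<^esub> f (pure_tensor R H H h (b \<cdot> h')) \<in> L"
    and n: "n \<in> balancing"
  shows "f n \<in> L"
proof -
  have "balancing_rels \<subseteq> {t \<in> carrier HH. f t \<in> L}"
  proof
    fix t assume t: "t \<in> balancing_rels"
    then obtain h b h' where h: "h \<in> carrier H" and b: "b \<in> B" and h': "h' \<in> carrier H"
      and eq: "t = pure_tensor R H H (h \<cdot> b) h' \<ominus>\<^bsub>HH\<^esub> pure_tensor R H H h (b \<cdot> h')"
      unfolding balancing_rels_def by blast
    have "f t = f (pure_tensor R H H (h \<cdot> b) h') \<ominus>\<^bsub>P\<^esub> f (pure_tensor R H H h (b \<cdot> h'))"
      unfolding eq using h h' B_closed[OF b] by (intro linear_map_minus[OF f HH_module P] mods closed)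
    then show "t \<in> {t \<in> carrier HH. f t \<in> L}"
      using t balancing_rels_closed assms(4)[OF h b h'] by auto
  qed
  then have "balancing \<subseteq> {t \<in> carrier HH. f t \<in> L}"
    unfolding balancing_def by (rule module_span_least[OF submodule_preimage[OF f HH_module P L]])
  then show ?thesis using n by blast
qed

text \<open>
  The composite of \<open>can\<^sub>Q\<close> with the projection \<open>H \<otimes> H \<rightarrow> H \<otimes>\<^sub>B H\<close>.
\<close>

definition can_lifted where
  "can_lifted = tensor_lift R H H HQ (\<lambda>h h'. tensor_map R H H H Q (\<lambda>x. h \<cdot> x) \<pi> (\<Delta> h'))"

lemma can_lifted_bilinear: "bilinear R H H HQ (\<lambda>h h'. tensor_map R H H H Q (\<lambda>x. h \<cdot> x) \<pi> (\<Delta> h'))"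
  unfolding tensor_map_def by (auto intro!: Qlin Qmods Qclosed)

lemma can_lifted_linear: "can_lifted \<in> linear_map R HH HQ"
  unfolding can_lifted_def by (rule tensor_lift_linear[OF H_module H_module HQ_module can_lifted_bilinear])

lemma can_lifted_pure:
  assumes h: "h \<in> carrier H" and h': "h' \<in> carrier H"
  shows "can_lifted (pure_tensor R H H h h') = sweedler HQ (\<lambda>u v. pure_tensor R H Q (h \<cdot> u) (\<pi> v)) h'"
  unfolding can_lifted_def tensor_lift_pure[OF H_module H_module HQ_module can_lifted_bilinear h h']
  by (simp add: tensor_map_def)

text \<open>
  In terms of the action, \<open>can\<^sub>Q\<close> sends \<open>h \<otimes> h'\<close> to \<open>(h \<otimes> \<pi>(1)) h'\<close>; balancing over \<open>B\<close> then follows from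
  \<open>(h \<otimes> \<pi>(1)) b = hb \<otimes> \<pi>(1)\<close>, which is coinvariance of \<open>b\<close>.
\<close>

lemma can_lifted_act:
  assumes h: "h \<in> carrier H" and h': "h' \<in> carrier H"
  shows "can_lifted (pure_tensor R H H h h') = act (right_unit h) h'"
  unfolding can_lifted_pure[OF h h'] right_unit_def act_pure[OF h one_H_closed h']
  by (intro tensor_lift_cong mods closed h') simp

lemma can_lifted_eq:
  assumes t: "t \<in> carrier HH"
  shows "can_lifted t = tensor_map R H H H Q id \<pi> (\<alpha> t)"
proof (rule tensor_ext[OF H_module H_module can_lifted_linear _ HQ_module _ t])
  note T = tensor_map_linear[OF H_module H_module H_module Q_module id_linear proj_linear]
  show "(\<lambda>t. tensor_map R H H H Q id \<pi> (\<alpha> t)) \<in> linear_map R HH HQ"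
    by (rule linear_map_comp[OF T \<alpha>_linear])
  fix h h' assume h: "h \<in> carrier H" and h': "h' \<in> carrier H"
  have "tensor_map R H H H Q id \<pi> (\<alpha> (pure_tensor R H H h h')) =
      sweedler HQ (\<lambda>u v. tensor_map R H H H Q id \<pi> (pure_tensor R H H (h \<cdot> u) v)) h'"
    unfolding \<alpha>_pure[OF h h']
    by (rule linear_map_tensor_lift[OF _ _ _ _ T]) (auto intro!: Qlin Qmods Qclosed h h')
  also have "\<dots> = can_lifted (pure_tensor R H H h h')"
    unfolding can_lifted_pure[OF h h']
    by (intro tensor_lift_cong mods closed h')
       (simp add: tensor_map_pure[OF H_module H_module H_module Q_module id_linear proj_linear] h closed)
  finally show "can_lifted (pure_tensor R H H h h') = tensor_map R H H H Q id \<pi> (\<alpha> (pure_tensor R H H h h'))"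
    by (rule sym)
qed

lemma act_right_unit:
  assumes h: "h \<in> carrier H" and b: "b \<in> B"
  shows "act (right_unit h) b = right_unit (h \<cdot> b)"
proof -
  have bH: "b \<in> carrier H" using b by (rule B_closed)
  let ?l = "tensor_map R H Q H Q (\<lambda>x. h \<cdot> x) id"
  have m: "(\<lambda>x. h \<cdot> x) \<in> linear_map R H H" using h by (intro lin)
  note l = tensor_map_linear[OF H_module Q_module H_module Q_module m id_linear]
  note lp = tensor_map_pure[OF H_module Q_module H_module Q_module m id_linear]
  have "?l (\<delta> b) = sweedler HQ (\<lambda>u v. ?l (pure_tensor R H Q u (\<pi> v))) b"
    unfolding delta_eq
    by (rule linear_map_tensor_lift[OF _ _ _ _ l]) (auto intro!: Qlin Qmods Qclosed bH)
  also have "\<dots> = act (right_unit h) b"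
    unfolding can_lifted_act[OF h bH, symmetric] can_lifted_pure[OF h bH]
    by (intro tensor_lift_cong mods closed bH) (simp add: lp Qclosed)
  finally show ?thesis
    by (simp add: delta_B[OF b] lp bH Qclosed right_unit_def)
qed

lemma can_lifted_balancing: "n \<in> balancing \<Longrightarrow> can_lifted n = \<zero>\<^bsub>HQ\<^esub>"
proof -
  assume n: "n \<in> balancing"
  have "can_lifted n \<in> {\<zero>\<^bsub>HQ\<^esub>}"
  proof (rule balancing_least[OF can_lifted_linear HQ_module submodule_zero[OF HQ_module] _ n])
    fix h b h' assume h: "h \<in> carrier H" and b: "b \<in> B" and h': "h' \<in> carrier H"
    have bH: "b \<in> carrier H" using b by (rule B_closed)
    have "can_lifted (pure_tensor R H H h (b \<cdot> h')) = act (act (right_unit h) b) h'"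
      using act_right_action h h' bH by (simp add: can_lifted_act closed right_action_def right_unit_closed)
    also have "\<dots> = can_lifted (pure_tensor R H H (h \<cdot> b) h')"
      using h h' bH by (simp add: act_right_unit b can_lifted_act closed)
    finally have eq: "can_lifted (pure_tensor R H H (h \<cdot> b) h') = can_lifted (pure_tensor R H H h (b \<cdot> h'))" by (rule sym)
    have "can_lifted (pure_tensor R H H h (b \<cdot> h')) \<in> carrier HQ"
      using h h' bH by (intro linear_map_closed[OF can_lifted_linear] mods closed)
    then show "can_lifted (pure_tensor R H H (h \<cdot> b) h') \<ominus>\<^bsub>HQ\<^esub> can_lifted (pure_tensor R H H h (b \<cdot> h')) \<in> {\<zero>\<^bsub>HQ\<^esub>}"
      unfolding eq using abelian_group.minus_eq_zero_iff[OF module.axioms(2)[OF HQ_module]] by blast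
  qed
  then show ?thesis by simp
qed

lemma can_lifted_surj: "can_lifted ` carrier HH = carrier HQ"
proof (intro equalityI subsetI)
  fix v assume v: "v \<in> carrier HQ"
  show "v \<in> can_lifted ` carrier HH"
  proof (rule tensor_spanned[OF H_module Q_module submodule_image[OF can_lifted_linear HH_module HQ_module] _ v])
    fix y d assume y: "y \<in> carrier H" and "d \<in> carrier Q"
    then obtain z where z: "z \<in> carrier H" "d = \<pi> z" using proj_surj by blast
    have p: "pure_tensor R H H y z \<in> carrier HH" using y z by (intro mods closed)
    have a: "\<alpha>' (pure_tensor R H H y z) \<in> carrier HH" by (rule linear_map_closed[OF \<alpha>'_linear p])
    have eq: "can_lifted (\<alpha>' (pure_tensor R H H y z)) = pure_tensor R H Q y d"
      unfolding can_lifted_eq[OF a] \<alpha>_\<alpha>'[OF p] z(2)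
      by (simp add: tensor_map_pure[OF H_module H_module H_module Q_module id_linear proj_linear] y z)
    show "pure_tensor R H Q y d \<in> can_lifted ` carrier HH" unfolding eq[symmetric] by (rule imageI[OF a])
  qed
next
  fix v assume "v \<in> can_lifted ` carrier HH"
  then show "v \<in> carrier HQ" by (rule imageE) (simp add: linear_map_closed[OF can_lifted_linear])
qed

text \<open>
  Surjectivity is automatic because \<open>\<alpha>\<close> and \<open>id \<otimes> \<pi>\<close> are onto.
\<close>

lemma galois_iff: "galois_extension R H \<Delta> Q \<longleftrightarrow> (\<forall>t\<in>carrier HH. can_lifted t = \<zero>\<^bsub>HQ\<^esub> \<longrightarrow> t \<in> balancing)"
proof -
  let ?M = "quot_module HH balancing"
  have bal: "balanced_tensor R H B = ?M"
    by (simp add: balanced_tensor_def balancing_def balancing_rels_def)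
  have can: "can_map R H \<Delta> Q = quot_lift can_lifted"
    by (simp add: can_map_def can_lifted_def)
  have k: "\<forall>n\<in>balancing. can_lifted n = \<zero>\<^bsub>HQ\<^esub>" by (simp add: can_lifted_balancing)
  note can_coset = quotient.quot_lift_coset[OF balancing_quotient can_lifted_linear HQ_module k]
  note can_linear = quotient.quot_lift_linear[OF balancing_quotient can_lifted_linear HQ_module k]
  note M = quotient.module_quot[OF balancing_quotient]
  have car: "carrier ?M = (\<lambda>t. balancing +>\<^bsub>HH\<^esub> t) ` carrier HH"
    by (rule quotient.quot_carrier[OF balancing_quotient])
  have z: "balancing +>\<^bsub>HH\<^esub> t = \<zero>\<^bsub>?M\<^esub> \<longleftrightarrow> t \<in> balancing" if "t \<in> carrier HH" for t
    by (rule quotient.coset_eq_zero_iff[OF balancing_quotient that])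
  have surj: "quot_lift can_lifted ` carrier ?M = carrier HQ"
    unfolding car image_image can_lifted_surj[symmetric] by (rule image_cong[OF refl can_coset])
  have "inj_on (quot_lift can_lifted) (carrier ?M) \<longleftrightarrow> (\<forall>t\<in>carrier HH. can_lifted t = \<zero>\<^bsub>HQ\<^esub> \<longrightarrow> t \<in> balancing)"
  proof
    assume inj: "inj_on (quot_lift can_lifted) (carrier ?M)"
    show "\<forall>t\<in>carrier HH. can_lifted t = \<zero>\<^bsub>HQ\<^esub> \<longrightarrow> t \<in> balancing"
    proof (intro ballI impI)
      fix t assume t: "t \<in> carrier HH" and 0: "can_lifted t = \<zero>\<^bsub>HQ\<^esub>"
      have "quot_lift can_lifted (balancing +>\<^bsub>HH\<^esub> t) = quot_lift can_lifted \<zero>\<^bsub>?M\<^esub>"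
        using linear_map_zero[OF can_linear M HQ_module] by (simp add: can_coset t 0)
      then have "balancing +>\<^bsub>HH\<^esub> t = \<zero>\<^bsub>?M\<^esub>"
        by (rule inj_onD[OF inj])
           (simp_all add: t quotient.coset_in_quot[OF balancing_quotient]
             abelian_monoid.zero_closed[OF abelian_group.axioms(1)[OF module.axioms(2)[OF M]]])
      then show "t \<in> balancing" unfolding z[OF t] .
    qed
  next
    assume r: "\<forall>t\<in>carrier HH. can_lifted t = \<zero>\<^bsub>HQ\<^esub> \<longrightarrow> t \<in> balancing"
    show "inj_on (quot_lift can_lifted) (carrier ?M)"
    proof (rule linear_map_injI[OF can_linear M HQ_module])
      fix X assume "X \<in> carrier ?M" and 0: "quot_lift can_lifted X = \<zero>\<^bsub>HQ\<^esub>"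
      then obtain t where t: "t \<in> carrier HH" "X = balancing +>\<^bsub>HH\<^esub> t" unfolding car by (auto elim: imageE)
      have "can_lifted t = \<zero>\<^bsub>HQ\<^esub>" using 0 unfolding t(2) can_coset[OF t(1)] .
      then have "t \<in> balancing" using r t(1) by simp
      then show "X = \<zero>\<^bsub>?M\<^esub>" unfolding t(2) z[OF t(1)] .
    qed
  qed
  then show ?thesis
    unfolding galois_extension_def bal can bij_betw_def using surj by simp
qed

lemma B_plus_H_sub: "{k \<cdot> h | k h. k \<in> B \<inter> {x \<in> carrier H. \<epsilon> x = \<zero>\<^bsub>R\<^esub>} \<and> h \<in> carrier H} \<subseteq> carrier H"
  by auto

lemma B_plus_H_submodule: "submodule B_plus_H R H"
  unfolding B_plus_H_def by (rule module_span_submodule[OF H_module B_plus_H_sub])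

lemma B_plus_H_incl: "\<lbrakk>k \<in> B; \<epsilon> k = \<zero>\<^bsub>R\<^esub>; h \<in> carrier H\<rbrakk> \<Longrightarrow> k \<cdot> h \<in> B_plus_H"
  unfolding B_plus_H_def by (rule module_span_incl) (use B_closed in blast)

text \<open>
  Applying \<open>\<epsilon> \<otimes> id\<close> to \<open>\<delta>(k) = k \<otimes> \<pi>(1)\<close> gives \<open>\<pi>(k) = \<epsilon>(k) \<pi>(1)\<close>.
\<close>

lemma B_plus_H_subset: "B_plus_H \<subseteq> J"
  unfolding B_plus_H_def
proof (rule module_span_least[OF J_submodule], safe)
  fix k h assume k: "k \<in> B" "k \<in> carrier H" "\<epsilon> k = \<zero>\<^bsub>R\<^esub>" and h: "h \<in> carrier H"
  let ?e = "tensor_lift R H Q Q (\<lambda>x d. \<epsilon> x \<odot>\<^bsub>Q\<^esub> d)"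
  have b: "bilinear R H Q Q (\<lambda>x d. \<epsilon> x \<odot>\<^bsub>Q\<^esub> d)" by (auto intro!: Qlin Qmods Qclosed)
  note e = tensor_lift_linear[OF H_module Q_module Q_module b]
  note ep = tensor_lift_pure[OF H_module Q_module Q_module b]
  have "?e (\<delta> k) = sweedler Q (\<lambda>x y. ?e (pure_tensor R H Q x (\<pi> y))) k"
    unfolding delta_eq by (rule linear_map_tensor_lift[OF _ _ _ _ e]) (auto intro!: Qlin Qmods Qclosed k)
  also have "\<dots> = sweedler Q (\<lambda>x y. \<epsilon> x \<odot>\<^bsub>Q\<^esub> \<pi> y) k"
    by (intro tensor_lift_cong mods closed k) (simp add: ep Qclosed)
  also have "\<dots> = \<pi> k" by (rule counit_left_sweedler[OF Q_module proj_linear k(2)])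
  finally have "\<pi> k = \<epsilon> k \<odot>\<^bsub>Q\<^esub> \<pi> \<one>\<^bsub>H\<^esub>"
    by (simp add: delta_B[OF k(1)] ep k(2) Qclosed)
  also have "\<dots> = \<zero>\<^bsub>Q\<^esub>"
    unfolding k(3) by (rule module.smult_l_null[OF Q_module]) (intro Qclosed)
  finally show "k \<cdot> h \<in> J" using J_right k h by (simp add: proj_zero_iff)
qed

text \<open>
  For \<open>x \<in> J\<close>, the element \<open>n = \<alpha>'(1 \<otimes> x)\<close> is in the kernel of the lifted canonical map, hence in \<open>N\<close>. The map
  \<open>(\<epsilon> \<otimes> id) \<circ> \<alpha>\<close>, which is \<open>h \<otimes> h' \<mapsto> \<epsilon>(h) h'\<close>, sends \<open>n\<close> to \<open>x\<close> and \<open>N\<close> into \<open>B\<^sup>+H\<close>.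
\<close>

lemma galois_imp_B_plus_H:
  assumes inj: "\<And>t. t \<in> carrier HH \<Longrightarrow> can_lifted t = \<zero>\<^bsub>HQ\<^esub> \<Longrightarrow> t \<in> balancing"
  shows "J \<subseteq> B_plus_H"
proof
  fix x assume x: "x \<in> J"
  then have xH: "x \<in> carrier H" using submodule.axioms(1)[OF J_submodule, THEN subgroup.subset] by auto
  have p: "pure_tensor R H H \<one>\<^bsub>H\<^esub> x \<in> carrier HH" using xH by (intro mods closed)
  define n where "n = \<alpha>' (pure_tensor R H H \<one>\<^bsub>H\<^esub> x)"
  have n: "n \<in> carrier HH" unfolding n_def by (rule linear_map_closed[OF \<alpha>'_linear p])
  have an: "\<alpha> n = pure_tensor R H H \<one>\<^bsub>H\<^esub> x" unfolding n_def by (rule \<alpha>_\<alpha>'[OF p])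
  have "can_lifted n = pure_tensor R H Q \<one>\<^bsub>H\<^esub> (\<pi> x)"
    unfolding can_lifted_eq[OF n] an
    by (simp add: tensor_map_pure[OF H_module H_module H_module Q_module id_linear proj_linear] xH)
  also have "\<dots> = pure_tensor R H Q \<one>\<^bsub>H\<^esub> \<zero>\<^bsub>Q\<^esub>" using proj_zero_iff[OF xH] x by simp
  also have "\<dots> = \<zero>\<^bsub>HQ\<^esub>"
    by (rule linear_map_zero[OF bilinear_right[OF pure_tensor_bilinear[OF H_module Q_module] one_H_closed] Q_module HQ_module])
  finally have nN: "n \<in> balancing" by (rule inj[OF n])
  let ?e = "tensor_lift R H H H (\<lambda>y z. \<epsilon> y \<odot>\<^bsub>H\<^esub> z)"
  have b: "bilinear R H H H (\<lambda>y z. \<epsilon> y \<odot>\<^bsub>H\<^esub> z)" by (auto intro!: lin mods closed)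
  note e = tensor_lift_linear[OF H_module H_module H_module b]
  note ep = tensor_lift_pure[OF H_module H_module H_module b]
  have ea: "?e (\<alpha> (pure_tensor R H H h h')) = \<epsilon> h \<odot>\<^bsub>H\<^esub> h'" if h: "h \<in> carrier H" and h': "h' \<in> carrier H" for h h'
  proof -
    have "?e (\<alpha> (pure_tensor R H H h h')) = sweedler H (\<lambda>u v. ?e (pure_tensor R H H (h \<cdot> u) v)) h'"
      unfolding \<alpha>_pure[OF h h'] by (rule linear_map_tensor_lift[OF _ _ _ _ e]) (auto intro!: lin mods closed h h')
    also have "\<dots> = sweedler H (\<lambda>u v. \<epsilon> u \<odot>\<^bsub>H\<^esub> (\<epsilon> h \<odot>\<^bsub>H\<^esub> v)) h'"
      using cring.cring_simprules(14)[OF cring_R] counit_closed h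
      by (intro tensor_lift_cong mods closed h')
         (simp add: ep h closed counit_mult module.smult_assoc1[OF H_module, symmetric])
    also have "\<dots> = \<epsilon> h \<odot>\<^bsub>H\<^esub> h'" by (intro counit_left_sweedler mods h') (auto intro!: lin mods closed h)
    finally show ?thesis .
  qed
  have "?e (\<alpha> n) \<in> B_plus_H"
  proof (rule balancing_least[OF linear_map_comp[OF e \<alpha>_linear] H_module B_plus_H_submodule _ nN])
    fix h b h' assume h: "h \<in> carrier H" and b: "b \<in> B" and h': "h' \<in> carrier H"
    have bH: "b \<in> carrier H" using b by (rule B_closed)
    \<comment> \<open>The relation is sent to \<open>\<epsilon>(hb)h' - \<epsilon>(h)bh'\<close>, the product of \<open>\<epsilon>(b)1 - b \<in> B\<^sup>+\<close> and \<open>\<epsilon>(h)h'\<close>.\<close>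
    let ?k = "\<epsilon> b \<odot>\<^bsub>H\<^esub> \<one>\<^bsub>H\<^esub> \<ominus>\<^bsub>H\<^esub> b" and ?h = "\<epsilon> h \<odot>\<^bsub>H\<^esub> h'"
    have kB: "?k \<in> B"
      by (intro submodule_minus[OF B_submodule H_module] submodule.smult_closed[OF B_submodule] one_in_B b closed bH)
    have ek: "\<epsilon> ?k = \<zero>\<^bsub>R\<^esub>"
    proof -
      note Rm = module_regular[OF cring_R]
      have "\<epsilon> ?k = \<epsilon> b \<odot>\<^bsub>regular_module R\<^esub> \<epsilon> \<one>\<^bsub>H\<^esub> \<ominus>\<^bsub>regular_module R\<^esub> \<epsilon> b"
        using linear_map_minus[OF counit_linear H_module Rm] linear_map_smult[OF counit_linear] bH
        by (simp add: closed mods)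
      also have "\<dots> = \<epsilon> b \<ominus>\<^bsub>regular_module R\<^esub> \<epsilon> b"
        using counit_closed[OF bH] by (simp add: counit_one regular_module_def)
      also have "\<dots> = \<zero>\<^bsub>regular_module R\<^esub>"
        using abelian_group.minus_eq_zero_iff[OF module.axioms(2)[OF Rm]] linear_map_closed[OF counit_linear bH] by blast
      finally show ?thesis by (simp add: regular_module_def)
    qed
    have "?e (\<alpha> (pure_tensor R H H (h \<cdot> b) h')) \<ominus>\<^bsub>H\<^esub> ?e (\<alpha> (pure_tensor R H H h (b \<cdot> h'))) =
        (\<epsilon> b \<odot>\<^bsub>H\<^esub> \<one>\<^bsub>H\<^esub>) \<cdot> ?h \<ominus>\<^bsub>H\<^esub> b \<cdot> ?h"
      using h bH h' cring.cring_simprules(14)[OF cring_R]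
      by (simp add: ea closed counit_mult smult_mult_left smult_mult_right H_module
          module.smult_assoc1[OF H_module, symmetric])
    also have "\<dots> = ?k \<cdot> ?h"
      using linear_map_minus[OF bilinear_left[OF mul_bilinear] H_module H_module] bH h h'
      by (simp add: closed H_module)
    also have "\<dots> \<in> B_plus_H" by (rule B_plus_H_incl[OF kB ek]) (intro closed H_module h h')
    finally show "?e (\<alpha> (pure_tensor R H H (h \<cdot> b) h')) \<ominus>\<^bsub>H\<^esub> ?e (\<alpha> (pure_tensor R H H h (b \<cdot> h'))) \<in> B_plus_H" .
  qed
  then show "x \<in> B_plus_H" unfolding an by (simp add: ep xH counit_one H_smult_one H_module)
qed

lemma translate_balancing:
  assumes a: "a \<in> carrier H" and q: "q \<in> carrier H" and n: "n \<in> balancing"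
  shows "translate a q n \<in> balancing"
proof (rule balancing_least[OF translate_linear[OF a q] HH_module balancing_submodule _ n])
  fix h b h' assume h: "h \<in> carrier H" and b: "b \<in> B" and h': "h' \<in> carrier H"
  have bH: "b \<in> carrier H" using b by (rule B_closed)
  show "translate a q (pure_tensor R H H (h \<cdot> b) h') \<ominus>\<^bsub>HH\<^esub> translate a q (pure_tensor R H H h (b \<cdot> h')) \<in> balancing"
    using relI[of "a \<cdot> h" b "h' \<cdot> q"] a q h h' b bH by (simp add: translate_pure closed mul_assoc)
qed

end

context flat_hopf_quotient
begin

text \<open>
  The element is \<open>S(b\<^sub>(\<^sub>1\<^sub>)) \<otimes> b\<^sub>(\<^sub>2\<^sub>)\<close>. As \<open>\<Delta>(b)\<close> comes from \<open>H \<otimes> B\<close>, it is congruent to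
  \<open>S(b\<^sub>(\<^sub>1\<^sub>)) b\<^sub>(\<^sub>2\<^sub>) \<otimes> 1 = \<epsilon>(b) (1 \<otimes> 1) = 0\<close> modulo the balancing relations.
\<close>

lemma alpha'_B_plus:
  assumes b: "b \<in> B" and 0: "\<epsilon> b = \<zero>\<^bsub>R\<^esub>"
  shows "\<alpha>' (pure_tensor R H H \<one>\<^bsub>H\<^esub> b) \<in> balancing"
proof -
  have bH: "b \<in> carrier H" using b by (rule B_closed)
  let ?P1 = "tensor_lift R H H HH (\<lambda>u v. pure_tensor R H H (S u) v)"
  let ?P2 = "tensor_lift R H H HH (\<lambda>u v. pure_tensor R H H (S u \<cdot> v) \<one>\<^bsub>H\<^esub>)"
  have b1: "bilinear R H H HH (\<lambda>u v. pure_tensor R H H (S u) v)"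
    and b2: "bilinear R H H HH (\<lambda>u v. pure_tensor R H H (S u \<cdot> v) \<one>\<^bsub>H\<^esub>)"
    by (auto intro!: lin mods closed)
  note l1 = tensor_lift_linear[OF H_module H_module HH_module b1]
    and l2 = tensor_lift_linear[OF H_module H_module HH_module b2]
  note p = tensor_lift_pure[OF H_module H_module HH_module b1] tensor_lift_pure[OF H_module H_module HH_module b2]
  have "\<Delta> b \<in> {t \<in> carrier HH. ?P2 t \<ominus>\<^bsub>HH\<^esub> ?P1 t \<in> balancing}"
  proof (rule comult_B_mem[OF submodule_preimage[OF linear_map_diff[OF l2 l1 HH_module] HH_module HH_module balancing_submodule] _ b])
    fix h c assume h: "h \<in> carrier H" and c: "c \<in> B"
    then show "pure_tensor R H H h c \<in> {t \<in> carrier HH. ?P2 t \<ominus>\<^bsub>HH\<^esub> ?P1 t \<in> balancing}"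
      using relI[of "S h" c "\<one>\<^bsub>H\<^esub>"] B_closed[OF c] by (simp add: p closed mods)
  qed
  moreover have "?P2 (\<Delta> b) = \<zero>\<^bsub>HH\<^esub>"
  proof -
    have "?P2 (\<Delta> b) = \<epsilon> b \<odot>\<^bsub>HH\<^esub> pure_tensor R H H \<one>\<^bsub>H\<^esub> \<one>\<^bsub>H\<^esub>"
      by (rule antipode_left_sweedler[OF HH_module _ bH]) (auto intro!: lin mods closed)
    then show ?thesis
      unfolding 0 by (simp add: module.smult_l_null[OF HH_module] closed mods)
  qed
  moreover have "\<alpha>' (pure_tensor R H H \<one>\<^bsub>H\<^esub> b) = ?P1 (\<Delta> b)"
    unfolding \<alpha>'_pure[OF one_H_closed bH]
    by (intro tensor_lift_cong mods closed bH) (simp add: closed)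
  moreover have c1: "?P1 (\<Delta> b) \<in> carrier HH" by (rule linear_map_closed[OF l1 comult_closed[OF bH]])
  ultimately have "\<zero>\<^bsub>HH\<^esub> \<ominus>\<^bsub>HH\<^esub> \<alpha>' (pure_tensor R H H \<one>\<^bsub>H\<^esub> b) \<in> balancing" by simp
  then have "\<zero>\<^bsub>HH\<^esub> \<ominus>\<^bsub>HH\<^esub> (\<zero>\<^bsub>HH\<^esub> \<ominus>\<^bsub>HH\<^esub> \<alpha>' (pure_tensor R H H \<one>\<^bsub>H\<^esub> b)) \<in> balancing"
    by (rule submodule_minus[OF balancing_submodule HH_module submodule_zero_mem[OF balancing_submodule]])
  moreover have "\<alpha>' (pure_tensor R H H \<one>\<^bsub>H\<^esub> b) \<in> carrier HH"
    using linear_map_closed[OF \<alpha>'_linear] bH by (simp add: closed mods)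
  ultimately show ?thesis
    by (simp only: abelian_group.zero_minus_zero_minus[OF module.axioms(2)[OF HH_module]])
qed

lemma alpha'_B_plus_H:
  assumes y: "y \<in> carrier H" and m: "m \<in> B_plus_H"
  shows "\<alpha>' (pure_tensor R H H y m) \<in> balancing"
proof -
  have l: "(\<lambda>m. \<alpha>' (pure_tensor R H H y m)) \<in> linear_map R H HH"
    by (rule linear_map_comp[OF \<alpha>'_linear bilinear_right[OF pure_tensor_bilinear[OF H_module H_module] y]])
  have "B_plus_H \<subseteq> {m \<in> carrier H. \<alpha>' (pure_tensor R H H y m) \<in> balancing}"
    unfolding B_plus_H_def
  proof (rule module_span_least[OF submodule_preimage[OF l H_module HH_module balancing_submodule]], rule subsetI)
    fix x assume "x \<in> {k \<cdot> h |k h. k \<in> B \<inter> {x \<in> carrier H. \<epsilon> x = \<zero>\<^bsub>R\<^esub>} \<and> h \<in> carrier H}"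
    then obtain b k where b: "b \<in> B" "b \<in> carrier H" "\<epsilon> b = \<zero>\<^bsub>R\<^esub>" and k: "k \<in> carrier H" and x: "x = b \<cdot> k"
      by blast
    let ?n = "\<alpha>' (pure_tensor R H H \<one>\<^bsub>H\<^esub> b)"
    have pc: "pure_tensor R H H \<one>\<^bsub>H\<^esub> b \<in> carrier HH" using b by (intro mods closed)
    have nN: "?n \<in> balancing" by (rule alpha'_B_plus[OF b(1,3)])
    have n: "?n \<in> carrier HH" by (rule linear_map_closed[OF \<alpha>'_linear pc])
    let ?m = "sweedler HH (\<lambda>p q. translate (y \<cdot> S p) q ?n) k"
    have mN: "?m \<in> balancing"
      by (rule tensor_lift_mem[OF H_module H_module HH_module translate_bilinear[OF n y] balancing_submodule])
         (auto intro!: translate_balancing nN closed y k)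
    have "\<alpha>' (\<alpha> ?m) = ?m" using mN balancing_sub by (intro \<alpha>'_\<alpha>) blast
    then have "\<alpha>' (pure_tensor R H H y x) \<in> balancing"
      using mN alpha_translate_sum[OF n \<alpha>_\<alpha>'[OF pc] b(2) y k] x by simp
    then show "x \<in> {m \<in> carrier H. \<alpha>' (pure_tensor R H H y m) \<in> balancing}"
      using b k x by simp
  qed
  then show ?thesis using m by blast
qed

text \<open>
  If \<open>J = B\<^sup>+H\<close>, right exactness reduces injectivity to the claim \<open>\<alpha>'(y \<otimes> m) \<in> N\<close> for \<open>m \<in> B\<^sup>+H\<close>.
\<close>

lemma extension_iff: "galois_extension R H \<Delta> Q \<longleftrightarrow> B_plus_H = J"
proof
  assume "galois_extension R H \<Delta> Q"
  then have "J \<subseteq> B_plus_H" unfolding galois_iff by (intro galois_imp_B_plus_H) simp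
  then show "B_plus_H = J" using B_plus_H_subset by (rule subset_antisym[rotated])
next
  assume eq: "B_plus_H = J"
  show "galois_extension R H \<Delta> Q"
    unfolding galois_iff
  proof (intro ballI impI)
    fix t assume t: "t \<in> carrier HH" and 0: "can_lifted t = \<zero>\<^bsub>HQ\<^esub>"
    have at: "\<alpha> t \<in> carrier HH" by (rule linear_map_closed[OF \<alpha>_linear t])
    have "\<alpha> t \<in> {y \<in> carrier HH. \<alpha>' y \<in> balancing}"
    proof (rule right_exact[OF H_module H_module Q_module proj_linear proj_surj
          submodule_preimage[OF \<alpha>'_linear HH_module HH_module balancing_submodule] _ at])
      show "tensor_map R H H H Q id \<pi> (\<alpha> t) = \<zero>\<^bsub>HQ\<^esub>" using 0 can_lifted_eq[OF t] by simp
      fix p m assume p: "p \<in> carrier H" and m: "m \<in> carrier H" "\<pi> m = \<zero>\<^bsub>Q\<^esub>"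
      then have "m \<in> B_plus_H" using proj_zero_iff eq by blast
      then show "pure_tensor R H H p m \<in> {y \<in> carrier HH. \<alpha>' y \<in> balancing}"
        using alpha'_B_plus_H p m by (simp add: closed mods)
    qed
    then show "t \<in> balancing" using \<alpha>'_\<alpha>[OF t] by simp
  qed
qed

end

lemma closed_quotient_iff:
  fixes R :: "('r, 'a) ring_scheme" and H :: "('r, 'h, 'b) module_scheme"
  assumes hopf: "hopf_algebra R H \<Delta> \<epsilon> S"
    and flat: "flat_module TYPE(('h \<times> 'h set \<Rightarrow> 'r) set) R H"
    and Q: "Q \<in> quot_gen R H \<Delta> \<epsilon>"
  shows "closed_in_B (hopf_galcon R H \<Delta> \<epsilon>) Q \<longleftrightarrow> galois_extension R H \<Delta> Q"
proof -
  obtain I where I: "right_ideal I H" "coideal I R H \<Delta> \<epsilon>" and QI: "Q = quot_module H I"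
    using Q unfolding quot_gen_def by blast
  have "hopf_quotient R H \<Delta> \<epsilon> S I"
    using I by (intro hopf_quotient.intro hopf hopf_quotient_axioms.intro)
      (simp_all add: coideal_def right_ideal_def)
  then have quot: "flat_hopf_quotient R H \<Delta> \<epsilon> S I"
    by (intro flat_hopf_quotient.intro flat_hopf_quotient_axioms.intro flat)
  interpret flat_hopf_quotient R H \<Delta> \<epsilon> S I by (rule quot)
  have "closed_in_B (hopf_galcon R H \<Delta> \<epsilon>) Q \<longleftrightarrow> quot_module H B_plus_H = quot_module H I"
    using Q by (simp add: closed_in_B_def hopf_galcon_def quot_of_sub_def B_plus_H_def QI)
  \<comment> \<open>A quotient module determines the submodule, which is its zero element.\<close>
  also have "\<dots> \<longleftrightarrow> B_plus_H = I"
  proof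
    assume "quot_module H B_plus_H = quot_module H I"
    then have "\<zero>\<^bsub>quot_module H B_plus_H\<^esub> = \<zero>\<^bsub>quot_module H I\<^esub>" by (rule arg_cong)
    then show "B_plus_H = I" by (simp add: quot_module_def)
  qed simp
  finally show ?thesis by (simp only: extension_iff QI)
qed

lemma closed_subalgebra_iff:
  fixes R :: "('r, 'a) ring_scheme" and H :: "('r, 'h, 'b) module_scheme"
  assumes hopf: "hopf_algebra R H \<Delta> \<epsilon> S"
    and flat: "flat_module TYPE(('h \<times> 'h set \<Rightarrow> 'r) set) R H"
    and K: "K \<in> sub_gen R H \<Delta>"
  shows "closed_in_A (hopf_galcon R H \<Delta> \<epsilon>) K \<longleftrightarrow> galois_coextension R H \<Delta> \<epsilon> K"
proof -
  interpret hopf_algebra R H \<Delta> \<epsilon> S by (rule hopf)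
  have Ksub: "submodule K R H" using K by (simp add: sub_gen_def)
  let ?X = "{k \<cdot> h | k h. k \<in> K \<inter> {x \<in> carrier H. \<epsilon> x = \<zero>\<^bsub>R\<^esub>} \<and> h \<in> carrier H}"
  define J where "J = module_span R H ?X"
  have Q: "quot_of_sub R H \<epsilon> K = quot_module H J" by (simp add: quot_of_sub_def J_def)
  have X: "?X \<subseteq> carrier H" by auto
  have J: "submodule J R H" unfolding J_def by (rule module_span_submodule[OF H_module X])
  have JH: "x \<cdot> h \<in> J" if x: "x \<in> J" and h: "h \<in> carrier H" for x h
  proof -
    have "?X \<subseteq> {x \<in> carrier H. x \<cdot> h \<in> J}"
    proof
      fix x assume "x \<in> ?X"
      then obtain k h' where k: "k \<in> K \<inter> {x \<in> carrier H. \<epsilon> x = \<zero>\<^bsub>R\<^esub>}" "h' \<in> carrier H" and x: "x = k \<cdot> h'"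
        by blast
      then have "x \<cdot> h = k \<cdot> (h' \<cdot> h)" using h by (simp add: mul_assoc)
      moreover have "k \<cdot> (h' \<cdot> h) \<in> J"
        unfolding J_def using k mul_closed[OF k(2) h] by (intro module_span_incl) blast
      ultimately show "x \<in> {x \<in> carrier H. x \<cdot> h \<in> J}" using k x by simp
    qed
    from module_span_least[OF submodule_preimage[OF bilinear_left[OF mul_bilinear h] H_module H_module J] this, folded J_def]
    show ?thesis using x by auto
  qed
  have J0: "\<epsilon> x = \<zero>\<^bsub>R\<^esub>" if "x \<in> J" for x
  proof -
    have 0: "\<zero>\<^bsub>regular_module R\<^esub> = \<zero>\<^bsub>R\<^esub>" by (simp add: regular_module_def)
    have "?X \<subseteq> {x \<in> carrier H. \<epsilon> x = \<zero>\<^bsub>regular_module R\<^esub>}"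
      by (auto simp: 0 counit_mult counit_closed)
    from module_span_least[OF submodule_kernel[OF counit_linear H_module module_regular[OF cring_R]] this, folded J_def]
    show ?thesis using that 0 by auto
  qed
  have "coextension R H \<Delta> \<epsilon> S J K"
    by (intro coextension.intro flat_hopf_quotient.intro hopf_quotient.intro hopf_quotient_axioms.intro
        flat_hopf_quotient_axioms.intro coextension_axioms.intro hopf flat J JH J0 Ksub)
  then have iff: "galois_coextension R H \<Delta> \<epsilon> K \<longleftrightarrow> coinvariants R H \<Delta> (quot_module H J) = K"
    unfolding galois_coextension_def Q by (rule coextension.coextension_iff)
  show ?thesis
    unfolding iff using K by (simp add: closed_in_A_def hopf_galcon_def Q)
qed

theorem theorem4p6p2:
  fixes R :: "('r, 'a) ring_scheme" and H :: "('r, 'h, 'b) module_scheme"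
  assumes "hopf_algebra R H \<Delta> \<epsilon> S"
    and "flat_module TYPE(('h \<times> 'h set \<Rightarrow> 'r) set) R H"
  shows "(\<forall>Q \<in> quot_gen R H \<Delta> \<epsilon>.
      closed_in_B (hopf_galcon R H \<Delta> \<epsilon>) Q \<longleftrightarrow> galois_extension R H \<Delta> Q) \<and>
    (\<forall>K \<in> sub_gen R H \<Delta>.
      closed_in_A (hopf_galcon R H \<Delta> \<epsilon>) K \<longleftrightarrow> galois_coextension R H \<Delta> \<epsilon> K)"
  using closed_quotient_iff[OF assms] closed_subalgebra_iff[OF assms] by simp

end
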